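(* Let $M$ be an $\mathbb N$-valued random variable with $\mathbb E[M^p]<\infty$ for some $p>1$, such that $\mathbb P(M=k)=L(k)k^{-\tau_M}$ for all $k\in\mathbb N$, where $L$ is slowly varying and $\tau_M\ge p$. Let $\delta>-\inf\operatorname{supp}(M)$, and let $(G_n)_{n\ge1}$ be a sequence of generalised preferential attachment graphs (model (A), (B) or (D)) with out-degree distribution $M$ and parameter $\delta$. Let $d_v(n)$ be the degree of vertex $v$ in $G_n$. Then there are numbers $(p_k)_{k\ge1}$ and a slowly varying function $L^{(\varnothing)}$ such that, for all $k\ge1$, $$\frac1n\sum_{v\in[n]}\mathbf 1\{d_v(n)=k\}\ \overset{\mathbb P}{\to}\ p_k=L^{(\varnothing)}(k)\,k^{-\tau},$$ where $\tau=\min\{\tau_M,\tau_e\}$ and $\tau_e=3+\delta/\mathbb E[M]$.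
   Context: $\mathbb{N}=\{1,2,\dots\}$. **Preferential attachment models.** Let $(m_i)_{i\ge3}$ be i.i.d. copies of $M$, $m_1=m_2=1$, $\boldsymbol m=(m_1,m_2,\dots)$, $m_{[l]}=\sum_{i\le l}m_i$. Start with a fixed multigraph $G_0$ on $\{1,2\}$ with degrees $a_1,a_2$, where $a_i+\delta>0$, and let $a_{[2]}=a_1+a_2$. A self-loop contributes $2$ to the degree. Vertices $v=3,4,\dots$ arrive successively, vertex $v$ with $m_v$ edges, attached one at a time; $d_u(v,j-1)$ is the degree of $u$ after the first $j-1$ edges of $v$ have been attached. Given $\boldsymbol m$ and the current graph, the conditional probability that the $j$-th edge of $v$ attaches to $u$ is: - Model (A): $\frac{d_u(v,j-1)+\delta}{c_{v,j}}$ for $u<v$, and $\frac{d_v(v,j-1)+1+\frac{j}{m_v}\delta}{c_{v,j}}$ for $u=v$, with $c_{v,j}=a_{[2]}+2(m_{[v-1]}+j-2)-1+(v-1)\delta+\frac{j}{m_v}\delta$. - Model (B): $\frac{d_u(v,j-1)+\delta}{c_{v,j}}$ for $u<v$, and $\frac{d_v(v,j-1)+\frac{j-1}{m_v}\delta}{c_{v,j}}$ for $u=v$, with $c_{v,j}=a_{[2]}+2(m_{[v-1]}+j-3)+(v-1)\delta+\frac{j-1}{m_v}\delta$. - Model (D): $\frac{d_u(v,j-1)+\delta}{c_{v,j}}$ for $u<v$ (no self-loops), with $c_{v,j}=a_{[2]}+2(m_{[v-1]}-2)+(j-1)+(v-1)\delta$. $G_n$ denotes the graph once all edges of vertex $n$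 have been attached. *)

theory Defs
  imports "HOL-Probability.Probability"
begin

definition slowly_varying :: "(real \<Rightarrow> real) \<Rightarrow> bool" where
  "slowly_varying L \<longleftrightarrow>
     L \<in> borel_measurable borel \<and>
     eventually (\<lambda>x. L x > 0) at_top \<and>
     (\<forall>c>0. ((\<lambda>x. L (c * x) / L x) \<longlongrightarrow> 1) at_top)"

definition converges_in_prob ::
    "'w measure \<Rightarrow> (nat \<Rightarrow> 'w \<Rightarrow> real) \<Rightarrow> ('w \<Rightarrow> real) \<Rightarrow> bool" where
  "converges_in_prob P X Y \<longleftrightarrow>
     (\<forall>\<epsilon>>0. (\<lambda>n. measure P {\<omega> \<in> space P. \<bar>X n \<omega> - Y \<omega>\<bar> > \<epsilon>}) \<longlonglongrightarrow> 0)"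

(* A multigraph is the list of its edges in order of attachment. An edge of a new
   vertex v is (v, u), where u is the vertex it attaches to; this orientation plays no
   role for degrees. The order keeps the j-th edge of v identifiable in the graph, so
   conditioning on the current graph is conditioning on all attachments made so far. *)
type_synonym multigraph = "(nat \<times> nat) list"

(* A self-loop occurs in both counts, hence contributes 2. *)
definition vdegree :: "multigraph \<Rightarrow> nat \<Rightarrow> nat" where
  "vdegree G u = count_list (map fst G) u + count_list (map snd G) u"

datatype pa_model = ModelA | ModelB | ModelD

(* c_{v,j}, with a = a_1 + a_2 the total degree of the initial graph *)
fun pa_norm :: "pa_model \<Rightarrow> real \<Rightarrow> nat \<Rightarrow> (nat \<Rightarrow> nat) \<Rightarrow> nat \<Rightarrow> nat \<Rightarrow> real" where
  "pa_norm ModelA \<delta> a m v j =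
     real a + 2 * (real (\<Sum>i=1..v-1. m i) + real j - 2) - 1 + (real v - 1) * \<delta>
       + real j / real (m v) * \<delta>"
| "pa_norm ModelB \<delta> a m v j =
     real a + 2 * (real (\<Sum>i=1..v-1. m i) + real j - 3) + (real v - 1) * \<delta>
       + (real j - 1) / real (m v) * \<delta>"
| "pa_norm ModelD \<delta> a m v j =
     real a + 2 * (real (\<Sum>i=1..v-1. m i) - 2) + (real j - 1) + (real v - 1) * \<delta>"

fun pa_loop_weight :: "pa_model \<Rightarrow> real \<Rightarrow> (nat \<Rightarrow> nat) \<Rightarrow> multigraph \<Rightarrow> nat \<Rightarrow> nat \<Rightarrow> real" where
  "pa_loop_weight ModelA \<delta> m G v j = real (vdegree G v) + 1 + real j / real (m v) * \<delta>"
| "pa_loop_weight ModelB \<delta> m G v j = real (vdegree G v) + (real j - 1) / real (m v) * \<delta>"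
| "pa_loop_weight ModelD \<delta> m G v j = 0"

(* Probability that the j-th edge of v attaches to u, where G is the graph just before
   that edge is attached. The vertices are 1, ..., v, so u = 0 is excluded. *)
definition pa_attach_prob ::
    "pa_model \<Rightarrow> real \<Rightarrow> nat \<Rightarrow> (nat \<Rightarrow> nat) \<Rightarrow> multigraph \<Rightarrow> nat \<Rightarrow> nat \<Rightarrow> nat \<Rightarrow> real" where
  "pa_attach_prob model \<delta> a m G v j u =
     (if 1 \<le> u \<and> u < v then (real (vdegree G u) + \<delta>) / pa_norm model \<delta> a m v j
      else if u = v then pa_loop_weight model \<delta> m G v j / pa_norm model \<delta> a m v j
      else 0)"

definition pa_edges :: "(nat \<Rightarrow> 'w \<Rightarrow> nat) \<Rightarrow> nat \<Rightarrow> nat \<Rightarrow> 'w \<Rightarrow> multigraph" where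
  "pa_edges E v j \<omega> = map (\<lambda>i. (v, E i \<omega>)) [1..<Suc j]"

(* G_n; it is the initial graph for n = 1, 2 *)
definition pa_graph ::
    "multigraph \<Rightarrow> (nat \<Rightarrow> 'w \<Rightarrow> nat) \<Rightarrow> (nat \<Rightarrow> nat \<Rightarrow> 'w \<Rightarrow> nat) \<Rightarrow> nat \<Rightarrow> 'w \<Rightarrow> multigraph" where
  "pa_graph G0 m E n \<omega> = G0 @ concat (map (\<lambda>v. pa_edges (E v) v (m v \<omega>) \<omega>) [3..<Suc n])"

(* the graph after the first j edges of vertex v have been attached *)
definition pa_partial_graph ::
    "multigraph \<Rightarrow> (nat \<Rightarrow> 'w \<Rightarrow> nat) \<Rightarrow> (nat \<Rightarrow> nat \<Rightarrow> 'w \<Rightarrow> nat) \<Rightarrow> nat \<Rightarrow> nat \<Rightarrow> 'w \<Rightarrow> multigraph" where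
  "pa_partial_graph G0 m E v j \<omega> = pa_graph G0 m E (v - 1) \<omega> @ pa_edges (E v) v j \<omega>"

(* the sigma-algebra generated by the sequence m and the random graph G *)
definition pa_sigma ::
    "'w measure \<Rightarrow> (nat \<Rightarrow> 'w \<Rightarrow> nat) \<Rightarrow> ('w \<Rightarrow> multigraph) \<Rightarrow> 'w measure" where
  "pa_sigma P m G =
     vimage_algebra (space P) (\<lambda>\<omega>. (\<lambda>i\<in>{1..}. m i \<omega>, G \<omega>))
       (PiM {1..} (\<lambda>_. count_space UNIV) \<Otimes>\<^sub>M count_space UNIV)"

(* M is the law of the out-degrees, and E v j the vertex to which the j-th edge of v
   attaches. Only the values of E v j with j at most m v enter the graphs. *)
locale preferential_attachment = prob_space P
  for P :: "'w measure" +
  fixes M :: "nat pmf" and \<delta> :: real and model :: pa_model and G0 :: multigraph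
    and m :: "nat \<Rightarrow> 'w \<Rightarrow> nat" and E :: "nat \<Rightarrow> nat \<Rightarrow> 'w \<Rightarrow> nat"
  assumes initial_vertices: "set G0 \<subseteq> {1, 2} \<times> {1, 2}"
    and initial_degrees: "\<And>i. i \<in> {1, 2} \<Longrightarrow> real (vdegree G0 i) + \<delta> > 0"
    and m_initial: "\<And>i \<omega>. i \<in> {1, 2} \<Longrightarrow> \<omega> \<in> space P \<Longrightarrow> m i \<omega> = 1"
    and m_indep: "indep_vars (\<lambda>_. count_space UNIV) m {3..}"
    and m_law: "\<And>i. i \<ge> 3 \<Longrightarrow> distr P (count_space UNIV) (m i) = measure_pmf M"
    and E_measurable: "\<And>v j. v \<ge> 3 \<Longrightarrow> j \<ge> 1 \<Longrightarrow> E v j \<in> P \<rightarrow>\<^sub>M count_space UNIV"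
    and attachment: "\<And>v j u. v \<ge> 3 \<Longrightarrow> j \<ge> 1 \<Longrightarrow>
      AE \<omega> in P. j \<le> m v \<omega> \<longrightarrow>
        real_cond_exp P (pa_sigma P m (pa_partial_graph G0 m E v (j - 1)))
            (indicator {\<omega> \<in> space P. E v j \<omega> = u}) \<omega>
          = pa_attach_prob model \<delta> (vdegree G0 1 + vdegree G0 2) (\<lambda>i. m i \<omega>)
              (pa_partial_graph G0 m E v (j - 1) \<omega>) v j u"

end

theory Submission
  imports Defs
begin

text \<open>
  Write \<open>\<theta> = 2 + \<delta> / E[M]\<close>. While vertex \<open>v\<close> is attached, an old vertex of degree \<open>k\<close> gains an edge
  with probability about \<open>m\<^sub>v (k + \<delta>) / (\<theta> E[M] v)\<close>. Hence the number \<open>A\<^sub>k(n)\<close> of vertices of degree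
  \<open>k\<close> obeys a noisy linear recursion whose fixed point satisfies
  \<open>(\<theta> + k + \<delta>) p\<^sub>k = \<theta> P(M = k) + (k - 1 + \<delta>) p\<^bsub>k-1\<^esub>\<close>. Induction on \<open>k\<close> gives
  \<open>E \<bar>A\<^sub>k(n) - p\<^sub>k n\<bar> = o(n)\<close>: the attachment noise is orthogonal given the out-degrees, self-loops are
  rare, and since \<open>M\<close> need not have a second moment, everything is done in \<open>L\<^sup>1\<close>. The fluctuations of
  \<open>m\<^sub>v\<close> around \<open>E[M]\<close> multiply the slowly changing quantity \<open>A\<^sub>k(v) / v\<close>, so that summation by parts
  and the law of large numbers remove them without any independence between graph and out-degrees.

  The recursion is solved by \<open>p\<^sub>k = w\<^sub>k \<Sum>\<^bsub>j\<le>k\<^esub> P(M = j) v\<^sub>j\<close> with Gamma quotients \<open>v\<^sub>k \<sim> C k\<^sup>\<theta>\<close> and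
  \<open>w\<^sub>k \<sim> C' k\<^bsup>-\<theta>-1\<^esup>\<close>. The partial sum is an integral of a step function that is regularly varying with
  index \<open>\<theta> - \<tau>\<^sub>M\<close>, so it is regularly varying with index \<open>max 0 (\<theta> - \<tau>\<^sub>M + 1)\<close>, and \<open>\<tau>\<^sub>e = \<theta> + 1\<close>.
\<close>

section \<open>Regular variation\<close>

text \<open>Slow variation controls \<open>L\<close> along \<open>c * x\<close> for each fixed
  \<open>c\<close>, but the step functions evaluate it at \<lceil>x\<rceil>, that is, along a factor
  that varies with x. Hence a uniform version is needed, and it rests on the measurability of
  \<open>L\<close>. At \<open>\<tau>\<^sub>M = \<tau>\<^sub>e\<close> the weighted sum may converge
  or diverge; the ratio of its values at c x and x tends to 1 either way, so no explicit slowly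
  varying factor is computed. Only l + \<delta> > 0 is available for the smallest out-degree l, so
  weights below l may be negative: recursion and Gamma quotients start at l, and degrees below l
  occur only at the two initial vertices. The three models differ only in a part of
  \<open>c v j\<close> of size O(j + 1) and in the loop weight; after these are bounded, all models
  are treated alike. Replacing the graph during the attachment of v by the graph before it costs
  about (m v)^2 / v, whose mean may be infinite. The cost is therefore capped at a multiple of m v,
  and dominated convergence takes the place of a variance bound. For the same reason the noise is
  first cut off at K edges per vertex.\<close>

text \<open>The uniform convergence theorem for slow variation, in additive form. If uniformity
  failed along \<open>x n\<close> and \<open>u n\<close>, the shifts that are good from base point
  \<open>x n\<close> and those good from \<open>x n + u n\<close> would fill most of one interval. A
  common good endpoint then bounds the bad increment by two halves of \<epsilon>.\<close>

lemma additive_uniform_convergence: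
  fixes h :: "real \<Rightarrow> real"
  assumes [measurable]: "h \<in> borel_measurable borel"
    and lim: "\<And>u. ((\<lambda>x. h (x + u) - h x) \<longlongrightarrow> 0) at_top"
    and "\<epsilon> > 0"
  shows "\<exists>X. \<forall>x\<ge>X. \<forall>u\<in>{0..1}. \<bar>h (x + u) - h x\<bar> < \<epsilon>"
proof (rule ccontr)
  assume "\<not> ?thesis"
  then have "\<forall>n::nat. \<exists>x u. x \<ge> real n \<and> u \<in> {0..1} \<and> \<bar>h (x + u) - h x\<bar> \<ge> \<epsilon>"
    by (meson not_less)
  then obtain x u where x: "\<And>n::nat. x n \<ge> real n" and u: "\<And>n. u n \<in> {0..1}"
    and bad: "\<And>n. \<bar>h (x n + u n) - h (x n)\<bar> \<ge> \<epsilon>"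
    by metis
  have x_top: "filterlim x at_top sequentially"
    by (rule filterlim_at_top_mono[OF filterlim_real_sequentially]) (simp add: x)
  \<comment> \<open>All indices from n on are controlled at once, so these sets increase with n;
    pointwise convergence makes their union the whole interval, and continuity from below gives
    nearly full measure.\<close>
  define V where "V b y n = {l \<in> {0..b}. \<forall>i\<ge>n. \<bar>h (y i + l) - h (y i)\<bar> < \<epsilon> / 2}"
    for b :: real and y :: "nat \<Rightarrow> real" and n :: nat
  have V_meas[measurable]: "V b y n \<in> sets lborel" for b y n
  proof -
    have "V b y n = {l \<in> space lborel. l \<in> {0..b} \<and> (\<forall>i\<in>{n..}. \<bar>h (y i + l) - h (y i)\<bar> < \<epsilon> / 2)}"
      by (auto simp: V_def)
    also have "\<dots> \<in> sets lborel" by measurable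
    finally show ?thesis .
  qed
  have V_sub: "V b y n \<subseteq> {0..b}" for b y n by (auto simp: V_def)
  have V_fin: "emeasure lborel (V b y n) < \<infinity>" if "b \<ge> 0" for b y n
    using emeasure_mono[OF V_sub[of b y n], of lborel] that
    by (auto simp: emeasure_lborel_Icc_eq intro: le_less_trans)
  have V_lim: "(\<lambda>n. measure lborel (V b y n)) \<longlonglongrightarrow> b" if "filterlim y at_top sequentially" "b \<ge> 0" for b y
  proof -
    have UN: "(\<Union>n. V b y n) = {0..b}"
    proof (intro equalityI subsetI)
      fix l assume l: "l \<in> {0..b}"
      have "(\<lambda>i. h (y i + l) - h (y i)) \<longlonglongrightarrow> 0"
        using filterlim_compose[OF lim that(1)] .
      then have "eventually (\<lambda>i. \<bar>h (y i + l) - h (y i)\<bar> < \<epsilon> / 2) sequentially"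
        using \<open>\<epsilon> > 0\<close> by (simp add: tendsto_iff dist_real_def del: less_divide_eq_numeral1)
      then show "l \<in> (\<Union>n. V b y n)"
        using l by (auto simp: V_def eventually_sequentially)
    qed (use V_sub in blast)
    have "(\<lambda>n. measure lborel (V b y n)) \<longlonglongrightarrow> measure lborel (\<Union>n. V b y n)"
    proof (rule Lim_measure_incseq)
      show "incseq (V b y)" by (auto simp: V_def incseq_def)
      show "emeasure lborel (\<Union>n. V b y n) \<noteq> \<infinity>" by (simp add: UN emeasure_lborel_Icc_eq)
      show "range (V b y) \<subseteq> sets lborel" using V_meas by blast
    qed
    then show ?thesis using that by (simp add: UN)
  qed
  have xu_top: "filterlim (\<lambda>i. x i + u i) at_top sequentially"
    by (rule filterlim_at_top_mono[OF x_top]) (use u in auto)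
  have "eventually (\<lambda>n. measure lborel (V 3 x n) > 5/2 \<and> measure lborel (V 2 (\<lambda>i. x i + u i) n) > 3/2) sequentially"
    by (intro eventually_conj order_tendstoD(1)[OF V_lim[OF x_top]] order_tendstoD(1)[OF V_lim[OF xu_top]]; simp)
  then obtain n where n: "measure lborel (V 3 x n) > 5/2" "measure lborel (V 2 (\<lambda>i. x i + u i) n) > 3/2"
    using eventually_happens'[OF sequentially_bot] by blast
  \<comment> \<open>Translation by \<open>u n\<close> expresses the good endpoints of
    \<open>x n + u n\<close> relative to \<open>x n\<close>. Since \<open>u n\<close> lies in
    [0, 1], \<open>W\<close> stays in [0, 3], and 5/2 + 3/2 > 3 forces an intersection.\<close>
  define W where "W = (+) (- u n) -` V 2 (\<lambda>i. x i + u i) n"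
  have W_meas[measurable]: "W \<in> sets lborel"
    unfolding W_def using measurable_sets[of "(+) (- u n)" borel borel "V 2 (\<lambda>i. x i + u i) n"] V_meas
    by (simp del: add_uminus_conv_diff uminus_add_conv_diff)
  have W_em: "emeasure lborel W = emeasure lborel (V 2 (\<lambda>i. x i + u i) n)"
  proof -
    have "emeasure lborel (V 2 (\<lambda>i. x i + u i) n) = emeasure (distr lborel borel ((+) (- u n))) (V 2 (\<lambda>i. x i + u i) n)"
      by (simp add: lborel_distr_plus)
    also have "\<dots> = emeasure lborel W"
      using V_meas unfolding W_def by (subst emeasure_distr) simp_all
    finally show ?thesis ..
  qed
  have W_sub: "W \<subseteq> {0..3}"
    using u[of n] by (auto simp: W_def V_def)
  have "V 3 x n \<inter> W \<noteq> {}"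
  proof
    assume disj: "V 3 x n \<inter> W = {}"
    have "measure lborel (V 3 x n) + measure lborel W = measure lborel (V 3 x n \<union> W)"
      using V_fin[of 3 x n] V_fin[of 2 "\<lambda>i. x i + u i" n] disj V_meas W_meas
      by (intro measure_Union[symmetric]) (simp_all add: W_em del: sets_lborel)
    also have "\<dots> \<le> measure lborel {0..3::real}"
    proof (rule measure_mono_fmeasurable)
      show "V 3 x n \<union> W \<subseteq> {0..3}" using V_sub[of 3 x n] W_sub by simp
      show "V 3 x n \<union> W \<in> sets lborel" using V_meas W_meas by (rule sets.Un)
      show "{0..3::real} \<in> fmeasurable lborel" by (simp add: fmeasurable_def emeasure_lborel_Icc_eq)
    qed
    also have "\<dots> = 3" by simp
    also have "measure lborel W = measure lborel (V 2 (\<lambda>i. x i + u i) n)"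
      unfolding measure_def by (simp only: W_em)
    finally show False using n by linarith
  qed
  then obtain l where l: "l \<in> V 3 x n" "- u n + l \<in> V 2 (\<lambda>i. x i + u i) n"
    unfolding W_def by blast
  then have "\<bar>h (x n + l) - h (x n)\<bar> < \<epsilon> / 2"
    and "\<bar>h (x n + u n + (- u n + l)) - h (x n + u n)\<bar> < \<epsilon> / 2"
    unfolding V_def by blast+
  moreover have "x n + u n + (- u n + l) = x n + l" by simp
  ultimately have "\<bar>h (x n + l) - h (x n)\<bar> < \<epsilon> / 2" "\<bar>h (x n + l) - h (x n + u n)\<bar> < \<epsilon> / 2"
    by simp_all
  with bad[of n] show False by linarith
qed

lemma filterlim_real_of_int_ceiling: "filterlim (\<lambda>x::real. real_of_int \<lceil>x\<rceil>) at_top at_top"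
  by (rule filterlim_at_top_mono[of "\<lambda>x. x" at_top]) (simp_all add: filterlim_ident always_eventually)

text \<open>Here \<lceil>x\<rceil> = exp (ln x + u) with u in [0, 1] depending on x, so the limit
  for each fixed multiplier does not suffice; uniformity is applied to \<open>h\<close>, the
  logarithm of \<open>L\<close> on exponential scale.\<close>

lemma slowly_varying_ceiling:
  assumes L: "slowly_varying L"
  shows "((\<lambda>x. L (of_int \<lceil>x\<rceil>) / L x) \<longlongrightarrow> 1) at_top"
proof -
  have Lm[measurable]: "L \<in> borel_measurable borel" and pos: "eventually (\<lambda>x. L x > 0) at_top"
    and lim: "\<And>c. c > 0 \<Longrightarrow> ((\<lambda>x. L (c * x) / L x) \<longlongrightarrow> 1) at_top"
    using L by (auto simp: slowly_varying_def)
  define h where "h x = ln (L (exp x))" for x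
  have hm: "h \<in> borel_measurable borel" unfolding h_def by measurable
  have h_lim: "((\<lambda>x. h (x + u) - h x) \<longlongrightarrow> 0) at_top" for u
  proof -
    have "((\<lambda>x. ln (L (exp u * x) / L x)) \<longlongrightarrow> ln 1) at_top"
      by (intro tendsto_intros lim) auto
    then have "((\<lambda>x. ln (L (exp u * exp x) / L (exp x))) \<longlongrightarrow> 0) at_top"
      using filterlim_compose[OF _ exp_at_top] by fastforce
    moreover have "eventually (\<lambda>x. ln (L (exp u * exp x) / L (exp x)) = h (x + u) - h x) at_top"
    proof -
      have 1: "eventually (\<lambda>x. L (exp x) > 0) at_top"
        using eventually_compose_filterlim[OF pos exp_at_top] .
      have "filterlim (\<lambda>x. exp u * exp x) at_top at_top"
        by (intro filterlim_tendsto_pos_mult_at_top[OF tendsto_const] exp_at_top) simp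
      then have 2: "eventually (\<lambda>x. L (exp u * exp x) > 0) at_top"
        by (rule eventually_compose_filterlim[OF pos])
      show ?thesis using 1 2 by eventually_elim (simp add: h_def ln_div exp_add mult.commute)
    qed
    ultimately show ?thesis by (rule Lim_transform_eventually)
  qed
  have main: "((\<lambda>x. ln (L (of_int \<lceil>x\<rceil>)) - ln (L x)) \<longlongrightarrow> 0) at_top"
    unfolding tendsto_iff
  proof (intro allI impI)
    fix e :: real assume "e > 0"
    then obtain X where X: "\<And>x u. x \<ge> X \<Longrightarrow> u \<in> {0..1} \<Longrightarrow> \<bar>h (x + u) - h x\<bar> < e"
      using additive_uniform_convergence[OF hm h_lim] by meson
    show "eventually (\<lambda>x. dist (ln (L (of_int \<lceil>x\<rceil>)) - ln (L x)) 0 < e) at_top"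
      using eventually_ge_at_top[of "max 1 (exp X)"]
    proof eventually_elim
      case (elim x)
      define u where "u = ln (of_int \<lceil>x\<rceil> / x)"
      have x: "x \<ge> 1" "ln x \<ge> X" using elim by (auto simp: ln_ge_iff)
      have c: "of_int \<lceil>x\<rceil> \<ge> x" "of_int \<lceil>x\<rceil> \<le> 2 * x" using x(1) by linarith+
      have "u \<ge> 0" using x c by (auto simp: u_def ln_ge_iff)
      moreover have "u \<le> of_int \<lceil>x\<rceil> / x - 1"
        unfolding u_def using x c by (intro ln_le_minus_one) auto
      moreover have "of_int \<lceil>x\<rceil> / x \<le> 2" using x c by (simp add: divide_le_eq)
      then have "u \<le> 1" using \<open>u \<le> of_int \<lceil>x\<rceil> / x - 1\<close> by linarith
      moreover have "exp (ln x + u) = of_int \<lceil>x\<rceil>"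
        using x c by (simp add: u_def exp_add)
      ultimately show ?case using X[OF x(2), of u] x by (simp add: h_def)
    qed
  qed
  have "((\<lambda>x. exp (ln (L (of_int \<lceil>x\<rceil>)) - ln (L x))) \<longlongrightarrow> 1) at_top"
    using tendsto_exp[OF main] by simp
  moreover have "eventually (\<lambda>x. exp (ln (L (of_int \<lceil>x\<rceil>)) - ln (L x)) = L (of_int \<lceil>x\<rceil>) / L x) at_top"
  proof -
    have "eventually (\<lambda>x::real. L (of_int \<lceil>x\<rceil>) > 0) at_top"
      by (rule eventually_compose_filterlim[OF pos filterlim_real_of_int_ceiling])
    with pos show ?thesis by eventually_elim (simp add: exp_diff)
  qed
  ultimately show ?thesis by (rule Lim_transform_eventually)
qed

section \<open>Integrals of regularly varying functions\<close>

lemma set_integral_rescale: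
  fixes f :: "real \<Rightarrow> real"
  assumes "c > 0"
  shows "(LBINT t:{0..c * x}. f t) = c * (LBINT t:{0..x}. f (c * t))"
proof -
  have "(LBINT t:{0..c * x}. f t) = c * (LBINT t. indicator {0..c * x} (c * t) * f (c * t))"
    unfolding set_lebesgue_integral_def
    by (subst lborel_integral_real_affine[where c = c and t = 0]) (use assms in auto)
  also have "(\<lambda>t. indicator {0..c * x} (c * t) * f (c * t)) = (\<lambda>t. indicator {0..x} t * f (c * t))"
    using assms by (auto simp: indicator_def fun_eq_iff zero_le_mult_iff)
  finally show ?thesis by (simp add: set_lebesgue_integral_def)
qed

lemma set_integrable_rescale:
  fixes f :: "real \<Rightarrow> real"
  assumes "c > 0" "set_integrable lborel {0..c * x} f"
  shows "set_integrable lborel {0..x} (\<lambda>t. f (c * t))"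
proof -
  have "integrable lborel (\<lambda>t. indicator {0..c * x} (0 + c * t) * f (0 + c * t))"
    using assms unfolding set_integrable_def
    by (subst lborel_integrable_real_affine_iff) auto
  also have "(\<lambda>t. indicator {0..c * x} (0 + c * t) * f (0 + c * t)) = (\<lambda>t. indicator {0..x} t * f (c * t))"
    using assms by (auto simp: indicator_def fun_eq_iff zero_le_mult_iff)
  finally show ?thesis by (simp add: set_integrable_def)
qed

lemma set_integral_split_Icc:
  fixes f :: "real \<Rightarrow> real"
  assumes "set_integrable lborel {0..y} f" "0 \<le> x" "x \<le> y"
  shows "(LBINT t:{0..y}. f t) = (LBINT t:{0..x}. f t) + (LBINT t:{x<..y}. f t)"
proof -
  have "{0..y} = {0..x} \<union> {x<..y}" using assms by auto
  moreover have "set_integrable lborel {0..x} f" "set_integrable lborel {x<..y} f"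
    using assms by (auto intro!: set_integrable_subset[OF assms(1)])
  ultimately show ?thesis by (simp add: set_integral_Un[of "{0..x}" "{x<..y}"] disjoint_iff)
qed

lemma set_integral_nonneg:
  fixes f :: "real \<Rightarrow> real"
  assumes "\<And>x. x \<in> A \<Longrightarrow> f x \<ge> 0"
  shows "(LBINT x:A. f x) \<ge> 0"
  unfolding set_lebesgue_integral_def
  by (rule Bochner_Integration.integral_nonneg) (use assms in \<open>auto simp: indicator_def\<close>)

lemma set_integral_Ioc_pos:
  fixes f :: "real \<Rightarrow> real"
  assumes int: "set_integrable lborel {x<..y} f" and pos: "\<And>t. t \<in> {x<..y} \<Longrightarrow> f t > 0" and "x < y"
  shows "(LBINT t:{x<..y}. f t) > 0"
proof -
  have nonneg: "(LBINT t:{x<..y}. f t) \<ge> 0"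
    using pos by (intro set_integral_nonneg) (auto intro: less_imp_le)
  have "(LBINT t:{x<..y}. f t) \<noteq> 0"
  proof
    assume "(LBINT t:{x<..y}. f t) = 0"
    then have "AE t in lborel. indicator {x<..y} t * f t = 0"
      using int pos unfolding set_lebesgue_integral_def set_integrable_def
      by (subst (asm) integral_nonneg_eq_0_iff_AE) (auto simp: indicator_def intro: less_imp_le)
    then have "AE t in lborel. t \<notin> {x<..y}"
      by eventually_elim (use pos in \<open>force simp: indicator_def\<close>)
    then have "emeasure lborel {x<..y} = 0"
      by (subst (asm) AE_iff_measurable[of "{x<..y}"]) auto
    with \<open>x < y\<close> show False by (simp add: emeasure_lborel_Ioc)
  qed
  with nonneg show ?thesis by linarith
qed

text \<open>The direct half of Karamata's theorem, with the critical index -1 included. If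
  \<open>T\<close> is bounded it has a positive limit and its ratios tend to 1; if it is unbounded,
  substitution compares T (c x) with c powr (\<alpha> + 1) times T x. Each case forces the matching
  sign of \<alpha> + 1, which produces the maximum.\<close>

lemma regularly_varying_integral:
  fixes f :: "real \<Rightarrow> real"
  assumes int: "\<And>x. set_integrable lborel {0..x} f"
    and nonneg: "\<And>x. f x \<ge> 0"
    and pos: "eventually (\<lambda>x. f x > 0) at_top"
    and lim: "\<And>c. c > 0 \<Longrightarrow> ((\<lambda>x. f (c * x) / f x) \<longlongrightarrow> c powr \<alpha>) at_top"
  defines "T \<equiv> \<lambda>x. LBINT t:{0..x}. f t"
  shows "eventually (\<lambda>x. T x > 0) at_top"
    and "c > 0 \<Longrightarrow> ((\<lambda>x. T (c * x) / T x) \<longlongrightarrow> c powr max 0 (\<alpha> + 1)) at_top"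
proof -
  have int_Ioc: "set_integrable lborel {x<..y} f" if "x \<ge> 0" for x y
    by (rule set_integrable_subset[OF int[of y]]) (use that in auto)
  have split: "T y = T x + (LBINT t:{x<..y}. f t)" if "0 \<le> x" "x \<le> y" for x y
    unfolding T_def by (rule set_integral_split_Icc[OF int that])
  have Ioc_nonneg: "(LBINT t:{x<..y}. f t) \<ge> 0" for x y
    by (intro set_integral_nonneg nonneg)
  have T_nonneg: "T x \<ge> 0" for x unfolding T_def by (intro set_integral_nonneg nonneg)
  have mono: "T x \<le> T y" if "x \<le> y" for x y
  proof (cases "x \<ge> 0")
    case True
    then show ?thesis using split[of x y] Ioc_nonneg[of x y] that by simp
  next
    case False
    then have "T x = 0" by (simp add: T_def set_lebesgue_integral_def)
    then show ?thesis using T_nonneg[of y] by simp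
  qed
  obtain X0 where X0: "X0 > 0" "\<And>t. t \<ge> X0 \<Longrightarrow> f t > 0"
  proof -
    from pos obtain Y where "\<forall>t\<ge>Y. f t > 0" by (auto simp: eventually_at_top_linorder)
    then show ?thesis by (intro that[of "max 1 Y"]) auto
  qed
  have strict: "T x < T y" if "X0 \<le> x" "x < y" for x y
  proof -
    have "(LBINT t:{x<..y}. f t) > 0"
      using that X0 by (intro set_integral_Ioc_pos int_Ioc) auto
    then show ?thesis using split[of x y] that X0 by simp
  qed
  have T_pos: "T x > 0" if "x > X0" for x
    using strict[of X0 x] T_nonneg[of X0] that by simp
  show ev_pos: "eventually (\<lambda>x. T x > 0) at_top"
    using eventually_gt_at_top[of X0] by eventually_elim (rule T_pos)
  have bounded_or_top: "(\<exists>l>0. (T \<longlongrightarrow> l) at_top) \<or> filterlim T at_top at_top"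
  proof (cases "\<exists>B. \<forall>x. T x \<le> B")
    case True
    then have bdd: "bdd_above (range T)" by (auto simp: bdd_above_def)
    have "(T \<longlongrightarrow> (SUP x. T x)) at_top"
    proof (rule increasing_tendsto)
      show "eventually (\<lambda>x. T x \<le> (SUP x. T x)) at_top"
        by (intro always_eventually allI cSUP_upper bdd) simp
      fix y assume "y < (SUP x. T x)"
      then obtain x where "y < T x" using less_cSUP_iff[OF _ bdd] by auto
      then show "eventually (\<lambda>x. y < T x) at_top"
        using mono by (auto simp: eventually_at_top_linorder intro!: exI[of _ x] elim: less_le_trans)
    qed
    moreover have "(SUP x. T x) > 0"
      using T_pos[of "X0 + 1"] cSUP_upper[OF _ bdd, of "X0 + 1"] by simp
    ultimately show ?thesis by blast
  next
    case False
    have "filterlim T at_top at_top"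
      unfolding filterlim_at_top
    proof
      fix B from False obtain x where "T x > B" by (auto simp: not_le)
      then show "eventually (\<lambda>x. B \<le> T x) at_top"
        using mono by (auto simp: eventually_at_top_linorder intro!: exI[of _ x] elim: order_trans[OF less_imp_le])
    qed
    then show ?thesis ..
  qed
  have top_case: "((\<lambda>x. T (c * x) / T x) \<longlongrightarrow> c powr (\<alpha> + 1)) at_top"
    if "c > 0" and T_top: "filterlim T at_top at_top" for c
  proof -
    have "((\<lambda>x. T (c * x) / c / T x) \<longlongrightarrow> c powr \<alpha>) at_top"
      unfolding tendsto_iff
    proof (intro allI impI)
      fix e :: real assume "e > 0"
      have "eventually (\<lambda>x. dist (f (c * x) / f x) (c powr \<alpha>) < e / 2) at_top"
        using lim[OF \<open>c > 0\<close>] \<open>e > 0\<close> by (simp add: tendsto_iff del: less_divide_eq_numeral1)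
      then obtain X1 where X1: "\<And>x. x \<ge> X1 \<Longrightarrow> \<bar>f (c * x) / f x - c powr \<alpha>\<bar> < e / 2"
        by (auto simp: eventually_at_top_linorder dist_real_def)
      define X where "X = max X0 X1"
      \<comment> \<open>By substitution T (c x) / c is the integral of f (c t), so the discrepancy
        is the integral of \<open>d\<close>. Beyond \<open>X\<close> it is at most e/2 times T x;
        the part before \<open>X\<close> is a constant that the divergent T x outgrows.\<close>
      define d where "d t = f (c * t) - c powr \<alpha> * f t" for t
      have d_int: "set_integrable lborel {0..x} d" for x
        unfolding d_def by (intro set_integral_diff set_integrable_rescale set_integrable_mult_right int \<open>c > 0\<close>)
      have d_bound: "\<bar>d t\<bar> \<le> e / 2 * f t" if "t \<ge> X" for t
      proof -
        have t: "f t > 0" "\<bar>f (c * t) / f t - c powr \<alpha>\<bar> < e / 2"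
          using that X0 X1 by (auto simp: X_def)
        have "\<bar>d t\<bar> = \<bar>f (c * t) / f t - c powr \<alpha>\<bar> * f t"
          using t(1) by (simp add: d_def abs_mult_pos' field_simps flip: abs_mult_pos)
        also have "\<dots> \<le> e / 2 * f t" using t by (intro mult_right_mono) auto
        finally show ?thesis .
      qed
      define K where "K = \<bar>LBINT t:{0..X}. d t\<bar>"
      have est: "\<bar>T (c * x) / c - c powr \<alpha> * T x\<bar> \<le> K + e / 2 * T x" if "x \<ge> X" for x
      proof -
        have X: "X \<ge> 0" using X0 by (simp add: X_def)
        have d_Ioc: "set_integrable lborel {X<..x} d"
          by (rule set_integrable_subset[OF d_int[of x]]) (use X in auto)
        have "T (c * x) / c - c powr \<alpha> * T x = (LBINT t:{0..x}. d t)"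
          unfolding d_def T_def using \<open>c > 0\<close>
          by (subst set_integral_diff) (auto intro!: set_integrable_rescale set_integrable_mult_right int simp: set_integral_rescale)
        also have "\<dots> = (LBINT t:{0..X}. d t) + (LBINT t:{X<..x}. d t)"
          by (rule set_integral_split_Icc[OF d_int X that])
        finally have "\<bar>T (c * x) / c - c powr \<alpha> * T x\<bar> \<le> K + \<bar>LBINT t:{X<..x}. d t\<bar>"
          unfolding K_def by linarith
        also have "\<bar>LBINT t:{X<..x}. d t\<bar> \<le> (LBINT t:{X<..x}. \<bar>d t\<bar>)"
          using set_integral_norm_bound[OF d_Ioc] by simp
        also have "\<dots> \<le> (LBINT t:{X<..x}. e / 2 * f t)"
          using X by (intro set_integral_mono set_integrable_mult_right int_Ioc set_integrable_abs d_Ioc d_bound) auto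
        also have "\<dots> \<le> e / 2 * T x"
          using split[OF X that] T_nonneg[of X] \<open>e > 0\<close> by (simp add: field_simps)
        finally show ?thesis by simp
      qed
      have "eventually (\<lambda>x. T x > 2 * K / e) at_top"
        using T_top by (simp add: filterlim_at_top_dense)
      then show "eventually (\<lambda>x. dist (T (c * x) / c / T x) (c powr \<alpha>) < e) at_top"
        using ev_pos eventually_ge_at_top[of X]
      proof eventually_elim
        case (elim x)
        have "\<bar>T (c * x) / c / T x - c powr \<alpha>\<bar> = \<bar>T (c * x) / c - c powr \<alpha> * T x\<bar> / T x"
          using elim(2) by (simp add: abs_div_pos diff_divide_distrib)
        also have "\<dots> \<le> (K + e / 2 * T x) / T x"
          using elim by (intro divide_right_mono est) auto
        also have "\<dots> < e" using elim \<open>e > 0\<close> by (simp add: field_simps)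
        finally show ?case by (simp add: dist_real_def)
      qed
    qed
    then have "((\<lambda>x. c * (T (c * x) / c / T x)) \<longlongrightarrow> c * c powr \<alpha>) at_top"
      by (intro tendsto_mult tendsto_const)
    then show ?thesis using \<open>c > 0\<close> by (simp add: powr_add mult.commute)
  qed
  assume "c > 0"
  show "((\<lambda>x. T (c * x) / T x) \<longlongrightarrow> c powr max 0 (\<alpha> + 1)) at_top"
    using bounded_or_top
  proof
    assume "\<exists>l>0. (T \<longlongrightarrow> l) at_top"
    then obtain l where l: "l > 0" "(T \<longlongrightarrow> l) at_top" by blast
    have T_scale: "((\<lambda>x. T (c * x)) \<longlongrightarrow> l) at_top" if "c > 0" for c
      by (rule filterlim_compose[OF l(2)])
        (intro filterlim_tendsto_pos_mult_at_top[OF tendsto_const \<open>c > 0\<close>] filterlim_ident)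
    \<comment> \<open>If \<alpha> > -1, then f t \<le> 2 f (2 t) for large t, hence T (2 x) - T (2
      X) \<ge> T x - T X. Letting x grow, with T (2 x) and T x both tending to l, gives T (2 X)
      \<le> T X, against strict growth.\<close>
    have "\<alpha> + 1 \<le> 0"
    proof (rule ccontr)
      assume "\<not> ?thesis"
      then have "(2::real) powr \<alpha> > 1 / 2"
        using powr_less_mono[of "-1" \<alpha> "2::real"] by (simp add: powr_minus_divide)
      then have "eventually (\<lambda>x. f (2 * x) / f x > 1 / 2) at_top"
        by (intro order_tendstoD(1)[OF lim]; simp)
      then obtain X1 where X1: "\<And>x. x \<ge> X1 \<Longrightarrow> f (2 * x) / f x > 1 / 2"
        by (auto simp: eventually_at_top_linorder)
      define X where "X = max X0 X1"
      have X: "X \<ge> 0" "X \<ge> X0" using X0 by (auto simp: X_def)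
      have ge: "T (2 * x) - T (2 * X) \<ge> T x - T X" if "x \<ge> X" for x
      proof -
        have "f t \<le> 2 * f (2 * t)" if "t \<ge> X" for t
          using X1[of t] X0(2)[of t] that by (simp add: X_def field_simps)
        then have "(LBINT t:{X<..x}. f t) \<le> (LBINT t:{X<..x}. 2 * f (2 * t))"
          using X int by (intro set_integral_mono int_Ioc set_integrable_mult_right
            set_integrable_subset[OF set_integrable_rescale, of _ x]) auto
        moreover have "T (2 * x) = T (2 * X) + 2 * (LBINT t:{X<..x}. f (2 * t))"
          using set_integral_split_Icc[OF set_integrable_rescale[of 2 x f] X(1) that] int
          by (simp add: T_def set_integral_rescale)
        ultimately show ?thesis using split[OF X(1) that] by simp
      qed
      have "l - T (2 * X) \<ge> l - T X"
        by (rule tendsto_le[OF _ tendsto_diff[OF T_scale[of 2] tendsto_const] tendsto_diff[OF l(2) tendsto_const]])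
          (use ge in \<open>auto simp: eventually_at_top_linorder\<close>)
      moreover have "T X < T (2 * X)" using X X0 by (intro strict) auto
      ultimately show False by simp
    qed
    moreover have "((\<lambda>x. T (c * x) / T x) \<longlongrightarrow> l / l) at_top"
      using l \<open>c > 0\<close> by (intro tendsto_divide T_scale) auto
    ultimately show ?thesis using l \<open>c > 0\<close> by (simp add: max_def)
  next
    assume T_top: "filterlim T at_top at_top"
    have "2 powr (\<alpha> + 1) \<ge> (1::real)"
    proof (rule tendsto_lowerbound[OF top_case[OF _ T_top]])
      show "eventually (\<lambda>x. 1 \<le> T (2 * x) / T x) at_top"
        using ev_pos eventually_ge_at_top[of 0] by eventually_elim (simp add: mono)
    qed auto
    then have "\<alpha> + 1 \<ge> 0"
      using powr_less_mono[of "\<alpha> + 1" 0 "2::real"] by (cases "\<alpha> + 1 < 0") auto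
    then show ?thesis using top_case[OF \<open>c > 0\<close> T_top] by (simp add: max_def)
  qed
qed

section \<open>Calculus of regular variation and Gamma quotients\<close>

text \<open>Only the ratio limit is recorded; eventual positivity and measurability are carried
  separately, so that products combine simply by adding indices.\<close>

definition regularly_varying :: "(real \<Rightarrow> real) \<Rightarrow> real \<Rightarrow> bool" where
  "regularly_varying f \<rho> \<longleftrightarrow> (\<forall>c>0. ((\<lambda>x. f (c * x) / f x) \<longlongrightarrow> c powr \<rho>) at_top)"

lemma regularly_varying_mult:
  assumes "regularly_varying f \<rho>" "regularly_varying g \<sigma>"
  shows "regularly_varying (\<lambda>x. f x * g x) (\<rho> + \<sigma>)"
  unfolding regularly_varying_def
proof (intro allI impI)
  fix c :: real assume "c > 0"
  then have "((\<lambda>x. (f (c * x) / f x) * (g (c * x) / g x)) \<longlongrightarrow> c powr \<rho> * c powr \<sigma>) at_top"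
    using assms by (intro tendsto_mult) (auto simp: regularly_varying_def)
  then show "((\<lambda>x. f (c * x) * g (c * x) / (f x * g x)) \<longlongrightarrow> c powr (\<rho> + \<sigma>)) at_top"
    by (simp add: powr_add)
qed

lemma filterlim_mult_const_at_top: "c > 0 \<Longrightarrow> filterlim (\<lambda>x::real. c * x) at_top at_top"
  by (rule filterlim_tendsto_pos_mult_at_top[OF tendsto_const _ filterlim_ident])

lemma regularly_varying_equiv:
  assumes f: "regularly_varying f \<rho>" and nz: "eventually (\<lambda>x. f x \<noteq> 0) at_top"
    and lim: "((\<lambda>x. g x / f x) \<longlongrightarrow> C) at_top" and "C \<noteq> 0"
  shows "regularly_varying g \<rho>"
  unfolding regularly_varying_def
proof (intro allI impI)
  fix c :: real assume "c > 0"
  have top: "filterlim (\<lambda>x. c * x) at_top at_top"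
    using filterlim_mult_const_at_top[OF \<open>c > 0\<close>] .
  have lim': "((\<lambda>x. (g (c * x) / f (c * x)) * (f (c * x) / f x) / (g x / f x)) \<longlongrightarrow> C * c powr \<rho> / C) at_top"
    using f \<open>c > 0\<close> \<open>C \<noteq> 0\<close>
    by (intro tendsto_divide tendsto_mult lim filterlim_compose[OF lim top]) (auto simp: regularly_varying_def)
  have "eventually (\<lambda>x. (g (c * x) / f (c * x)) * (f (c * x) / f x) / (g x / f x) = g (c * x) / g x) at_top"
    using nz eventually_compose_filterlim[OF nz top] by eventually_elim simp
  then have "((\<lambda>x. g (c * x) / g x) \<longlongrightarrow> C * c powr \<rho> / C) at_top"
    by (rule Lim_transform_eventually[OF lim'])
  then show "((\<lambda>x. g (c * x) / g x) \<longlongrightarrow> c powr \<rho>) at_top"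
    using \<open>C \<noteq> 0\<close> by simp
qed

lemma ceiling_ratio_tendsto: "((\<lambda>x::real. real_of_int \<lceil>x\<rceil> / x) \<longlongrightarrow> 1) at_top"
proof (rule tendsto_sandwich)
  show "eventually (\<lambda>x::real. 1 \<le> real_of_int \<lceil>x\<rceil> / x) at_top"
    using eventually_gt_at_top[of 0] by eventually_elim (simp add: le_divide_eq)
  show "eventually (\<lambda>x::real. real_of_int \<lceil>x\<rceil> / x \<le> 1 + inverse x) at_top"
    using eventually_gt_at_top[of 0]
  proof eventually_elim
    case (elim x)
    have "real_of_int \<lceil>x\<rceil> \<le> x + 1" by linarith
    then show ?case using elim by (simp add: field_simps)
  qed
  have "((\<lambda>x::real. 1 + inverse x) \<longlongrightarrow> 1 + 0) at_top"
    by (intro tendsto_intros tendsto_inverse_0_at_top filterlim_ident)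
  then show "((\<lambda>x::real. 1 + inverse x) \<longlongrightarrow> 1) at_top" by simp
qed simp

lemma regularly_varying_ceiling_powr: "regularly_varying (\<lambda>x. real_of_int \<lceil>x\<rceil> powr \<sigma>) \<sigma>"
proof (rule regularly_varying_equiv)
  show "regularly_varying (\<lambda>x. x powr \<sigma>) \<sigma>"
    unfolding regularly_varying_def
  proof (intro allI impI)
    fix c :: real assume "c > 0"
    have "eventually (\<lambda>x. (c * x) powr \<sigma> / x powr \<sigma> = c powr \<sigma>) at_top"
      using eventually_gt_at_top[of 0] by eventually_elim (use \<open>c > 0\<close> in \<open>simp add: powr_mult\<close>)
    then show "((\<lambda>x. (c * x) powr \<sigma> / x powr \<sigma>) \<longlongrightarrow> c powr \<sigma>) at_top"
      by (rule tendsto_eventually)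
  qed
  show "eventually (\<lambda>x::real. x powr \<sigma> \<noteq> 0) at_top"
    using eventually_gt_at_top[of 0] by eventually_elim simp
  have "((\<lambda>x::real. (real_of_int \<lceil>x\<rceil> / x) powr \<sigma>) \<longlongrightarrow> 1 powr \<sigma>) at_top"
    by (intro tendsto_powr ceiling_ratio_tendsto tendsto_const) simp
  moreover have "eventually (\<lambda>x::real. (real_of_int \<lceil>x\<rceil> / x) powr \<sigma> = real_of_int \<lceil>x\<rceil> powr \<sigma> / x powr \<sigma>) at_top"
    using eventually_gt_at_top[of 0] by eventually_elim (simp add: powr_divide)
  ultimately show "((\<lambda>x::real. real_of_int \<lceil>x\<rceil> powr \<sigma> / x powr \<sigma>) \<longlongrightarrow> 1) at_top"
    by (simp add: tendsto_cong)
qed simp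

lemma regularly_varying_of_seq:
  fixes v :: "nat \<Rightarrow> real"
  assumes "(\<lambda>k. v k / real k powr \<sigma>) \<longlonglongrightarrow> C" "C \<noteq> 0"
  shows "regularly_varying (\<lambda>x. v (nat \<lceil>x\<rceil>)) \<sigma>"
proof (rule regularly_varying_equiv[OF regularly_varying_ceiling_powr _ _ \<open>C \<noteq> 0\<close>])
  have ev: "eventually (\<lambda>x::real. real_of_int \<lceil>x\<rceil> \<noteq> 0 \<and> \<lceil>x\<rceil> \<ge> 0) at_top"
    using eventually_gt_at_top[of 0] by eventually_elim linarith
  then show "eventually (\<lambda>x::real. real_of_int \<lceil>x\<rceil> powr \<sigma> \<noteq> 0) at_top"
    by eventually_elim simp
  have "filterlim (\<lambda>x::real. nat \<lceil>x\<rceil>) at_top at_top"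
    unfolding filterlim_at_top
  proof
    fix N :: nat
    show "eventually (\<lambda>x::real. N \<le> nat \<lceil>x\<rceil>) at_top"
      using eventually_ge_at_top[of "real N"] by eventually_elim linarith
  qed
  then have "((\<lambda>x::real. v (nat \<lceil>x\<rceil>) / real (nat \<lceil>x\<rceil>) powr \<sigma>) \<longlongrightarrow> C) at_top"
    by (rule filterlim_compose[OF assms(1)])
  then show "((\<lambda>x::real. v (nat \<lceil>x\<rceil>) / real_of_int \<lceil>x\<rceil> powr \<sigma>) \<longlongrightarrow> C) at_top"
    by (rule Lim_transform_eventually) (use ev in \<open>eventually_elim, simp\<close>)
qed

text \<open>Quotient of two instances of Euler's limit formula: \<open>Gamma_series z n\<close>
  contains \<open>pochhammer z (n + 1)\<close> in the denominator and n powr z in the numerator. The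
  index k = n + l + 1 aligns k - l with n + 1, and the extra factor n / k tends to 1.\<close>

lemma pochhammer_ratio_asymptotics:
  fixes z \<theta> :: real and l :: nat
  assumes "z > 0" "\<theta> > 0"
  shows "(\<lambda>k. (pochhammer (z + \<theta>) (k - l) / pochhammer z (k - l)) / real k powr \<theta>)
           \<longlonglongrightarrow> Gamma z / Gamma (z + \<theta>)"
proof -
  have nz: "Gamma (z + \<theta>) \<noteq> 0" using assms by (simp add: Gamma_real_pos less_imp_neq[symmetric])
  have "(\<lambda>n. Gamma_series z n / Gamma_series (z + \<theta>) n * (real n / real (n + Suc l)) powr \<theta>)
          \<longlonglongrightarrow> Gamma z / Gamma (z + \<theta>) * 1 powr \<theta>"
  proof (intro tendsto_intros nz)
    show "(\<lambda>n. real n / real (n + Suc l)) \<longlonglongrightarrow> 1" by real_asymp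
  qed simp
  moreover have "eventually (\<lambda>n. Gamma_series z n / Gamma_series (z + \<theta>) n * (real n / real (n + Suc l)) powr \<theta>
      = (pochhammer (z + \<theta>) (n + Suc l - l) / pochhammer z (n + Suc l - l)) / real (n + Suc l) powr \<theta>) sequentially"
    using eventually_gt_at_top[of 0]
  proof eventually_elim
    case (elim n)
    have "pochhammer z (Suc n) > 0" "pochhammer (z + \<theta>) (Suc n) > 0"
      using assms by (auto intro: pochhammer_pos)
    then show ?case using elim
      by (simp add: Gamma_series_def powr_divide powr_def[of "real n"] exp_add distrib_right field_simps)
  qed
  ultimately have "(\<lambda>n. (pochhammer (z + \<theta>) (n + Suc l - l) / pochhammer z (n + Suc l - l)) / real (n + Suc l) powr \<theta>)
      \<longlonglongrightarrow> Gamma z / Gamma (z + \<theta>)"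
    by (simp add: tendsto_cong)
  then show ?thesis by (rule LIMSEQ_offset)
qed

lemma step_function_set_integrable:
  fixes a :: "nat \<Rightarrow> real" and x :: real
  shows "set_integrable lborel {0..x} (\<lambda>t. a (nat \<lceil>t\<rceil>))"
proof -
  define K where "K = (\<Sum>j\<le>nat \<lceil>x\<rceil>. \<bar>a j\<bar>)"
  have "integrable lborel (\<lambda>t. indicator {0..x} t * a (nat \<lceil>t\<rceil>))"
  proof (rule Bochner_Integration.integrable_bound)
    show "integrable lborel (\<lambda>t. indicator {0..x} t * K)"
      by (intro integrable_mult_left integrable_real_indicator) (auto simp: emeasure_lborel_Icc_eq)
    show "(\<lambda>t. indicator {0..x} t * a (nat \<lceil>t\<rceil>)) \<in> borel_measurable lborel" by measurable
    have "\<bar>a (nat \<lceil>t\<rceil>)\<bar> \<le> K" if "t \<le> x" for t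
      unfolding K_def using that
      by (intro member_le_sum[of _ _ "\<lambda>j. \<bar>a j\<bar>"]) (auto intro: nat_mono ceiling_mono simp del: nat_ceiling_le_eq)
    moreover have "K \<ge> 0" by (simp add: K_def sum_nonneg)
    ultimately show "AE t in lborel. norm (indicator {0..x} t * a (nat \<lceil>t\<rceil>)) \<le> norm (indicator {0..x} t * K)"
      by (auto simp: indicator_def)
  qed
  then show ?thesis by (simp add: set_integrable_def)
qed

text \<open>The integrand equals a j on (j - 1, j], and \<open>a 0\<close> is seen only at the null
  point 0. Partial sums are thus exact integrals, to which the theorem on regularly varying
  integrands applies.\<close>

lemma step_function_integral:
  fixes a :: "nat \<Rightarrow> real"
  shows "(LBINT t:{0..real k}. a (nat \<lceil>t\<rceil>)) = (\<Sum>j=1..k. a j)"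
proof (induction k)
  case 0
  have "(LBINT t:{0..0::real}. a (nat \<lceil>t\<rceil>)) = (LBINT t:{0..0::real}. a 0)"
    by (rule set_lebesgue_integral_cong) auto
  then show ?case by (simp add: set_integral_const)
next
  case (Suc k)
  have "(LBINT t:{0..real (Suc k)}. a (nat \<lceil>t\<rceil>))
      = (\<Sum>j=1..k. a j) + (LBINT t:{real k<..real (Suc k)}. a (nat \<lceil>t\<rceil>))"
    using set_integral_split_Icc[OF step_function_set_integrable, of "real k" "real (Suc k)" a] Suc by simp
  also have "(LBINT t:{real k<..real (Suc k)}. a (nat \<lceil>t\<rceil>)) = (LBINT t:{real k<..real (Suc k)}. a (Suc k))"
  proof (rule set_lebesgue_integral_cong)
    show "\<forall>t. t \<in> {real k<..real (Suc k)} \<longrightarrow> a (nat \<lceil>t\<rceil>) = a (Suc k)"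
    proof (intro allI impI)
      fix t assume "t \<in> {real k<..real (Suc k)}"
      then have "\<lceil>t\<rceil> = int (Suc k)" by (intro ceiling_unique) auto
      then show "a (nat \<lceil>t\<rceil>) = a (Suc k)" by (simp del: of_nat_Suc)
    qed
  qed simp
  also have "\<dots> = a (Suc k)" by (simp add: set_integral_const)
  finally show ?case by simp
qed

text \<open>Variation of constants. With the integrating factor \<open>v\<close>, the quantity
  (\<theta> + k + \<delta>) p k v k increases by \<theta> b k v k at each step, so \<open>p\<close>
  is \<open>w\<close> times a partial sum; the latter inherits regular variation from its
  summands.\<close>

lemma power_law_of_recursion:
  fixes b p :: "nat \<Rightarrow> real" and l :: nat and \<theta> \<delta> \<tau> :: real
  assumes L: "slowly_varying L" and b: "\<And>k. k \<ge> 1 \<Longrightarrow> b k = L (real k) * real k powr (- \<tau>)"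
    and b_nonneg: "\<And>k. b k \<ge> 0" and b_zero: "\<And>k. k < l \<Longrightarrow> b k = 0"
    and \<theta>: "\<theta> > 0" and l: "real l + \<delta> > 0"
    and p_zero: "\<And>k. k < l \<Longrightarrow> p k = 0"
    and p_rec: "\<And>k. k \<ge> l \<Longrightarrow> k \<ge> 1 \<Longrightarrow> (\<theta> + real k + \<delta>) * p k = \<theta> * b k + (real k - 1 + \<delta>) * p (k - 1)"
    and "l \<ge> 1"
  shows "\<exists>L'. slowly_varying L' \<and> (\<forall>k\<ge>1. p k = L' (real k) * real k powr (- min \<tau> (\<theta> + 1)))"
proof -
  define z where "z = real l + \<delta>"
  have z: "z > 0" using l by (simp add: z_def)
  \<comment> \<open>Solution of v k (k - 1 + \<delta>) = v (k - 1) (\<theta> + k - 1 + \<delta>) for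
    k > l with v l = 1; both Pochhammer symbols are positive because z = l + \<delta> > 0.\<close>
  define v where "v k = pochhammer (z + \<theta>) (k - l) / pochhammer z (k - l)" for k
  define w where "w k = \<theta> / (\<theta> + real k + \<delta>) / v k" for k
  have v_pos: "v k > 0" for k
    unfolding v_def using z \<theta> by (intro divide_pos_pos pochhammer_pos) auto
  have v_Suc: "v k = v (k - 1) * (\<theta> + real k + \<delta> - 1) / (real k - 1 + \<delta>)" if "k > l" for k
  proof -
    obtain n where n: "k = Suc (l + n)" using less_imp_Suc_add[OF \<open>k > l\<close>] by blast
    show ?thesis
      by (simp add: n v_def z_def pochhammer_Suc Suc_diff_le add_ac)
  qed
  have p_eq: "p k = w k * (\<Sum>j=1..k. b j * v j)" for k
  proof (induction k)
    case 0
    then show ?case using p_zero[of 0] \<open>l \<ge> 1\<close> by simp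
  next
    case (Suc k)
    consider "Suc k < l" | "Suc k = l" | "Suc k > l" by linarith
    then show ?case
    proof cases
      case 1
      then show ?thesis by (simp add: p_zero b_zero)
    next
      case 2
      have "(\<theta> + real l + \<delta>) * p l = \<theta> * b l"
        using p_rec[of l] p_zero[of "l - 1"] \<open>l \<ge> 1\<close> by simp
      moreover have "\<theta> + real l + \<delta> > 0" using \<theta> l by simp
      ultimately have "p l = \<theta> * b l / (\<theta> + real l + \<delta>)" by (simp add: field_simps)
      moreover have "(\<Sum>j=1..l. b j * v j) = b l * v l"
        using 2 \<open>l \<ge> 1\<close> by (subst sum.remove[of _ l]) (auto intro!: sum.neutral simp: b_zero)
      ultimately show ?thesis using v_pos[of l] by (simp add: 2 w_def)
    next
      case 3
      define S where "S = (\<Sum>j=1..k. b j * v j)"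
      have pos: "\<theta> + real (Suc k) + \<delta> > 0" "real k + \<delta> > 0" "\<theta> + real k + \<delta> > 0"
        using 3 l \<theta> by (auto simp: less_Suc_eq_le)
      have "(\<theta> + real (Suc k) + \<delta>) * p (Suc k) = \<theta> * b (Suc k) + (real k + \<delta>) * (\<theta> / (\<theta> + real k + \<delta>) / v k * S)"
        using p_rec[of "Suc k"] 3 Suc by (simp add: S_def w_def)
      also have "(real k + \<delta>) * (\<theta> / (\<theta> + real k + \<delta>) / v k * S) = \<theta> * S / v (Suc k)"
        using v_Suc[of "Suc k"] 3 pos v_pos[of k] by (simp add: add_ac mult_ac)
      finally have "p (Suc k) = (\<theta> * b (Suc k) + \<theta> * S / v (Suc k)) / (\<theta> + real (Suc k) + \<delta>)"
        using pos by (simp add: field_simps)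
      then show ?thesis
        using v_pos[of "Suc k"] pos by (simp add: S_def w_def field_simps)
    qed
  qed
  define a where "a k = b k * v k" for k
  define f where "f x = a (nat \<lceil>x\<rceil>)" for x :: real
  define T where "T x = (LBINT t:{0..x}. f t)" for x
  have Lm[measurable]: "L \<in> borel_measurable borel" and L_pos: "eventually (\<lambda>x. L x > 0) at_top"
    and L_lim: "\<And>c. c > 0 \<Longrightarrow> ((\<lambda>x. L (c * x) / L x) \<longlongrightarrow> 1) at_top"
    using L by (auto simp: slowly_varying_def)
  have v_lim: "(\<lambda>k. v k / real k powr \<theta>) \<longlonglongrightarrow> Gamma z / Gamma (z + \<theta>)"
    unfolding v_def by (rule pochhammer_ratio_asymptotics[OF z \<theta>])
  have "Gamma z / Gamma (z + \<theta>) > 0"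
    using z \<theta> by (intro divide_pos_pos Gamma_real_pos) auto
  then have G_nz: "Gamma z / Gamma (z + \<theta>) \<noteq> 0" by linarith
  have w_lim: "(\<lambda>k. w k / real k powr (- \<theta> - 1)) \<longlonglongrightarrow> \<theta> / (Gamma z / Gamma (z + \<theta>))"
  proof -
    have "(\<lambda>k. \<theta> * (real k / (\<theta> + real k + \<delta>)) / (v k / real k powr \<theta>)) \<longlonglongrightarrow> \<theta> * 1 / (Gamma z / Gamma (z + \<theta>))"
    proof (rule tendsto_divide[OF tendsto_mult[OF tendsto_const] v_lim G_nz])
      show "(\<lambda>k. real k / (\<theta> + real k + \<delta>)) \<longlonglongrightarrow> 1" by real_asymp
    qed
    moreover have "eventually (\<lambda>k. \<theta> * (real k / (\<theta> + real k + \<delta>)) / (v k / real k powr \<theta>)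
        = w k / real k powr (- \<theta> - 1)) sequentially"
      using eventually_gt_at_top[of 0]
    proof eventually_elim
      case (elim k)
      have "real k powr (- \<theta> - 1) = 1 / (real k powr \<theta> * real k)"
        using elim by (simp add: powr_diff powr_minus field_simps)
      then show ?case by (simp add: w_def)
    qed
    ultimately show ?thesis by (simp add: tendsto_cong)
  qed
  have w_rv: "regularly_varying (\<lambda>x. w (nat \<lceil>x\<rceil>)) (- \<theta> - 1)"
    by (rule regularly_varying_of_seq[OF w_lim]) (use \<theta> G_nz in simp)
  have v_rv: "regularly_varying (\<lambda>x. v (nat \<lceil>x\<rceil>)) \<theta>"
    by (rule regularly_varying_of_seq[OF v_lim G_nz])
  have L_rv: "regularly_varying (\<lambda>x. L (of_int \<lceil>x\<rceil>)) 0"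
  proof (rule regularly_varying_equiv[OF _ _ slowly_varying_ceiling[OF L]])
    show "regularly_varying L 0" using L_lim by (simp add: regularly_varying_def)
    show "eventually (\<lambda>x. L x \<noteq> 0) at_top" using L_pos by eventually_elim simp
  qed simp
  have f_eq: "f x = L (of_int \<lceil>x\<rceil>) * of_int \<lceil>x\<rceil> powr (- \<tau>) * v (nat \<lceil>x\<rceil>)" if "x > 0" for x
  proof -
    have "nat \<lceil>x\<rceil> \<ge> 1" "real (nat \<lceil>x\<rceil>) = of_int \<lceil>x\<rceil>" using that by linarith+
    then show ?thesis by (simp add: f_def a_def b)
  qed
  have f_rv: "((\<lambda>x. f (c * x) / f x) \<longlongrightarrow> c powr (\<theta> - \<tau>)) at_top" if "c > 0" for c
  proof -
    have "regularly_varying (\<lambda>x. L (of_int \<lceil>x\<rceil>) * of_int \<lceil>x\<rceil> powr (- \<tau>) * v (nat \<lceil>x\<rceil>)) (0 + (- \<tau>) + \<theta>)"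
      by (intro regularly_varying_mult L_rv v_rv regularly_varying_ceiling_powr)
    then have "((\<lambda>x. L (of_int \<lceil>c * x\<rceil>) * of_int \<lceil>c * x\<rceil> powr (- \<tau>) * v (nat \<lceil>c * x\<rceil>)
        / (L (of_int \<lceil>x\<rceil>) * of_int \<lceil>x\<rceil> powr (- \<tau>) * v (nat \<lceil>x\<rceil>))) \<longlongrightarrow> c powr (\<theta> - \<tau>)) at_top"
      using that by (simp add: regularly_varying_def)
    then show ?thesis
    proof (rule Lim_transform_eventually)
      show "eventually (\<lambda>x. L (of_int \<lceil>c * x\<rceil>) * of_int \<lceil>c * x\<rceil> powr (- \<tau>) * v (nat \<lceil>c * x\<rceil>)
        / (L (of_int \<lceil>x\<rceil>) * of_int \<lceil>x\<rceil> powr (- \<tau>) * v (nat \<lceil>x\<rceil>)) = f (c * x) / f x) at_top"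
        using eventually_gt_at_top[of 0] by eventually_elim (use that f_eq in simp)
    qed
  qed
  have f_pos: "eventually (\<lambda>x. f x > 0) at_top"
    using eventually_gt_at_top[of 0] eventually_compose_filterlim[OF L_pos filterlim_real_of_int_ceiling]
  proof eventually_elim
    case (elim x)
    moreover from elim have "\<lceil>x\<rceil> \<noteq> 0" by linarith
    ultimately show ?case using f_eq[of x] v_pos by simp
  qed
  have f_nonneg: "f x \<ge> 0" for x
    using b_nonneg v_pos by (simp add: f_def a_def less_imp_le)
  have f_int: "set_integrable lborel {0..x} f" for x
    using step_function_set_integrable[of x a] by (simp add: f_def[abs_def])
  have T_nat: "T (real k) = (\<Sum>j=1..k. b j * v j)" for k
    using step_function_integral[of k a] by (simp add: T_def f_def a_def)
  have T_pos: "eventually (\<lambda>x. T x > 0) at_top"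
    unfolding T_def by (rule regularly_varying_integral(1)[OF f_int f_nonneg f_pos f_rv])
  have T_rv: "regularly_varying T (max 0 (\<theta> - \<tau> + 1))"
    unfolding regularly_varying_def T_def
    using regularly_varying_integral(2)[OF f_int f_nonneg f_pos f_rv] by blast
  define \<sigma> where "\<sigma> = min \<tau> (\<theta> + 1)"
  \<comment> \<open>\<open>T\<close> is taken at x itself, since T (real k) is the k-th partial sum
    exactly. The exponent \<sigma> makes the indices -\<theta> - 1, \<sigma> and max 0 (\<theta> -
    \<tau> + 1) add up to 0 in either case of the minimum.\<close>
  define L' where "L' x = w (nat \<lceil>x\<rceil>) * of_int \<lceil>x\<rceil> powr \<sigma> * T x" for x :: real
  have "L' \<in> borel_measurable borel"
  proof -
    have fm[measurable]: "f \<in> borel_measurable borel" unfolding f_def by measurable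
    have "T \<in> borel_measurable borel"
    proof -
      have "T = (\<lambda>x. LBINT t. (if 0 \<le> t \<and> t \<le> x then f t else 0))"
        unfolding T_def set_lebesgue_integral_def
        by (intro ext Bochner_Integration.integral_cong) (auto simp: indicator_def)
      also have "\<dots> \<in> borel_measurable borel" by measurable
      finally show ?thesis .
    qed
    then show ?thesis unfolding L'_def by measurable
  qed
  moreover have "eventually (\<lambda>x. L' x > 0) at_top"
    using T_pos eventually_gt_at_top[of "\<bar>\<delta>\<bar>"]
  proof eventually_elim
    case (elim x)
    have "\<theta> + real (nat \<lceil>x\<rceil>) + \<delta> > 0" "\<lceil>x\<rceil> \<noteq> 0" using elim \<theta> by linarith+
    then show ?case unfolding L'_def w_def using elim v_pos \<theta> by simp
  qed
  moreover have "regularly_varying L' ((- \<theta> - 1) + \<sigma> + max 0 (\<theta> - \<tau> + 1))"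
    unfolding L'_def by (intro regularly_varying_mult w_rv T_rv regularly_varying_ceiling_powr)
  then have "\<forall>c>0. ((\<lambda>x. L' (c * x) / L' x) \<longlongrightarrow> 1) at_top"
    by (simp add: regularly_varying_def \<sigma>_def min_def max_def split: if_splits)
  moreover have "p k = L' (real k) * real k powr (- \<sigma>)" if "k \<ge> 1" for k
    using that by (simp add: L'_def T_nat p_eq powr_minus)
  ultimately show ?thesis unfolding slowly_varying_def \<sigma>_def by blast
qed

section \<open>Sublinear processes in mean\<close>

text \<open>A one-sided Cesaro argument: beyond N the sequence grows with slope at most e/2, and the
  starting value u N is below (e/2) n as soon as n exceeds 2 u N / e.\<close>

lemma sublinear_of_small_increments:
  fixes u s :: "nat \<Rightarrow> real"
  assumes step: "\<And>n. n > n0 \<Longrightarrow> u n \<le> u (n - 1) + s n" and nonneg: "\<And>n. u n \<ge> 0"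
    and s: "s \<longlonglongrightarrow> 0"
  shows "(\<lambda>n. u n / real n) \<longlonglongrightarrow> 0"
proof (rule LIMSEQ_I)
  fix e :: real assume "e > 0"
  then obtain N1 where N1: "\<And>n. n \<ge> N1 \<Longrightarrow> \<bar>s n\<bar> < e / 2"
    using LIMSEQ_D[OF s, of "e / 2"] by auto
  define N where "N = max n0 N1"
  have bound: "u n \<le> u N + e / 2 * real n" if "n \<ge> N" for n
    using that
  proof (induction n rule: dec_induct)
    case base
    then show ?case using \<open>e > 0\<close> by simp
  next
    case (step n)
    have "u (Suc n) \<le> u n + s (Suc n)" using assms(1)[of "Suc n"] step by (simp add: N_def)
    moreover have "s (Suc n) \<le> e / 2" using N1[of "Suc n"] step by (simp add: N_def)
    ultimately show ?case using step.IH by (simp add: algebra_simps add_divide_distrib)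
  qed
  obtain K :: nat where K: "real K > 2 * u N / e" using reals_Archimedean2 by blast
  show "\<exists>no. \<forall>n\<ge>no. norm (u n / real n - 0) < e"
  proof (intro exI allI impI)
    fix n assume n: "n \<ge> Max {N, K, 1}"
    then have n': "n \<ge> N" "n \<ge> K" "n \<ge> 1" by auto
    have "2 * u N / e < real n" using K n' by (meson less_le_trans of_nat_mono)
    then have "u N < e / 2 * real n" using \<open>e > 0\<close> by (simp add: field_simps)
    then have "u n < e * real n" using bound[OF n'(1)] by (simp add: algebra_simps)
    then show "norm (u n / real n - 0) < e" using n' nonneg[of n] by (simp add: field_simps)
  qed
qed

context prob_space
begin

definition L1_sublinear :: "(nat \<Rightarrow> 'a \<Rightarrow> real) \<Rightarrow> bool" where
  "L1_sublinear H \<longleftrightarrow> (\<forall>n. integrable M (H n)) \<and>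
     (\<lambda>n. expectation (\<lambda>\<omega>. \<bar>H n \<omega>\<bar>) / real n) \<longlonglongrightarrow> 0"

lemma L1_sublinearD:
  assumes "L1_sublinear H"
  shows "integrable M (H n)" "(\<lambda>n. expectation (\<lambda>\<omega>. \<bar>H n \<omega>\<bar>) / real n) \<longlonglongrightarrow> 0"
  using assms by (auto simp: L1_sublinear_def)

text \<open>Needed because the attachment of v sees the state after v - 1 vertices but is normalised
  by v.\<close>

lemma L1_sublinear_shift:
  assumes "L1_sublinear H"
  shows "(\<lambda>v. expectation (\<lambda>\<omega>. \<bar>H (v - 1) \<omega>\<bar>) / real v) \<longlonglongrightarrow> 0"
proof -
  have lim: "(\<lambda>v. expectation (\<lambda>\<omega>. \<bar>H v \<omega>\<bar>) / real v * (real v / real (Suc v))) \<longlonglongrightarrow> 0 * 1"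
  proof (intro tendsto_mult L1_sublinearD(2)[OF assms])
    show "(\<lambda>v. real v / real (Suc v)) \<longlonglongrightarrow> 1" by real_asymp
  qed
  have "\<forall>\<^sub>F v in sequentially. expectation (\<lambda>\<omega>. \<bar>H v \<omega>\<bar>) / real v * (real v / real (Suc v))
      = expectation (\<lambda>\<omega>. \<bar>H (Suc v - 1) \<omega>\<bar>) / real (Suc v)"
    using eventually_gt_at_top[of 0] by eventually_elim simp
  from Lim_transform_eventually[OF lim this]
  have "(\<lambda>v. expectation (\<lambda>\<omega>. \<bar>H (Suc v - 1) \<omega>\<bar>) / real (Suc v)) \<longlonglongrightarrow> 0"
    unfolding mult_zero_left .
  then show ?thesis by (rule LIMSEQ_imp_Suc)
qed

lemma L1_sublinear_bound:
  assumes H': "L1_sublinear H'" and meas: "\<And>n. H n \<in> borel_measurable M"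
    and le: "\<And>n. AE \<omega> in M. \<bar>H n \<omega>\<bar> \<le> \<bar>H' n \<omega>\<bar>"
  shows "L1_sublinear H"
proof -
  have int: "integrable M (H n)" for n
    by (rule Bochner_Integration.integrable_bound[OF L1_sublinearD(1)[OF H'] meas]) (use le in simp)
  have "(\<lambda>n. expectation (\<lambda>\<omega>. \<bar>H n \<omega>\<bar>) / real n) \<longlonglongrightarrow> 0"
  proof (rule tendsto_sandwich[OF _ _ tendsto_const L1_sublinearD(2)[OF H']])
    show "\<forall>\<^sub>F n in sequentially. 0 \<le> expectation (\<lambda>\<omega>. \<bar>H n \<omega>\<bar>) / real n" by simp
    show "\<forall>\<^sub>F n in sequentially. expectation (\<lambda>\<omega>. \<bar>H n \<omega>\<bar>) / real n \<le> expectation (\<lambda>\<omega>. \<bar>H' n \<omega>\<bar>) / real n"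
      by (intro always_eventually allI divide_right_mono integral_mono_AE integrable_abs int L1_sublinearD(1)[OF H'] le) simp
  qed
  with int show ?thesis by (auto simp: L1_sublinear_def)
qed

lemma L1_sublinear_add:
  assumes H: "L1_sublinear H" and H': "L1_sublinear H'"
  shows "L1_sublinear (\<lambda>n \<omega>. H n \<omega> + H' n \<omega>)"
  unfolding L1_sublinear_def
proof
  note [simp] = L1_sublinearD(1)[OF H] L1_sublinearD(1)[OF H']
  show "\<forall>n. integrable M (\<lambda>\<omega>. H n \<omega> + H' n \<omega>)" by simp
  show "(\<lambda>n. expectation (\<lambda>\<omega>. \<bar>H n \<omega> + H' n \<omega>\<bar>) / real n) \<longlonglongrightarrow> 0"
  proof (rule tendsto_sandwich[OF _ _ tendsto_const])
    show "(\<lambda>n. expectation (\<lambda>\<omega>. \<bar>H n \<omega>\<bar>) / real n + expectation (\<lambda>\<omega>. \<bar>H' n \<omega>\<bar>) / real n) \<longlonglongrightarrow> 0"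
      using tendsto_add[OF L1_sublinearD(2)[OF H] L1_sublinearD(2)[OF H']] by simp
    have "expectation (\<lambda>\<omega>. \<bar>H n \<omega> + H' n \<omega>\<bar>) \<le> expectation (\<lambda>\<omega>. \<bar>H n \<omega>\<bar>) + expectation (\<lambda>\<omega>. \<bar>H' n \<omega>\<bar>)" for n
      using integral_mono[of M "\<lambda>\<omega>. \<bar>H n \<omega> + H' n \<omega>\<bar>" "\<lambda>\<omega>. \<bar>H n \<omega>\<bar> + \<bar>H' n \<omega>\<bar>"] by simp
    then show "\<forall>\<^sub>F n in sequentially. expectation (\<lambda>\<omega>. \<bar>H n \<omega> + H' n \<omega>\<bar>) / real n
        \<le> expectation (\<lambda>\<omega>. \<bar>H n \<omega>\<bar>) / real n + expectation (\<lambda>\<omega>. \<bar>H' n \<omega>\<bar>) / real n"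
      by (intro always_eventually allI) (simp add: add_divide_distrib[symmetric] divide_right_mono)
  qed simp
qed

lemma L1_sublinear_cmult:
  assumes H: "L1_sublinear H"
  shows "L1_sublinear (\<lambda>n \<omega>. c * H n \<omega>)"
  using L1_sublinearD(1)[OF H] tendsto_mult_right_zero[OF L1_sublinearD(2)[OF H], of "\<bar>c\<bar>"]
  by (auto simp: L1_sublinear_def abs_mult)

lemma L1_sublinear_diff:
  assumes "L1_sublinear H" "L1_sublinear H'"
  shows "L1_sublinear (\<lambda>n \<omega>. H n \<omega> - H' n \<omega>)"
  using L1_sublinear_add[OF assms(1) L1_sublinear_cmult[OF assms(2), of "- 1"]] by simp

lemma L1_sublinear_const:
  assumes "integrable M X"
  shows "L1_sublinear (\<lambda>n. X)"
  using assms lim_const_over_n[of "expectation (\<lambda>\<omega>. \<bar>X \<omega>\<bar>)"] by (simp add: L1_sublinear_def)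

lemma L1_sublinear_sum:
  assumes int: "\<And>v. v \<ge> l \<Longrightarrow> integrable M (h v)" and lim: "(\<lambda>v. expectation (\<lambda>\<omega>. \<bar>h v \<omega>\<bar>)) \<longlonglongrightarrow> 0"
  shows "L1_sublinear (\<lambda>n \<omega>. \<Sum>v=l..n. h v \<omega>)"
proof (rule L1_sublinear_bound)
  show "L1_sublinear (\<lambda>n \<omega>. \<Sum>v=l..n. \<bar>h v \<omega>\<bar>)"
    unfolding L1_sublinear_def
  proof
    show "\<forall>n. integrable M (\<lambda>\<omega>. \<Sum>v=l..n. \<bar>h v \<omega>\<bar>)"
      by (intro allI Bochner_Integration.integrable_sum integrable_abs int) simp
    define u where "u n = expectation (\<lambda>\<omega>. \<Sum>v=l..n. \<bar>h v \<omega>\<bar>)" for n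
    have u: "u n = (\<Sum>v=l..n. expectation (\<lambda>\<omega>. \<bar>h v \<omega>\<bar>))" for n
      unfolding u_def by (intro Bochner_Integration.integral_sum integrable_abs int) simp
    have "(\<lambda>n. u n / real n) \<longlonglongrightarrow> 0"
    proof (rule sublinear_of_small_increments[OF _ _ lim])
      fix n assume "n > l"
      then obtain k where k: "n = Suc k" "l \<le> Suc k" by (cases n) auto
      show "u n \<le> u (n - 1) + expectation (\<lambda>\<omega>. \<bar>h n \<omega>\<bar>)"
        using k by (simp add: u sum.nat_ivl_Suc')
    qed (simp add: u sum_nonneg)
    then show "(\<lambda>n. expectation (\<lambda>\<omega>. \<bar>\<Sum>v=l..n. \<bar>h v \<omega>\<bar>\<bar>) / real n) \<longlonglongrightarrow> 0"
      by (simp add: u_def)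
  qed
  show "(\<lambda>\<omega>. \<Sum>v=l..n. h v \<omega>) \<in> borel_measurable M" for n
    by (intro borel_measurable_integrable Bochner_Integration.integrable_sum int) simp
  show "AE \<omega> in M. \<bar>\<Sum>v=l..n. h v \<omega>\<bar> \<le> \<bar>\<Sum>v=l..n. \<bar>h v \<omega>\<bar>\<bar>" for n
    by (auto intro!: AE_I2 sum_abs)
qed

text \<open>This closure property carries both truncations: of the summands in the law of large
  numbers and of the number of edges per vertex in the attachment noise.\<close>

lemma L1_sublinear_approx:
  assumes int: "\<And>n. integrable M (H n)"
    and approx: "\<And>e. e > 0 \<Longrightarrow> \<exists>H'. L1_sublinear H' \<and> (\<forall>n. expectation (\<lambda>\<omega>. \<bar>H n \<omega> - H' n \<omega>\<bar>) \<le> e * real n)"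
  shows "L1_sublinear H"
proof -
  have "(\<lambda>n. expectation (\<lambda>\<omega>. \<bar>H n \<omega>\<bar>) / real n) \<longlonglongrightarrow> 0"
  proof (rule LIMSEQ_I)
    fix e :: real assume "e > 0"
    then obtain H' where H': "L1_sublinear H'"
      and close: "\<And>n. expectation (\<lambda>\<omega>. \<bar>H n \<omega> - H' n \<omega>\<bar>) \<le> e / 2 * real n"
      using approx[of "e / 2"] by auto
    obtain N where N: "\<And>n. n \<ge> N \<Longrightarrow> \<bar>expectation (\<lambda>\<omega>. \<bar>H' n \<omega>\<bar>) / real n\<bar> < e / 2"
      using LIMSEQ_D[OF L1_sublinearD(2)[OF H'], of "e / 2"] \<open>e > 0\<close> by auto
    show "\<exists>no. \<forall>n\<ge>no. norm (expectation (\<lambda>\<omega>. \<bar>H n \<omega>\<bar>) / real n - 0) < e"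
    proof (intro exI allI impI)
      fix n assume n: "n \<ge> max N 1"
      have "expectation (\<lambda>\<omega>. \<bar>H n \<omega>\<bar>) \<le> expectation (\<lambda>\<omega>. \<bar>H n \<omega> - H' n \<omega>\<bar> + \<bar>H' n \<omega>\<bar>)"
        using int L1_sublinearD(1)[OF H'] by (intro integral_mono) auto
      also have "\<dots> = expectation (\<lambda>\<omega>. \<bar>H n \<omega> - H' n \<omega>\<bar>) + expectation (\<lambda>\<omega>. \<bar>H' n \<omega>\<bar>)"
        using int L1_sublinearD(1)[OF H'] by simp
      also have "\<dots> < e / 2 * real n + e / 2 * real n"
        using close[of n] N[of n] n by (intro add_le_less_mono) (auto simp: field_simps)
      finally have "expectation (\<lambda>\<omega>. \<bar>H n \<omega>\<bar>) < e * real n" by simp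
      then show "norm (expectation (\<lambda>\<omega>. \<bar>H n \<omega>\<bar>) / real n - 0) < e"
        using n by (simp add: field_simps)
    qed
  qed
  with int show ?thesis by (auto simp: L1_sublinear_def)
qed

text \<open>A variance of order n gives a mean absolute value of order sqrt n; the pointwise
  inequality with s = sqrt n takes the place of Cauchy-Schwarz.\<close>

lemma L1_sublinear_of_second_moment:
  assumes int: "\<And>n. integrable M (H n)" and int2: "\<And>n. integrable M (\<lambda>\<omega>. (H n \<omega>)\<^sup>2)"
    and bound: "\<And>n. expectation (\<lambda>\<omega>. (H n \<omega>)\<^sup>2) \<le> C * real n"
  shows "L1_sublinear H"
proof -
  have "(\<lambda>n. expectation (\<lambda>\<omega>. \<bar>H n \<omega>\<bar>) / real n) \<longlonglongrightarrow> 0"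
  proof (rule tendsto_sandwich[OF _ _ tendsto_const])
    show "(\<lambda>n. (1 + C) / sqrt (real n)) \<longlonglongrightarrow> 0" by real_asymp
    show "\<forall>\<^sub>F n in sequentially. expectation (\<lambda>\<omega>. \<bar>H n \<omega>\<bar>) / real n \<le> (1 + C) / sqrt (real n)"
      using eventually_gt_at_top[of 0]
    proof eventually_elim
      case (elim n)
      define s where "s = sqrt (real n)"
      have s: "s > 0" "s * s = real n" using elim by (auto simp: s_def)
      \<comment> \<open>AM-GM: \<open>2 s \<bar>x\<bar> \<le> s\<^sup>2 + x\<^sup>2\<close>\<close>
      have pt: "\<bar>x\<bar> \<le> s + x\<^sup>2 / s" for x :: real
      proof -
        have "0 \<le> (s - \<bar>x\<bar>)\<^sup>2 + s * \<bar>x\<bar>" using s by simp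
        then have "\<bar>x\<bar> * s \<le> s * s + x\<^sup>2" using s by (simp add: power2_eq_square algebra_simps)
        then show ?thesis using s by (simp add: field_simps power2_eq_square)
      qed
      have "expectation (\<lambda>\<omega>. \<bar>H n \<omega>\<bar>) \<le> expectation (\<lambda>\<omega>. s + (H n \<omega>)\<^sup>2 / s)"
        using int int2 by (intro integral_mono pt) auto
      also have "\<dots> = s + expectation (\<lambda>\<omega>. (H n \<omega>)\<^sup>2) / s"
        using int2 by (simp add: prob_space)
      also have "\<dots> \<le> s + C * real n / s"
        using bound[of n] s by (intro add_left_mono divide_right_mono) auto
      also have "\<dots> = (1 + C) * s" using s by (simp add: field_simps flip: s(2))
      finally have "expectation (\<lambda>\<omega>. \<bar>H n \<omega>\<bar>) / real n \<le> (1 + C) * s / real n"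
        by (intro divide_right_mono) auto
      also have "\<dots> = (1 + C) / s" using s by (simp add: field_simps flip: s(2))
      finally show ?case by (simp add: s_def)
    qed
  qed (use int in auto)
  with int show ?thesis by (auto simp: L1_sublinear_def)
qed

lemma integrable_AE_bounded:
  fixes f :: "'a \<Rightarrow> real"
  assumes "f \<in> borel_measurable M" "AE \<omega> in M. \<bar>f \<omega>\<bar> \<le> B"
  shows "integrable M f"
  using assms by (intro integrable_const_bound[of _ B]) auto

lemma orthogonal_sum_second_moment:
  fixes D :: "'i \<Rightarrow> 'a \<Rightarrow> real"
  assumes "finite I" and meas[measurable]: "\<And>i. i \<in> I \<Longrightarrow> D i \<in> borel_measurable M"
    and bdd: "\<And>i. i \<in> I \<Longrightarrow> AE \<omega> in M. \<bar>D i \<omega>\<bar> \<le> B"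
    and orth: "\<And>i j. i \<in> I \<Longrightarrow> j \<in> I \<Longrightarrow> i \<noteq> j \<Longrightarrow> expectation (\<lambda>\<omega>. D i \<omega> * D j \<omega>) = 0"
  shows "integrable M (\<lambda>\<omega>. (\<Sum>i\<in>I. D i \<omega>)\<^sup>2)"
    and "expectation (\<lambda>\<omega>. (\<Sum>i\<in>I. D i \<omega>)\<^sup>2) \<le> B\<^sup>2 * real (card I)"
proof -
  have prod_bdd: "AE \<omega> in M. \<bar>D i \<omega> * D j \<omega>\<bar> \<le> B\<^sup>2" if "i \<in> I" "j \<in> I" for i j
    using bdd[OF that(1)] bdd[OF that(2)]
  proof eventually_elim
    case (elim \<omega>)
    then have "\<bar>D i \<omega>\<bar> * \<bar>D j \<omega>\<bar> \<le> B * B" by (intro mult_mono) auto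
    then show ?case by (simp add: abs_mult power2_eq_square)
  qed
  have int: "integrable M (\<lambda>\<omega>. D i \<omega> * D j \<omega>)" if "i \<in> I" "j \<in> I" for i j
    using that by (intro integrable_AE_bounded[OF _ prod_bdd]) auto
  have eq: "(\<Sum>i\<in>I. D i \<omega>)\<^sup>2 = (\<Sum>i\<in>I. \<Sum>j\<in>I. D i \<omega> * D j \<omega>)" for \<omega>
    by (simp add: power2_eq_square sum_product)
  show "integrable M (\<lambda>\<omega>. (\<Sum>i\<in>I. D i \<omega>)\<^sup>2)"
    unfolding eq using int by (intro Bochner_Integration.integrable_sum)
  have "expectation (\<lambda>\<omega>. (\<Sum>i\<in>I. D i \<omega>)\<^sup>2) = (\<Sum>i\<in>I. \<Sum>j\<in>I. expectation (\<lambda>\<omega>. D i \<omega> * D j \<omega>))"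
    unfolding eq using int by (simp add: Bochner_Integration.integral_sum)
  also have "\<dots> = (\<Sum>i\<in>I. expectation (\<lambda>\<omega>. D i \<omega> * D i \<omega>))"
  proof (rule sum.cong[OF refl])
    fix i assume i: "i \<in> I"
    have "(\<Sum>j\<in>I. expectation (\<lambda>\<omega>. D i \<omega> * D j \<omega>))
        = expectation (\<lambda>\<omega>. D i \<omega> * D i \<omega>) + (\<Sum>j\<in>I - {i}. expectation (\<lambda>\<omega>. D i \<omega> * D j \<omega>))"
      by (rule sum.remove[OF \<open>finite I\<close> i])
    also have "(\<Sum>j\<in>I - {i}. expectation (\<lambda>\<omega>. D i \<omega> * D j \<omega>)) = 0"
      using orth i by (intro sum.neutral) auto
    finally show "(\<Sum>j\<in>I. expectation (\<lambda>\<omega>. D i \<omega> * D j \<omega>)) = expectation (\<lambda>\<omega>. D i \<omega> * D i \<omega>)" by simp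
  qed
  also have "\<dots> \<le> (\<Sum>i\<in>I. B\<^sup>2)"
  proof (rule sum_mono)
    fix i assume i: "i \<in> I"
    have "expectation (\<lambda>\<omega>. D i \<omega> * D i \<omega>) \<le> expectation (\<lambda>\<omega>. B\<^sup>2)"
      using prod_bdd[OF i i] by (intro integral_mono_AE int i) auto
    then show "expectation (\<lambda>\<omega>. D i \<omega> * D i \<omega>) \<le> B\<^sup>2" by (simp add: prob_space)
  qed
  finally show "expectation (\<lambda>\<omega>. (\<Sum>i\<in>I. D i \<omega>)\<^sup>2) \<le> B\<^sup>2 * real (card I)" by (simp add: mult.commute)
qed

text \<open>
  With \<open>U\<^sub>n = A\<^sub>n - x n - W\<^sub>n\<close>, where \<open>W\<^sub>n\<close> is the process assumed to be sublinear, the recursion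
  becomes \<open>U\<^sub>n - U\<^bsub>n-1\<^esub> = - (a / n) (U\<^bsub>n-1\<^esub> + W\<^bsub>n-1\<^esub> - x)\<close>, so the increments of \<open>E \<bar>U\<^sub>n\<bar>\<close> tend to 0.
\<close>
lemma L1_linear_recursion:
  fixes A :: "nat \<Rightarrow> 'a \<Rightarrow> real"
  assumes int: "\<And>n. integrable M (A n)" and "a \<ge> 0"
    and W: "L1_sublinear (\<lambda>n \<omega>. A n \<omega> + (\<Sum>v=3..n. a / real v * A (v - 1) \<omega>) - f * real n)"
  shows "L1_sublinear (\<lambda>n \<omega>. A n \<omega> - f / (1 + a) * real n)"
proof -
  define x where "x = f / (1 + a)"
  have fx: "f = x * (1 + a)" using \<open>a \<ge> 0\<close> by (simp add: x_def)
  define W where "W n \<omega> = A n \<omega> + (\<Sum>v=3..n. a / real v * A (v - 1) \<omega>) - f * real n" for n \<omega>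
  define U where "U n \<omega> = A n \<omega> - x * real n - W n \<omega>" for n \<omega>
  have W: "L1_sublinear W" using assms(3) by (simp add: W_def[abs_def])
  note W_int[simp] = L1_sublinearD(1)[OF W]
  have U_int[simp]: "integrable M (U n)" for n unfolding U_def[abs_def] using int by simp
  \<comment> \<open>Beyond \<lceil>a\<rceil> the factor 1 - a / n in front of the previous
    \<open>U\<close> lies in [0, 1], so the feedback cannot enlarge the mean of its absolute
    value.\<close>
  define n0 where "n0 = max 3 (nat \<lceil>a\<rceil>)"
  define s where "s n = a / real n * (expectation (\<lambda>\<omega>. \<bar>W (n - 1) \<omega>\<bar>) + \<bar>x\<bar>)" for n
  have "(\<lambda>n. expectation (\<lambda>\<omega>. \<bar>U n \<omega>\<bar>) / real n) \<longlonglongrightarrow> 0"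
  proof (rule sublinear_of_small_increments)
    fix n assume n: "n > n0"
    then have n3: "n > 3" and "nat \<lceil>a\<rceil> < n" by (auto simp: n0_def)
    then have an: "a / real n \<le> 1" by (simp, linarith)
    obtain k where k: "n = Suc k" "k \<ge> 3" using n3 by (cases n) auto
    have U_rec: "U n \<omega> = (1 - a / real n) * U (n - 1) \<omega> - a / real n * W (n - 1) \<omega> + a / real n * x" for \<omega>
    proof -
      have "W n \<omega> - A n \<omega> = W (n - 1) \<omega> - A (n - 1) \<omega> + a / real n * A (n - 1) \<omega> - f"
        using k by (simp add: W_def sum.nat_ivl_Suc' algebra_simps)
      then have "U n \<omega> = U (n - 1) \<omega> - a / real n * A (n - 1) \<omega> + f - x"
        using k by (simp add: U_def algebra_simps)
      moreover have "a / real n * A (n - 1) \<omega>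
          = a / real n * U (n - 1) \<omega> + a / real n * W (n - 1) \<omega> + (a * x - a / real n * x)"
      proof -
        have "A (n - 1) \<omega> = U (n - 1) \<omega> + W (n - 1) \<omega> + x * (real n - 1)"
          using k by (simp add: U_def)
        moreover have "a / real n * (x * (real n - 1)) = a * x - a / real n * x"
          using k by (simp add: field_simps)
        ultimately show ?thesis by (simp only: distrib_left)
      qed
      moreover have "(1 - a / real n) * U (n - 1) \<omega> = U (n - 1) \<omega> - a / real n * U (n - 1) \<omega>"
        by (simp only: left_diff_distrib mult_1)
      moreover have "f = x + a * x" by (simp add: fx distrib_left)
      ultimately show ?thesis by linarith
    qed
    have "expectation (\<lambda>\<omega>. \<bar>U n \<omega>\<bar>) \<le> expectation (\<lambda>\<omega>. \<bar>U (n - 1) \<omega>\<bar> + a / real n * (\<bar>W (n - 1) \<omega>\<bar> + \<bar>x\<bar>))"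
    proof (intro integral_mono)
      fix \<omega>
      have "\<bar>U n \<omega>\<bar> \<le> \<bar>(1 - a / real n) * U (n - 1) \<omega>\<bar> + \<bar>a / real n * W (n - 1) \<omega>\<bar> + \<bar>a / real n * x\<bar>"
        unfolding U_rec by linarith
      moreover have "\<bar>(1 - a / real n) * U (n - 1) \<omega>\<bar> \<le> 1 * \<bar>U (n - 1) \<omega>\<bar>"
        unfolding abs_mult using an \<open>a \<ge> 0\<close> by (intro mult_right_mono) auto
      ultimately show "\<bar>U n \<omega>\<bar> \<le> \<bar>U (n - 1) \<omega>\<bar> + a / real n * (\<bar>W (n - 1) \<omega>\<bar> + \<bar>x\<bar>)"
        using \<open>a \<ge> 0\<close> by (simp add: abs_mult distrib_left)
    qed auto
    also have "\<dots> = expectation (\<lambda>\<omega>. \<bar>U (n - 1) \<omega>\<bar>) + s n"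
      by (simp add: s_def prob_space)
    finally show "expectation (\<lambda>\<omega>. \<bar>U n \<omega>\<bar>) \<le> expectation (\<lambda>\<omega>. \<bar>U (n - 1) \<omega>\<bar>) + s n" .
  next
    have "(\<lambda>n. a * (expectation (\<lambda>\<omega>. \<bar>W (n - 1) \<omega>\<bar>) / real n + \<bar>x\<bar> / real n)) \<longlonglongrightarrow> a * (0 + 0)"
      by (intro tendsto_mult tendsto_add tendsto_const L1_sublinear_shift[OF W] lim_const_over_n)
    then show "s \<longlonglongrightarrow> 0" by (simp add: s_def[abs_def] add_divide_distrib distrib_left)
  qed simp
  then have "L1_sublinear U" by (simp add: L1_sublinear_def)
  then have "L1_sublinear (\<lambda>n \<omega>. U n \<omega> + W n \<omega>)" by (intro L1_sublinear_add W)
  then show ?thesis by (simp add: U_def x_def)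
qed

section \<open>Law of large numbers in mean\<close>

text \<open>The function \<open>g\<close> makes room for an absolute deviation: the intended use has
  Y i as the out-degree of a new vertex and g of the sum as the deviation of the earlier out-degrees
  from their mean.\<close>

lemma indep_vars_product_expectation:
  fixes Y :: "'i \<Rightarrow> 'a \<Rightarrow> real"
  assumes indep: "indep_vars (\<lambda>_. borel) Y (insert i I)" and "finite I" "i \<notin> I"
    and int: "\<And>k. k \<in> insert i I \<Longrightarrow> integrable M (Y k)"
    and g[measurable]: "g \<in> borel_measurable borel" and g_int: "integrable M (\<lambda>\<omega>. g (\<Sum>k\<in>I. Y k \<omega>))"
  shows "integrable M (\<lambda>\<omega>. Y i \<omega> * g (\<Sum>k\<in>I. Y k \<omega>))"
    and "expectation (\<lambda>\<omega>. Y i \<omega> * g (\<Sum>k\<in>I. Y k \<omega>)) = expectation (Y i) * expectation (\<lambda>\<omega>. g (\<Sum>k\<in>I. Y k \<omega>))"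
proof -
  have "indep_var borel (Y i) borel (\<lambda>\<omega>. \<Sum>k\<in>I. Y k \<omega>)"
    using assms by (intro indep_vars_sum) auto
  then have "indep_var borel ((\<lambda>x. x) \<circ> Y i) borel (g \<circ> (\<lambda>\<omega>. \<Sum>k\<in>I. Y k \<omega>))"
    by (rule indep_var_compose) auto
  then have ind: "indep_var borel (Y i) borel (\<lambda>\<omega>. g (\<Sum>k\<in>I. Y k \<omega>))"
    by (simp add: comp_def)
  show "integrable M (\<lambda>\<omega>. Y i \<omega> * g (\<Sum>k\<in>I. Y k \<omega>))"
    "expectation (\<lambda>\<omega>. Y i \<omega> * g (\<Sum>k\<in>I. Y k \<omega>)) = expectation (Y i) * expectation (\<lambda>\<omega>. g (\<Sum>k\<in>I. Y k \<omega>))"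
    using indep_var_integrable[OF ind] indep_var_lebesgue_integral[OF ind] int g_int by auto
qed

lemma expectation_of_pmf_law:
  fixes f :: "nat \<Rightarrow> real"
  assumes X[measurable]: "X \<in> M \<rightarrow>\<^sub>M count_space UNIV" and law: "distr M (count_space UNIV) X = measure_pmf Q"
  shows "integrable M (\<lambda>\<omega>. f (X \<omega>)) \<longleftrightarrow> integrable (measure_pmf Q) f"
    and "expectation (\<lambda>\<omega>. f (X \<omega>)) = measure_pmf.expectation Q f"
  using integrable_distr_eq[OF X, of f] integral_distr[OF X, of f] by (simp_all add: law)

text \<open>With \<open>f\<close> cut to 0 where it exceeds K in absolute value, the centred
  summands are bounded and orthogonal, hence of variance O(n). Each summand loses at most e/2 in
  mean by the cut and at most e/2 by the resulting shift of the expectation.\<close>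

lemma L1_law_of_large_numbers:
  fixes X :: "nat \<Rightarrow> 'a \<Rightarrow> nat" and f :: "nat \<Rightarrow> real"
  assumes indep: "indep_vars (\<lambda>_. count_space UNIV) X {l..}"
    and law: "\<And>i. i \<ge> l \<Longrightarrow> distr M (count_space UNIV) (X i) = measure_pmf Q"
    and f: "integrable (measure_pmf Q) f" and "l \<ge> 1"
  shows "L1_sublinear (\<lambda>n \<omega>. \<Sum>v=l..n. f (X v \<omega>) - measure_pmf.expectation Q f)"
proof (rule L1_sublinear_approx)
  have X[measurable]: "X i \<in> M \<rightarrow>\<^sub>M count_space UNIV" if "i \<ge> l" for i
    using indep that by (auto simp: indep_vars_def)
  note transfer = expectation_of_pmf_law[OF X law]
  show int: "integrable M (\<lambda>\<omega>. \<Sum>v=l..n. f (X v \<omega>) - measure_pmf.expectation Q f)" for n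
    using transfer f by (intro Bochner_Integration.integrable_sum Bochner_Integration.integrable_diff) auto
  fix e :: real assume "e > 0"
  define h where "h K k = (if \<bar>f k\<bar> \<le> real K then f k else 0)" for K k
  have h_int: "integrable (measure_pmf Q) (h K)" for K
    by (intro measure_pmf.integrable_const_bound[of _ "real K"]) (auto simp: h_def)
  have "(\<lambda>K. measure_pmf.expectation Q (\<lambda>k. \<bar>f k - h K k\<bar>)) \<longlonglongrightarrow> measure_pmf.expectation Q (\<lambda>k. 0)"
  proof (rule integral_dominated_convergence)
    show "integrable (measure_pmf Q) (\<lambda>k. \<bar>f k\<bar>)" using f by simp
    show "AE k in measure_pmf Q. (\<lambda>K. \<bar>f k - h K k\<bar>) \<longlonglongrightarrow> 0"
    proof (rule AE_I2)
      fix k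
      obtain N :: nat where N: "\<bar>f k\<bar> \<le> real N" using real_arch_simple by blast
      show "(\<lambda>K. \<bar>f k - h K k\<bar>) \<longlonglongrightarrow> 0"
        by (rule tendsto_eventually) (use N in \<open>auto simp: h_def eventually_sequentially intro!: exI[of _ N]\<close>)
    qed
  qed (auto simp: h_def)
  then have "\<forall>\<^sub>F K in sequentially. measure_pmf.expectation Q (\<lambda>k. \<bar>f k - h K k\<bar>) < e / 2"
    using \<open>e > 0\<close> by (intro order_tendstoD(2)) auto
  then obtain K where K: "measure_pmf.expectation Q (\<lambda>k. \<bar>f k - h K k\<bar>) < e / 2"
    using eventually_happens'[OF sequentially_bot] by blast
  define \<mu> where "\<mu> = measure_pmf.expectation Q (h K)"
  define D where "D v \<omega> = h K (X v \<omega>) - \<mu>" for v \<omega>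
  have D_meas: "D v \<in> borel_measurable M" if "v \<ge> l" for v
    unfolding D_def using X[OF that] by measurable
  have D_bound: "AE \<omega> in M. \<bar>D v \<omega>\<bar> \<le> real K + \<bar>\<mu>\<bar>" for v
    by (auto intro!: AE_I2 simp: D_def h_def)
  have D_int: "integrable M (D v)" if "v \<ge> l" for v
    by (rule integrable_AE_bounded[OF D_meas[OF that] D_bound])
  have D_mean: "expectation (D v) = 0" if "v \<ge> l" for v
    using transfer[OF that that, of "h K"] h_int by (simp add: D_def[abs_def] \<mu>_def prob_space)
  have D_indep: "indep_vars (\<lambda>_. borel) D {l..}"
    unfolding D_def[abs_def] by (rule indep_vars_compose2[OF indep]) simp
  have orth: "expectation (\<lambda>\<omega>. D i \<omega> * D j \<omega>) = 0" if "i \<in> {l..n}" "j \<in> {l..n}" "i \<noteq> j" for i j n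
    using indep_vars_product_expectation(2)[of D i "{j}" "\<lambda>x. x"] indep_vars_subset[OF D_indep, of "{i, j}"] that D_int D_mean
    by auto
  have "L1_sublinear (\<lambda>n \<omega>. \<Sum>v=l..n. D v \<omega>)"
  proof (rule L1_sublinear_of_second_moment)
    show "integrable M (\<lambda>\<omega>. \<Sum>v=l..n. D v \<omega>)" for n using D_int by auto
    show "integrable M (\<lambda>\<omega>. (\<Sum>v=l..n. D v \<omega>)\<^sup>2)" for n
      using D_meas D_bound orth by (intro orthogonal_sum_second_moment(1)) auto
    have "expectation (\<lambda>\<omega>. (\<Sum>v=l..n. D v \<omega>)\<^sup>2) \<le> (real K + \<bar>\<mu>\<bar>)\<^sup>2 * real (card {l..n})" for n
      using D_meas D_bound orth by (intro orthogonal_sum_second_moment(2)) auto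
    also have "(real K + \<bar>\<mu>\<bar>)\<^sup>2 * real (card {l..n}) \<le> (real K + \<bar>\<mu>\<bar>)\<^sup>2 * real n" for n
      using \<open>l \<ge> 1\<close> by (intro mult_left_mono) auto
    finally show "expectation (\<lambda>\<omega>. (\<Sum>v=l..n. D v \<omega>)\<^sup>2) \<le> (real K + \<bar>\<mu>\<bar>)\<^sup>2 * real n" for n .
  qed
  moreover have "expectation (\<lambda>\<omega>. \<bar>(\<Sum>v=l..n. f (X v \<omega>) - measure_pmf.expectation Q f) - (\<Sum>v=l..n. D v \<omega>)\<bar>) \<le> e * real n" for n
  proof -
    let ?E = "measure_pmf.expectation Q f"
    have tail_int: "integrable M (\<lambda>\<omega>. \<bar>f (X v \<omega>) - h K (X v \<omega>)\<bar>)"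
      and tail: "expectation (\<lambda>\<omega>. \<bar>f (X v \<omega>) - h K (X v \<omega>)\<bar>) < e / 2" if "v \<ge> l" for v
      using transfer[OF that that, of "\<lambda>k. \<bar>f k - h K k\<bar>"] f h_int K by auto
    have mean: "\<bar>?E - \<mu>\<bar> \<le> e / 2"
      using K integral_abs_bound[of "measure_pmf Q" "\<lambda>k. f k - h K k"] f h_int by (simp add: \<mu>_def)
    have "expectation (\<lambda>\<omega>. \<bar>(\<Sum>v=l..n. f (X v \<omega>) - ?E) - (\<Sum>v=l..n. D v \<omega>)\<bar>)
        \<le> expectation (\<lambda>\<omega>. \<Sum>v=l..n. \<bar>f (X v \<omega>) - h K (X v \<omega>)\<bar> + e / 2)"
    proof (rule integral_mono)
      show "integrable M (\<lambda>\<omega>. \<bar>(\<Sum>v=l..n. f (X v \<omega>) - ?E) - (\<Sum>v=l..n. D v \<omega>)\<bar>)"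
        by (intro integrable_abs Bochner_Integration.integrable_diff int Bochner_Integration.integrable_sum D_int) auto
      show "integrable M (\<lambda>\<omega>. \<Sum>v=l..n. \<bar>f (X v \<omega>) - h K (X v \<omega>)\<bar> + e / 2)"
        by (intro Bochner_Integration.integrable_sum Bochner_Integration.integrable_add tail_int) auto
      fix \<omega>
      have "\<bar>(\<Sum>v=l..n. f (X v \<omega>) - ?E) - (\<Sum>v=l..n. D v \<omega>)\<bar> \<le> (\<Sum>v=l..n. \<bar>f (X v \<omega>) - ?E - D v \<omega>\<bar>)"
        by (subst sum_subtractf[symmetric]) (rule sum_abs)
      also have "\<dots> \<le> (\<Sum>v=l..n. \<bar>f (X v \<omega>) - h K (X v \<omega>)\<bar> + e / 2)"
        using mean unfolding D_def by (intro sum_mono) linarith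
      finally show "\<bar>(\<Sum>v=l..n. f (X v \<omega>) - ?E) - (\<Sum>v=l..n. D v \<omega>)\<bar>
          \<le> (\<Sum>v=l..n. \<bar>f (X v \<omega>) - h K (X v \<omega>)\<bar> + e / 2)" .
    qed
    also have "\<dots> = (\<Sum>v=l..n. expectation (\<lambda>\<omega>. \<bar>f (X v \<omega>) - h K (X v \<omega>)\<bar>) + e / 2)"
      using tail_int by (subst Bochner_Integration.integral_sum) (auto simp: prob_space intro!: sum.cong)
    also have "\<dots> \<le> (\<Sum>v=l..n. e / 2 + e / 2)"
      using tail by (intro sum_mono add_right_mono) (auto intro: less_imp_le)
    also have "\<dots> \<le> e * real n"
      using \<open>l \<ge> 1\<close> \<open>e > 0\<close> by simp
    finally show ?thesis .
  qed
  ultimately show "\<exists>H'. L1_sublinear H' \<and> (\<forall>n. expectation (\<lambda>\<omega>. \<bar>(\<Sum>v=l..n. f (X v \<omega>) - measure_pmf.expectation Q f) - H' n \<omega>\<bar>) \<le> e * real n)"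
    by blast
qed

end

section \<open>The attachment process\<close>

lemma vdegree_append: "vdegree (g @ h) u = vdegree g u + vdegree h u"
  by (simp add: vdegree_def)

lemma vdegree_snoc: "vdegree (g @ [(v, e)]) u = vdegree g u + of_bool (u = v) + of_bool (u = e)"
  by (simp add: vdegree_def)

text \<open>The range \<open>n\<close> is separate from the graph: while v is being attached, the
  count runs over 1, ..., v - 1, and v itself is added once, when its step is complete.\<close>

definition deg_count :: "nat \<Rightarrow> multigraph \<Rightarrow> nat \<Rightarrow> real" where
  "deg_count k g n = (\<Sum>u=1..n. of_bool (vdegree g u = k))"

text \<open>The change in the number of vertices of degree k if u gains one edge end. Adding 1 to
  the degree avoids truncated subtraction at k = 0.\<close>

definition deg_flow :: "nat \<Rightarrow> multigraph \<Rightarrow> nat \<Rightarrow> real" where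
  "deg_flow k g u = of_bool (vdegree g u + 1 = k) - of_bool (vdegree g u = k)"

lemma deg_flow_bound: "\<bar>deg_flow k g u\<bar> \<le> 1"
  by (auto simp: deg_flow_def)

lemma deg_count_bounds: "0 \<le> deg_count k g n" "deg_count k g n \<le> real n"
proof -
  show "0 \<le> deg_count k g n" by (auto simp: deg_count_def intro: sum_nonneg)
  have "deg_count k g n \<le> (\<Sum>u=1..n. 1)" unfolding deg_count_def by (intro sum_mono) auto
  then show "deg_count k g n \<le> real n" by simp
qed

text \<open>As n < v, the end v of the new edge lies outside the counted range, so only the chosen
  end matters.\<close>

lemma deg_count_snoc:
  assumes "n < v"
  shows "deg_count k (g @ [(v, e)]) n = deg_count k g n + (\<Sum>u=1..n. of_bool (e = u) * deg_flow k g u)"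
  unfolding deg_count_def sum.distrib[symmetric]
  by (intro sum.cong) (use assms in \<open>auto simp: vdegree_snoc deg_flow_def\<close>)

lemma sum_eq_single:
  assumes "finite A" "x \<in> A" "\<And>y. y \<in> A \<Longrightarrow> y \<noteq> x \<Longrightarrow> f y = (0::real)"
  shows "sum f A = f x"
  using assms by (subst sum.remove[of A x]) (auto intro!: sum.neutral)

lemma deg_count_snoc_bound:
  assumes "n < v"
  shows "\<bar>deg_count k (g @ [(v, e)]) n - deg_count k g n\<bar> \<le> 1"
proof -
  have "(\<Sum>u=1..n. of_bool (e = u) * deg_flow k g u) = (if e \<in> {1..n} then deg_flow k g e else 0)"
  proof (cases "e \<in> {1..n}")
    case True
    then have "(\<Sum>u=1..n. of_bool (e = u) * deg_flow k g u) = of_bool (e = e) * deg_flow k g e"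
      by (intro sum_eq_single) auto
    then show ?thesis using True by simp
  qed (auto intro!: sum.neutral)
  then show ?thesis using deg_flow_bound[of k g e] by (simp add: deg_count_snoc[OF assms])
qed

text \<open>For old vertices all models have the numerator degree + \<delta>, which is constant on
  each degree class; the weighted flow therefore only sees the classes k - 1 (inflow) and k
  (outflow).\<close>

lemma attachment_drift:
  assumes "k \<ge> 1"
  shows "(\<Sum>u=1..v-1. pa_attach_prob model \<delta> a b g v j u * deg_flow k g u)
    = ((real k - 1 + \<delta>) * deg_count (k - 1) g (v - 1) - (real k + \<delta>) * deg_count k g (v - 1)) / pa_norm model \<delta> a b v j"
proof -
  have "(\<Sum>u=1..v-1. pa_attach_prob model \<delta> a b g v j u * deg_flow k g u)
      = (\<Sum>u=1..v-1. ((real k - 1 + \<delta>) * of_bool (vdegree g u = k - 1) - (real k + \<delta>) * of_bool (vdegree g u = k)) / pa_norm model \<delta> a b v j)"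
  proof (rule sum.cong[OF refl])
    fix u assume "u \<in> {1..v-1}"
    then have u: "1 \<le> u" "u < v" by auto
    have "(real (vdegree g u) + \<delta>) * deg_flow k g u
        = (real k - 1 + \<delta>) * of_bool (vdegree g u = k - 1) - (real k + \<delta>) * of_bool (vdegree g u = k)"
      using assms by (cases k) (auto simp: deg_flow_def)
    then show "pa_attach_prob model \<delta> a b g v j u * deg_flow k g u
        = ((real k - 1 + \<delta>) * of_bool (vdegree g u = k - 1) - (real k + \<delta>) * of_bool (vdegree g u = k)) / pa_norm model \<delta> a b v j"
      using u by (simp add: pa_attach_prob_def)
  qed
  then show ?thesis
    by (simp add: deg_count_def sum_divide_distrib[symmetric] sum_subtractf sum_distrib_left)
qed

lemma pa_attach_prob_cong:
  assumes "\<And>i. 1 \<le> i \<Longrightarrow> i \<le> v \<Longrightarrow> b i = b' i" "v \<ge> 1"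
  shows "pa_attach_prob model \<delta> a b g v j u = pa_attach_prob model \<delta> a b' g v j u"
proof -
  have "(\<Sum>i=1..v-1. b i) = (\<Sum>i=1..v-1. b' i)" using assms by (intro sum.cong) auto
  moreover have "b v = b' v" using assms by simp
  ultimately show ?thesis by (cases model) (simp_all add: pa_attach_prob_def)
qed

lemma pa_partial_graph_0: "pa_partial_graph G0 m E v 0 \<omega> = pa_graph G0 m E (v - 1) \<omega>"
  by (simp add: pa_partial_graph_def pa_edges_def)

lemma pa_partial_graph_Suc:
  "pa_partial_graph G0 m E v (Suc j) \<omega> = pa_partial_graph G0 m E v j \<omega> @ [(v, E v (Suc j) \<omega>)]"
  by (simp add: pa_partial_graph_def pa_edges_def)

lemma pa_graph_eq_partial:
  assumes "v \<ge> 3"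
  shows "pa_graph G0 m E v \<omega> = pa_partial_graph G0 m E v (m v \<omega>) \<omega>"
proof -
  have "[3..<Suc v] = [3..<Suc (v - 1)] @ [v]" using assms by simp
  then show ?thesis by (simp add: pa_graph_def pa_partial_graph_def)
qed

lemma measurable_countable2:
  fixes f :: "'w \<Rightarrow> 'b::countable" and g :: "'w \<Rightarrow> 'c::countable"
  assumes f: "f \<in> N \<rightarrow>\<^sub>M count_space UNIV" and g: "g \<in> N \<rightarrow>\<^sub>M count_space UNIV"
    and h: "\<And>x y. h x y \<in> space K"
  shows "(\<lambda>\<omega>. h (f \<omega>) (g \<omega>)) \<in> N \<rightarrow>\<^sub>M K"
proof -
  have "(\<lambda>\<omega>. h i (g \<omega>)) \<in> N \<rightarrow>\<^sub>M K" for i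
    by (rule measurable_compose[OF g]) (auto simp: h)
  then show ?thesis by (rule measurable_compose_countable[OF _ f])
qed

text \<open>A finite list lives in a countable type, as does the graph, so every function of the two
  is measurable for the conditioning sigma-algebra. Attachment at v only involves out-degrees up to
  index v.\<close>

definition out_degrees :: "(nat \<Rightarrow> 'w \<Rightarrow> nat) \<Rightarrow> nat \<Rightarrow> 'w \<Rightarrow> nat list" where
  "out_degrees m n \<omega> = map (\<lambda>i. m i \<omega>) [1..<Suc n]"

lemma out_degrees_nth: "1 \<le> i \<Longrightarrow> i \<le> n \<Longrightarrow> out_degrees m n \<omega> ! (i - 1) = m i \<omega>"
  using nth_upt[of 1 "i - 1" "Suc n"] by (simp add: out_degrees_def del: upt_Suc)

context preferential_attachment
begin

abbreviation G :: "nat \<Rightarrow> 'w \<Rightarrow> multigraph" where "G \<equiv> pa_graph G0 m E"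
abbreviation PG :: "nat \<Rightarrow> nat \<Rightarrow> 'w \<Rightarrow> multigraph" where "PG \<equiv> pa_partial_graph G0 m E"

abbreviation A :: "nat \<Rightarrow> nat \<Rightarrow> 'w \<Rightarrow> real" where "A k n \<omega> \<equiv> deg_count k (G n \<omega>) n"

abbreviation a0 :: nat where "a0 \<equiv> vdegree G0 1 + vdegree G0 2"

lemma m_measurable: "i \<ge> 1 \<Longrightarrow> m i \<in> P \<rightarrow>\<^sub>M count_space UNIV"
proof (cases "i \<ge> 3")
  case True
  then show ?thesis using m_indep by (auto simp: indep_vars_def)
next
  case False
  assume "i \<ge> 1"
  with False have "i \<in> {1, 2}" by auto
  then show ?thesis using m_initial[of i] by (subst measurable_cong[where g = "\<lambda>_. 1"]) auto
qed

lemma pa_edges_measurable: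
  assumes "v \<ge> 3"
  shows "pa_edges (E v) v j \<in> P \<rightarrow>\<^sub>M count_space UNIV"
proof (induction j)
  case 0
  then show ?case by (simp add: pa_edges_def[abs_def])
next
  case (Suc j)
  have "(\<lambda>\<omega>. pa_edges (E v) v j \<omega> @ [(v, E v (Suc j) \<omega>)]) \<in> P \<rightarrow>\<^sub>M count_space UNIV"
    using assms by (intro measurable_countable2[OF Suc E_measurable]) auto
  then show ?case by (simp add: pa_edges_def[abs_def])
qed

lemma G_measurable: "G n \<in> P \<rightarrow>\<^sub>M count_space UNIV"
proof (induction n)
  case 0
  then show ?case by (simp add: pa_graph_def[abs_def])
next
  case (Suc n)
  show ?case
  proof (cases "Suc n \<ge> 3")
    case True
    have "(\<lambda>\<omega>. pa_edges (E (Suc n)) (Suc n) (m (Suc n) \<omega>) \<omega>) \<in> P \<rightarrow>\<^sub>M count_space UNIV"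
      by (rule measurable_compose_countable[OF pa_edges_measurable[OF True] m_measurable]) simp
    then have "(\<lambda>\<omega>. G n \<omega> @ pa_edges (E (Suc n)) (Suc n) (m (Suc n) \<omega>) \<omega>) \<in> P \<rightarrow>\<^sub>M count_space UNIV"
      by (rule measurable_countable2[OF Suc]) simp
    then show ?thesis using pa_graph_eq_partial[OF True, of G0 m E] by (simp add: pa_partial_graph_def fun_eq_iff cong: measurable_cong)
  next
    case False
    then show ?thesis by (simp add: pa_graph_def[abs_def])
  qed
qed

lemma PG_measurable: "v \<ge> 3 \<Longrightarrow> PG v j \<in> P \<rightarrow>\<^sub>M count_space UNIV"
  unfolding pa_partial_graph_def[abs_def]
  by (rule measurable_countable2[OF G_measurable pa_edges_measurable]) auto

lemma pa_sigma_map_measurable: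
  assumes "v \<ge> 3"
  shows "(\<lambda>\<omega>. (\<lambda>i\<in>{1..}. m i \<omega>, PG v j \<omega>)) \<in> P \<rightarrow>\<^sub>M PiM {1..} (\<lambda>_. count_space UNIV) \<Otimes>\<^sub>M count_space UNIV"
  by (intro measurable_Pair measurable_restrict PG_measurable assms m_measurable) simp

lemma pa_sigma_subalgebra:
  assumes "v \<ge> 3"
  shows "subalgebra P (pa_sigma P m (PG v j))"
  using pa_sigma_map_measurable[OF assms, of j]
  unfolding subalgebra_def pa_sigma_def measurable_iff_sets by simp

lemma pa_sigma_measurable:
  fixes f :: "nat list \<Rightarrow> multigraph \<Rightarrow> real"
  shows "(\<lambda>\<omega>. f (out_degrees m n \<omega>) (PG v j \<omega>)) \<in> borel_measurable (pa_sigma P m (PG v j))"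
proof -
  let ?N = "PiM {1..} (\<lambda>_. count_space UNIV) \<Otimes>\<^sub>M count_space UNIV :: ((nat \<Rightarrow> nat) \<times> multigraph) measure"
  have 1: "(\<lambda>b. map b [1..<Suc n]) \<in> PiM {1..} (\<lambda>_. count_space (UNIV :: nat set)) \<rightarrow>\<^sub>M count_space UNIV"
  proof (induction n)
    case 0
    then show ?case by simp
  next
    case (Suc n)
    have "(\<lambda>b. b (Suc n)) \<in> PiM {1..} (\<lambda>_. count_space (UNIV :: nat set)) \<rightarrow>\<^sub>M count_space UNIV"
      by (rule measurable_component_singleton) simp
    from measurable_countable2[OF Suc this, of "\<lambda>x y. x @ [y]" "count_space UNIV"]
    have "(\<lambda>b. map b [1..<Suc n] @ [b (Suc n)]) \<in> PiM {1..} (\<lambda>_. count_space (UNIV :: nat set)) \<rightarrow>\<^sub>M count_space UNIV"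
      by simp
    then show ?case by simp
  qed
  have 2: "(\<lambda>x. f (map (fst x) [1..<Suc n]) (snd x)) \<in> borel_measurable ?N"
    by (rule measurable_countable2[OF measurable_compose[OF measurable_fst 1] measurable_snd, of f borel]) simp
  have 3: "(\<lambda>\<omega>. (\<lambda>i\<in>{1..}. m i \<omega>, PG v j \<omega>)) \<in> pa_sigma P m (PG v j) \<rightarrow>\<^sub>M ?N"
    unfolding pa_sigma_def by (rule measurable_vimage_algebra1) (auto simp: space_pair_measure space_PiM)
  have "map (\<lambda>i\<in>{1..}. m i \<omega>) [1..<Suc n] = out_degrees m n \<omega>" for \<omega>
    by (auto simp: out_degrees_def simp del: upt_Suc)
  then show ?thesis using measurable_compose[OF 3 2] by simp
qed

lemma attach_prob_measurable:
  assumes v: "v \<ge> 3"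
  shows "(\<lambda>\<omega>. pa_attach_prob model \<delta> a0 (\<lambda>i. m i \<omega>) (PG v j \<omega>) v j' u) \<in> borel_measurable P"
proof -
  define b :: "nat list \<Rightarrow> nat \<Rightarrow> nat" where "b l i = l ! (i - 1)" for l i
  have "(\<lambda>\<omega>. pa_attach_prob model \<delta> a0 (\<lambda>i. m i \<omega>) (PG v j \<omega>) v j' u)
      = (\<lambda>\<omega>. pa_attach_prob model \<delta> a0 (b (out_degrees m v \<omega>)) (PG v j \<omega>) v j' u)"
    using v by (intro ext pa_attach_prob_cong) (auto simp only: b_def out_degrees_nth)
  also have "\<dots> \<in> borel_measurable P"
    using measurable_from_subalg[OF pa_sigma_subalgebra[OF v]
      pa_sigma_measurable[of "\<lambda>l g. pa_attach_prob model \<delta> a0 (b l) g v j' u" v v j]] .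
  finally show ?thesis .
qed

text \<open>A factor known before the edge is attached can be pulled out of the conditional
  expectation. It has to vanish where \<open>m v < j\<close>, because the attachment rule prescribes
  the conditional law only for edges that exist.\<close>

lemma attachment_zero_mean:
  assumes v: "v \<ge> 3" and j: "j \<ge> 1"
    and Z: "Z \<in> borel_measurable (pa_sigma P m (PG v (j - 1)))"
    and bdd: "AE \<omega> in P. \<bar>Z \<omega>\<bar> \<le> B" and zero: "\<And>\<omega>. m v \<omega> < j \<Longrightarrow> Z \<omega> = 0"
  shows "integrable P (\<lambda>\<omega>. Z \<omega> * pa_attach_prob model \<delta> a0 (\<lambda>i. m i \<omega>) (PG v (j - 1) \<omega>) v j u)"
    and "expectation (\<lambda>\<omega>. Z \<omega> * of_bool (E v j \<omega> = u))
      = expectation (\<lambda>\<omega>. Z \<omega> * pa_attach_prob model \<delta> a0 (\<lambda>i. m i \<omega>) (PG v (j - 1) \<omega>) v j u)"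
proof -
  let ?F = "pa_sigma P m (PG v (j - 1))" and ?A = "{\<omega> \<in> space P. E v j \<omega> = u}"
  let ?p = "\<lambda>\<omega>. pa_attach_prob model \<delta> a0 (\<lambda>i. m i \<omega>) (PG v (j - 1) \<omega>) v j u"
  interpret F: finite_measure_subalgebra P ?F
    by unfold_locales (rule pa_sigma_subalgebra[OF v])
  have Z_P[measurable]: "Z \<in> borel_measurable P"
    using measurable_from_subalg[OF pa_sigma_subalgebra[OF v] Z] .
  have [measurable]: "E v j \<in> P \<rightarrow>\<^sub>M count_space UNIV" using E_measurable v j by simp
  have A[measurable]: "?A \<in> sets P" by measurable
  have int: "integrable P (\<lambda>\<omega>. Z \<omega> * indicator ?A \<omega>)"
  proof (rule integrable_AE_bounded)
    show "AE \<omega> in P. \<bar>Z \<omega> * indicator ?A \<omega>\<bar> \<le> \<bar>B\<bar>"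
      using bdd by eventually_elim (auto simp: indicator_def)
  qed measurable
  note ce = F.real_cond_exp_intg[OF int Z]
  have p_meas: "?p \<in> borel_measurable P"
    by (rule attach_prob_measurable[OF v])
  have ae: "AE \<omega> in P. Z \<omega> * real_cond_exp P ?F (indicator ?A) \<omega> = Z \<omega> * ?p \<omega>"
    using attachment[OF v j, of u]
  proof eventually_elim
    case (elim \<omega>)
    then show ?case by (cases "j \<le> m v \<omega>") (simp_all add: zero)
  qed
  show "integrable P (\<lambda>\<omega>. Z \<omega> * ?p \<omega>)"
    using ce(1) integrable_cong_AE[OF _ _ ae] p_meas by simp
  have "expectation (\<lambda>\<omega>. Z \<omega> * of_bool (E v j \<omega> = u)) = expectation (\<lambda>\<omega>. Z \<omega> * indicator ?A \<omega>)"
    by (intro Bochner_Integration.integral_cong) (auto simp: indicator_def)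
  also have "\<dots> = expectation (\<lambda>\<omega>. Z \<omega> * real_cond_exp P ?F (indicator ?A) \<omega>)"
    using ce(2) by simp
  also have "\<dots> = expectation (\<lambda>\<omega>. Z \<omega> * ?p \<omega>)"
    using ae p_meas by (intro integral_cong_AE) auto
  finally show "expectation (\<lambda>\<omega>. Z \<omega> * of_bool (E v j \<omega> = u)) = expectation (\<lambda>\<omega>. Z \<omega> * ?p \<omega>)" .
qed

end

section \<open>Drift of the degree counts\<close>

lemma pmf_tendsto_zero:
  fixes g :: "nat \<Rightarrow> nat \<Rightarrow> real" and h :: "nat \<Rightarrow> real"
  assumes "integrable (measure_pmf Q) h" "\<And>n k. \<bar>g n k\<bar> \<le> h k" "\<And>k. (\<lambda>n. g n k) \<longlonglongrightarrow> 0"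
  shows "(\<lambda>n. measure_pmf.expectation Q (g n)) \<longlonglongrightarrow> 0"
proof -
  have "(\<lambda>n. measure_pmf.expectation Q (g n)) \<longlonglongrightarrow> measure_pmf.expectation Q (\<lambda>k. 0)"
    by (rule integral_dominated_convergence[where w = h]) (use assms in auto)
  then show ?thesis by simp
qed

locale integrable_preferential_attachment = preferential_attachment P M \<delta> model G0 m E
  for P :: "'w measure" and M :: "nat pmf" and \<delta> :: real and model :: pa_model and G0 :: multigraph
    and m :: "nat \<Rightarrow> 'w \<Rightarrow> nat" and E :: "nat \<Rightarrow> nat \<Rightarrow> 'w \<Rightarrow> nat" +
  assumes M_pos: "set_pmf M \<subseteq> {1..}"
    and M_integrable: "integrable (measure_pmf M) real"
    and \<delta>_bound: "\<delta> > - real (Inf (set_pmf M))"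
begin

definition l :: nat where "l = Inf (set_pmf M)"
definition \<mu> :: real where "\<mu> = measure_pmf.expectation M real"
definition \<theta> :: real where "\<theta> = 2 + \<delta> / \<mu>"
text \<open>Chosen for \<open>c v j\<close> \<ge> \<kappa> v: almost surely the normalisation is at
  least a0 + 2 \<delta> + (v - 3), and this dominates \<kappa> v since 3 \<kappa> \<le> a0 + 2
  \<delta> and \<kappa> \<le> 1. It is positive because both initial vertices have positive
  weight.\<close>

definition \<kappa> :: real where "\<kappa> = min 1 ((real a0 + 2 * \<delta>) / 3)"
definition R :: "nat \<Rightarrow> 'w \<Rightarrow> real" where "R n \<omega> = (\<Sum>i=3..n. real (m i \<omega>) - \<mu>)"
text \<open>The event on which the pathwise estimates hold. It has full probability, as the law of
  an out-degree is carried by values at least l and there are countably many vertices.\<close>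

definition regular :: "'w \<Rightarrow> bool" where
  "regular \<omega> \<longleftrightarrow> \<omega> \<in> space P \<and> (\<forall>i\<ge>3. l \<le> m i \<omega>)"
abbreviation c :: "nat \<Rightarrow> nat \<Rightarrow> 'w \<Rightarrow> real" where
  "c v j \<omega> \<equiv> pa_norm model \<delta> a0 (\<lambda>i. m i \<omega>) v j"

lemma l_in: "l \<in> set_pmf M"
  unfolding l_def by (rule Inf_nat_def1) (rule set_pmf_not_empty)

lemma l_le: "k \<in> set_pmf M \<Longrightarrow> l \<le> k"
  unfolding l_def by (rule cInf_lower) auto

lemma l_ge_1: "l \<ge> 1"
  using l_in M_pos by auto

lemma l_\<delta>: "real l + \<delta> > 0"
  using \<delta>_bound by (simp add: l_def)

lemma \<mu>_ge: "\<mu> \<ge> real l"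
proof -
  have "measure_pmf.expectation M (\<lambda>k. real l) \<le> measure_pmf.expectation M real"
    by (rule integral_mono_AE) (use M_integrable l_le in \<open>auto simp: AE_measure_pmf_iff\<close>)
  then show ?thesis by (simp add: \<mu>_def)
qed

lemma \<mu>_pos: "\<mu> > 0"
  using \<mu>_ge l_ge_1 by linarith

lemma \<mu>\<theta>: "\<mu> * \<theta> = 2 * \<mu> + \<delta>"
  using \<mu>_pos by (simp add: \<theta>_def field_simps)

lemma \<mu>\<theta>_pos: "\<mu> * \<theta> > 0"
  using \<mu>\<theta> \<mu>_ge l_\<delta> l_ge_1 by linarith

lemma \<theta>_pos: "\<theta> > 0"
  using \<mu>\<theta>_pos \<mu>_pos by (simp add: zero_less_mult_iff)

lemma \<kappa>_pos: "\<kappa> > 0"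
  using initial_degrees[of 1] initial_degrees[of 2] by (simp add: \<kappa>_def)

lemma AE_regular: "AE \<omega> in P. regular \<omega>"
proof -
  have "AE \<omega> in P. \<forall>i. i \<ge> 3 \<longrightarrow> l \<le> m i \<omega>"
    unfolding AE_all_countable
  proof
    fix i
    show "AE \<omega> in P. i \<ge> 3 \<longrightarrow> l \<le> m i \<omega>"
    proof (cases "i \<ge> 3")
      case True
      have "AE k in distr P (count_space UNIV) (m i). l \<le> k"
        using l_le unfolding m_law[OF True] by (auto simp: AE_measure_pmf_iff)
      then show ?thesis using AE_distrD[OF m_measurable[of i]] True by simp
    qed simp
  qed
  then show ?thesis using AE_space by eventually_elim (auto simp: regular_def)
qed

lemma m_sum:
  assumes "\<omega> \<in> space P" "v \<ge> 3"
  shows "real (\<Sum>i=1..v-1. m i \<omega>) = 2 + (\<Sum>i=3..v-1. real (m i \<omega>))"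
proof -
  have "{1..v-1} = {1, 2} \<union> {3..v-1}" using assms by auto
  then have "(\<Sum>i=1..v-1. real (m i \<omega>)) = (\<Sum>i\<in>{1, 2}. real (m i \<omega>)) + (\<Sum>i=3..v-1. real (m i \<omega>))"
    by (simp add: sum.union_disjoint)
  then show ?thesis using m_initial[of 1 \<omega>] m_initial[of 2 \<omega>] assms by simp
qed

text \<open>The remainder d collects everything that depends on the model and on j. Its bounds are
  all that is used of the normalisation afterwards, so the case distinction over models ends
  here.\<close>

lemma norm_decomposition:
  assumes "regular \<omega>" "v \<ge> 3" "1 \<le> j" "j \<le> m v \<omega>"
  obtains d where "c v j \<omega> = real a0 + 2 * (\<Sum>i=3..v-1. real (m i \<omega>)) + (real v - 1) * \<delta> + d"
    and "0 \<le> d" "d \<le> 2 * real j + \<bar>\<delta>\<bar>"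
proof -
  define d where "d = c v j \<omega> - (real a0 + 2 * (\<Sum>i=3..v-1. real (m i \<omega>)) + (real v - 1) * \<delta>)"
  have S: "real (\<Sum>i=1..v-1. m i \<omega>) = 2 + (\<Sum>i=3..v-1. real (m i \<omega>))"
    using assms by (intro m_sum) (auto simp: regular_def)
  define t where "t = \<delta> / real (m v \<omega>)"
  have mv: "real (m v \<omega>) > 0" "real l \<le> real (m v \<omega>)" using assms by (auto simp: regular_def)
  \<comment> \<open>The condition \<delta> > -l together with m v \<ge> l gives \<delta> / m v \<ge>
    -1. So the fraction of \<delta> granted to the new vertex never takes away more than the edge
    count contributes.\<close>
  have t: "t \<ge> - 1" using mv l_\<delta> by (simp add: t_def field_simps)
  have jt: "real i * t \<le> \<bar>\<delta>\<bar>" "real i * t \<ge> - real i" if "i \<le> m v \<omega>" for i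
  proof -
    have "real i * t \<le> real i * \<bar>t\<bar>" by (intro mult_left_mono) auto
    also have "\<dots> \<le> real (m v \<omega>) * \<bar>t\<bar>" using that by (intro mult_right_mono) auto
    also have "\<dots> = \<bar>\<delta>\<bar>" using mv by (simp add: t_def)
    finally show "real i * t \<le> \<bar>\<delta>\<bar>" .
    show "real i * t \<ge> - real i" using mult_left_mono[OF t, of "real i"] by simp
  qed
  have j1: "real j - 1 = real (j - 1)" using assms by simp
  have "0 \<le> d \<and> d \<le> 2 * real j + \<bar>\<delta>\<bar>"
  proof (cases model)
    case ModelA
    have "d = 2 * real j - 1 + real j * t" unfolding d_def ModelA pa_norm.simps S by (simp add: t_def algebra_simps)
    then show ?thesis using jt[of j] assms by linarith
  next
    case ModelB
    have "d = 2 * (real j - 1) + real (j - 1) * t"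
      unfolding d_def ModelB pa_norm.simps S j1[symmetric] by (simp add: t_def algebra_simps diff_divide_distrib)
    moreover have "real (j - 1) * t \<le> \<bar>\<delta>\<bar>" "real (j - 1) * t \<ge> - (real j - 1)"
      using jt[of "j - 1"] assms unfolding j1 by auto
    ultimately show ?thesis using assms by (auto simp del: of_nat_diff)
  next
    case ModelD
    have "d = real j - 1" unfolding d_def ModelD pa_norm.simps S by (simp add: algebra_simps)
    then show ?thesis using assms by linarith
  qed
  then show ?thesis using that[of d] by (simp add: d_def)
qed

text \<open>Each vertex from 3 to v - 1 contributes at least 2 l + \<delta> = l + (l + \<delta>),
  which is at least 1.\<close>

lemma norm_lower_bound:
  assumes "regular \<omega>" "v \<ge> 3" "1 \<le> j" "j \<le> m v \<omega>"
  shows "\<kappa> * real v \<le> c v j \<omega>"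
proof -
  obtain d where d: "c v j \<omega> = real a0 + 2 * (\<Sum>i=3..v-1. real (m i \<omega>)) + (real v - 1) * \<delta> + d" "0 \<le> d"
    using norm_decomposition[OF assms] by metis
  have "(\<Sum>i=3..v-1. real (m i \<omega>)) \<ge> (\<Sum>i=3..v-1. real l)"
    using assms by (intro sum_mono) (auto simp: regular_def)
  then have S: "(\<Sum>i=3..v-1. real (m i \<omega>)) \<ge> (real v - 3) * real l" using assms by (simp add: of_nat_diff)
  have "(real v - 3) * (2 * real l + \<delta>) \<ge> (real v - 3) * 1"
    using assms l_\<delta> l_ge_1 by (intro mult_left_mono) auto
  then have "(real v - 3) * 1 \<le> 2 * ((real v - 3) * real l) + (real v - 3) * \<delta>" by (simp add: algebra_simps)
  then have 1: "c v j \<omega> \<ge> real a0 + 2 * \<delta> + (real v - 3)"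
    using S d by (simp add: algebra_simps)
  have "\<kappa> \<le> 1" "3 * \<kappa> \<le> real a0 + 2 * \<delta>" by (auto simp: \<kappa>_def min_def)
  moreover have "\<kappa> * (real v - 3) \<le> 1 * (real v - 3)" using \<open>\<kappa> \<le> 1\<close> assms by (intro mult_right_mono) auto
  ultimately show ?thesis using 1 by (simp add: algebra_simps)
qed

definition K0 :: real where "K0 = \<bar>real a0 - 6 * \<mu> - \<delta>\<bar> + \<bar>\<delta>\<bar>"

text \<open>Replacing the out-degrees by \<mu> gives 2 (v - 3) \<mu> + (v - 1) \<delta> = \<mu>
  \<theta> v - 6 \<mu> - \<delta>, which explains the constant in \<open>K0\<close>; the deviation
  from \<mu> is 2 R (v - 1).\<close>

lemma norm_approximation:
  assumes "regular \<omega>" "v \<ge> 3" "1 \<le> j" "j \<le> m v \<omega>"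
  shows "\<bar>c v j \<omega> - \<mu> * \<theta> * real v\<bar> \<le> 2 * \<bar>R (v - 1) \<omega>\<bar> + 2 * real (m v \<omega>) + K0"
proof -
  obtain d where d: "c v j \<omega> = real a0 + 2 * (\<Sum>i=3..v-1. real (m i \<omega>)) + (real v - 1) * \<delta> + d"
    "0 \<le> d" "d \<le> 2 * real j + \<bar>\<delta>\<bar>"
    using norm_decomposition[OF assms] by metis
  have "(\<Sum>i=3..v-1. real (m i \<omega>)) = R (v - 1) \<omega> + (real v - 3) * \<mu>"
    using assms by (simp add: R_def sum_subtractf of_nat_diff)
  then have "c v j \<omega> - \<mu> * \<theta> * real v = 2 * R (v - 1) \<omega> + (real a0 - 6 * \<mu> - \<delta>) + d"
    using d(1) by (simp add: \<mu>\<theta> algebra_simps)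
  moreover have "real j \<le> real (m v \<omega>)" using assms by simp
  ultimately show ?thesis unfolding K0_def using d by linarith
qed

text \<open>The common scale of all errors made at vertex v. The first term is capped at m v, which
  is integrable, whereas (m v)^2 / v may have infinite mean; the second comes from the fluctuation
  of the normalisation.\<close>

definition dominant :: "nat \<Rightarrow> 'w \<Rightarrow> real" where
  "dominant v \<omega> = real (m v \<omega>) * min 1 ((real (m v \<omega>) + 1) / real v) + real (m v \<omega>) * \<bar>R (v - 1) \<omega>\<bar> / real v"

lemma dominant_nonneg: "dominant v \<omega> \<ge> 0"
  by (simp add: dominant_def)

lemma R_sublinear: "L1_sublinear R"
  using L1_law_of_large_numbers[OF m_indep m_law M_integrable] by (simp add: R_def[abs_def] \<mu>_def)

lemma m_expectation:
  fixes f :: "nat \<Rightarrow> real"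
  assumes "i \<ge> 3"
  shows "integrable P (\<lambda>\<omega>. f (m i \<omega>)) \<longleftrightarrow> integrable (measure_pmf M) f"
    and "expectation (\<lambda>\<omega>. f (m i \<omega>)) = measure_pmf.expectation M f"
  using expectation_of_pmf_law[OF m_measurable m_law, of i f] assms by auto

text \<open>The out-degree of v is independent of the earlier ones, so the product is integrable and
  its mean factorises although neither factor need have a second moment.\<close>

lemma m_R_expectation:
  assumes "v \<ge> 3"
  shows "integrable P (\<lambda>\<omega>. real (m v \<omega>) * \<bar>R (v - 1) \<omega>\<bar>)"
    and "expectation (\<lambda>\<omega>. real (m v \<omega>) * \<bar>R (v - 1) \<omega>\<bar>) = \<mu> * expectation (\<lambda>\<omega>. \<bar>R (v - 1) \<omega>\<bar>)"
proof -
  let ?g = "\<lambda>s. \<bar>s - (\<Sum>i=3..v-1. \<mu>)\<bar>"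
  have g: "?g (\<Sum>i=3..v-1. real (m i \<omega>)) = \<bar>R (v - 1) \<omega>\<bar>" for \<omega>
    by (simp add: R_def sum_subtractf)
  have ind: "indep_vars (\<lambda>_. borel) (\<lambda>i \<omega>. real (m i \<omega>)) (insert v {3..v-1})"
    by (rule indep_vars_subset[OF indep_vars_compose2[OF m_indep]]) (use assms in auto)
  have "integrable P (\<lambda>\<omega>. ?g (\<Sum>i=3..v-1. real (m i \<omega>)))"
    unfolding g using L1_sublinearD(1)[OF R_sublinear] by simp
  moreover have "integrable P (\<lambda>\<omega>. real (m k \<omega>))" if "k \<in> insert v {3..v-1}" for k
    using that assms m_expectation(1)[of k real] M_integrable by auto
  ultimately have "integrable P (\<lambda>\<omega>. real (m v \<omega>) * ?g (\<Sum>i=3..v-1. real (m i \<omega>)))"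
    "expectation (\<lambda>\<omega>. real (m v \<omega>) * ?g (\<Sum>i=3..v-1. real (m i \<omega>)))
      = expectation (\<lambda>\<omega>. real (m v \<omega>)) * expectation (\<lambda>\<omega>. ?g (\<Sum>i=3..v-1. real (m i \<omega>)))"
    using assms by (intro indep_vars_product_expectation[OF ind]; force)+
  then show "integrable P (\<lambda>\<omega>. real (m v \<omega>) * \<bar>R (v - 1) \<omega>\<bar>)"
    and "expectation (\<lambda>\<omega>. real (m v \<omega>) * \<bar>R (v - 1) \<omega>\<bar>) = \<mu> * expectation (\<lambda>\<omega>. \<bar>R (v - 1) \<omega>\<bar>)"
    unfolding g using m_expectation(2)[OF assms, of real] by (simp_all add: \<mu>_def)
qed

text \<open>The summands vanish in mean: the capped term by dominated convergence with bound m v,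
  the other by independence and the law of large numbers for R.\<close>

lemma dominant_sublinear: "L1_sublinear (\<lambda>n \<omega>. \<Sum>v=3..n. dominant v \<omega>)"
proof (rule L1_sublinear_sum)
  let ?g = "\<lambda>v k. real k * min 1 ((real k + 1) / real v)"
  have g_bound: "\<bar>?g v k\<bar> \<le> real k" for v k
  proof -
    have "real k * min 1 ((real k + 1) / real v) \<le> real k * 1" by (intro mult_left_mono) auto
    then show ?thesis by simp
  qed
  have g_int: "integrable (measure_pmf M) (?g v)" for v
    by (rule Bochner_Integration.integrable_bound[OF M_integrable]) (use g_bound in auto)
  show int: "integrable P (dominant v)" if "v \<ge> 3" for v
    unfolding dominant_def[abs_def]
    using m_expectation(1)[OF that, of "?g v"] g_int m_R_expectation(1)[OF that] by auto
  have eq: "expectation (\<lambda>\<omega>. \<bar>dominant v \<omega>\<bar>)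
      = measure_pmf.expectation M (?g v) + \<mu> * (expectation (\<lambda>\<omega>. \<bar>R (v - 1) \<omega>\<bar>) / real v)" if "v \<ge> 3" for v
  proof -
    have "expectation (\<lambda>\<omega>. \<bar>dominant v \<omega>\<bar>) = expectation (\<lambda>\<omega>. ?g v (m v \<omega>) + real (m v \<omega>) * \<bar>R (v - 1) \<omega>\<bar> / real v)"
      using dominant_nonneg by (simp add: dominant_def)
    also have "\<dots> = expectation (\<lambda>\<omega>. ?g v (m v \<omega>)) + expectation (\<lambda>\<omega>. real (m v \<omega>) * \<bar>R (v - 1) \<omega>\<bar>) / real v"
      using m_expectation(1)[OF that, of "?g v"] g_int m_R_expectation(1)[OF that] by simp
    finally show ?thesis using m_expectation(2)[OF that, of "?g v"] m_R_expectation(2)[OF that] by simp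
  qed
  have "(\<lambda>v. measure_pmf.expectation M (?g v)) \<longlonglongrightarrow> 0"
  proof (rule pmf_tendsto_zero[OF M_integrable g_bound])
    fix k
    have "(\<lambda>v. (real k + 1) / real v) \<longlonglongrightarrow> 0" by real_asymp
    then have "(\<lambda>v. real k * min 1 ((real k + 1) / real v)) \<longlonglongrightarrow> real k * min 1 0"
      by (intro tendsto_mult tendsto_min tendsto_const)
    then show "(\<lambda>v. ?g v k) \<longlonglongrightarrow> 0" by simp
  qed
  moreover note L1_sublinear_shift[OF R_sublinear]
  ultimately have "(\<lambda>v. measure_pmf.expectation M (?g v) + \<mu> * (expectation (\<lambda>\<omega>. \<bar>R (v - 1) \<omega>\<bar>) / real v)) \<longlonglongrightarrow> 0 + \<mu> * 0"
    by (intro tendsto_add tendsto_mult tendsto_const)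
  then have "(\<lambda>v. measure_pmf.expectation M (?g v) + \<mu> * (expectation (\<lambda>\<omega>. \<bar>R (v - 1) \<omega>\<bar>) / real v)) \<longlonglongrightarrow> 0"
    by simp
  then show "(\<lambda>v. expectation (\<lambda>\<omega>. \<bar>dominant v \<omega>\<bar>)) \<longlonglongrightarrow> 0"
    by (rule Lim_transform_eventually) (use eventually_ge_at_top[of 3] in \<open>eventually_elim, simp only: eq\<close>)
qed

end

context integrable_preferential_attachment
begin

section \<open>Comparison of the drift with its linear approximation\<close>

lemma norm_measurable:
  assumes "v \<ge> 3"
  shows "c v j \<in> borel_measurable P"
proof -
  have [measurable]: "m i \<in> P \<rightarrow>\<^sub>M count_space UNIV" if "i \<in> {1..v-1} \<or> i = v" for i
    using that assms by (intro m_measurable) auto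
  have [measurable]: "(\<lambda>\<omega>. real (\<Sum>i=1..v-1. m i \<omega>)) \<in> borel_measurable P"
    unfolding of_nat_sum by measurable
  show ?thesis by (cases model) (simp_all only: pa_norm.simps, measurable)
qed

lemma deg_count_PG_measurable:
  assumes "v \<ge> 3"
  shows "(\<lambda>\<omega>. deg_count k (PG v j \<omega>) w) \<in> borel_measurable P"
  by (rule measurable_compose[OF PG_measurable[OF assms]]) simp

lemma deg_count_G_measurable: "(\<lambda>\<omega>. deg_count k (G n \<omega>) w) \<in> borel_measurable P"
  by (rule measurable_compose[OF G_measurable]) simp

lemma sum_out_degree_measurable:
  fixes f :: "nat \<Rightarrow> 'w \<Rightarrow> real"
  assumes "v \<ge> 3" and f: "\<And>j. j \<ge> 1 \<Longrightarrow> f j \<in> borel_measurable P"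
  shows "(\<lambda>\<omega>. \<Sum>j=1..m v \<omega>. f j \<omega>) \<in> borel_measurable P"
proof (rule measurable_compose_countable[OF _ m_measurable[of v]])
  show "(\<lambda>\<omega>. \<Sum>j=1..i. f j \<omega>) \<in> borel_measurable P" for i
    using f by (intro borel_measurable_sum) auto
qed (use assms in simp)

lemma deg_count_PG_close:
  shows "\<bar>deg_count k (PG v j \<omega>) (v - 1) - A k (v - 1) \<omega>\<bar> \<le> real j"
proof (cases "v = 0")
  case False
  then have "v - 1 < v" by simp
  show ?thesis
  proof (induction j)
    case (Suc j)
    then show ?case
      using deg_count_snoc_bound[OF \<open>v - 1 < v\<close>, of k "PG v j \<omega>" "E v (Suc j) \<omega>"]
      unfolding pa_partial_graph_Suc of_nat_Suc by linarith
  qed (simp add: pa_partial_graph_0)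
qed (simp add: deg_count_def)

lemma deg_count_increment:
  assumes "v \<ge> 3"
  shows "A k v \<omega> = deg_count k (PG v (m v \<omega>) \<omega>) (v - 1) + of_bool (vdegree (G v \<omega>) v = k)"
proof -
  obtain n where n: "v = Suc n" using assms by (cases v) auto
  show ?thesis using pa_graph_eq_partial[OF assms, of G0 m E \<omega>] by (simp add: deg_count_def n)
qed

lemma deg_count_increment_bound:
  assumes "v \<ge> 3"
  shows "\<bar>A k v \<omega> - A k (v - 1) \<omega>\<bar> \<le> real (m v \<omega>) + 1"
proof -
  have "0 \<le> (of_bool (vdegree (G v \<omega>) v = k) :: real)" "of_bool (vdegree (G v \<omega>) v = k) \<le> (1 :: real)"
    by simp_all
  then show ?thesis
    using deg_count_increment[OF assms, of k \<omega>] deg_count_PG_close[of k v "m v \<omega>" \<omega>] by linarith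
qed

text \<open>Multiplied by k + \<delta>, this is the accumulated conditional expected outflow from
  degree k while v is attached, with the actual intermediate graphs and normalisations.\<close>

definition edge_drift :: "nat \<Rightarrow> nat \<Rightarrow> 'w \<Rightarrow> real" where
  "edge_drift k v \<omega> = (\<Sum>j=1..m v \<omega>. deg_count k (PG v (j - 1) \<omega>) (v - 1) / c v j \<omega>)"

lemma edge_drift_measurable: "v \<ge> 3 \<Longrightarrow> edge_drift k v \<in> borel_measurable P"
  unfolding edge_drift_def[abs_def]
  by (intro sum_out_degree_measurable borel_measurable_divide deg_count_PG_measurable norm_measurable)

text \<open>The sum of the constant of the crude estimate and the two constants of the fine estimate
  in \<open>edge_drift_step\<close>, so that one factor serves in every case.\<close>

definition C1 :: real where
  "C1 = 1 / \<kappa> + 1 / (\<mu> * \<theta>) + (1 / \<kappa> + (2 + K0) / (\<kappa> * (\<mu> * \<theta>))) + 2 / (\<kappa> * (\<mu> * \<theta>))"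

lemma K0_nonneg: "K0 \<ge> 0" by (simp add: K0_def)

text \<open>Two estimates are combined. The crude one bounds both quotients separately and covers
  out-degrees comparable to v. The fine one separates the change of the count, at most m v, from the
  error of the normalisation; the minimum selects whichever is better.\<close>

lemma edge_drift_step:
  assumes "regular \<omega>" "v \<ge> 3" "1 \<le> j" "j \<le> m v \<omega>"
  shows "\<bar>deg_count k (PG v (j - 1) \<omega>) (v - 1) / c v j \<omega> - A k (v - 1) \<omega> / (\<mu> * \<theta> * real v)\<bar>
    \<le> C1 * (min 1 ((real (m v \<omega>) + 1) / real v) + \<bar>R (v - 1) \<omega>\<bar> / real v)"
proof -
  define x' x where "x' = deg_count k (PG v (j - 1) \<omega>) (v - 1)" and "x = A k (v - 1) \<omega>"
  define cc where "cc = c v j \<omega>"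
  define \<nu> where "\<nu> = \<mu> * \<theta>"
  define V where "V = real v"
  define N where "N = real (m v \<omega>)"
  define r where "r = \<bar>R (v - 1) \<omega>\<bar>"
  have \<nu>: "\<nu> > 0" using \<mu>\<theta>_pos by (simp add: \<nu>_def)
  have V: "V > 0" using assms by (simp add: V_def)
  have r: "r \<ge> 0" by (simp add: r_def)
  have x: "0 \<le> x" "x \<le> V" "0 \<le> x'" "x' \<le> V"
    using deg_count_bounds[of k _ "v - 1"] assms unfolding x_def x'_def V_def
    by (auto intro: order_trans[OF deg_count_bounds(2)])
  have "\<bar>x' - x\<bar> \<le> real (j - 1)" unfolding x'_def x_def by (rule deg_count_PG_close)
  also have "\<dots> \<le> N" using assms by (simp add: N_def)
  finally have xx: "\<bar>x' - x\<bar> \<le> N" .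
  have c_low: "\<kappa> * V \<le> cc" unfolding V_def cc_def by (rule norm_lower_bound[OF assms])
  have "\<kappa> * V > 0" using \<kappa>_pos V by simp
  with c_low have c_pos: "cc > 0" by linarith
  have c_app: "\<bar>cc - \<nu> * V\<bar> \<le> 2 * r + 2 * N + K0"
    unfolding \<nu>_def V_def r_def N_def cc_def by (rule norm_approximation[OF assms])
  have crude: "\<bar>x' / cc - x / (\<nu> * V)\<bar> \<le> 1 / \<kappa> + 1 / \<nu>"
  proof -
    have "x' / cc \<le> V / (\<kappa> * V)" using x c_low \<open>\<kappa> * V > 0\<close> V by (intro frac_le) auto
    moreover have "x / (\<nu> * V) \<le> V / (\<nu> * V)" using x \<nu> V by (intro divide_right_mono) auto
    moreover have "x' / cc \<ge> 0" "x / (\<nu> * V) \<ge> 0" using x c_pos \<nu> V by auto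
    ultimately show ?thesis using V by simp
  qed
  have N: "N \<ge> 1" using assms by (simp add: N_def)
  have fine: "\<bar>x' / cc - x / (\<nu> * V)\<bar> \<le> (1 / \<kappa> + (2 + K0) / (\<kappa> * \<nu>)) * ((N + 1) / V) + 2 / (\<kappa> * \<nu>) * (r / V)"
  proof -
    have "x' / cc - x / (\<nu> * V) = (x' - x) / cc + x * (\<nu> * V - cc) / (cc * (\<nu> * V))"
      using c_pos \<nu> V by (simp add: field_simps)
    then have "\<bar>x' / cc - x / (\<nu> * V)\<bar> \<le> \<bar>x' - x\<bar> / cc + x * \<bar>cc - \<nu> * V\<bar> / (cc * (\<nu> * V))"
      using c_pos \<nu> V x abs_triangle_ineq[of "(x' - x) / cc" "x * (\<nu> * V - cc) / (cc * (\<nu> * V))"]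
      by (simp add: abs_mult abs_minus_commute)
    also have "\<bar>x' - x\<bar> / cc \<le> N / (\<kappa> * V)"
      using xx c_low \<open>\<kappa> * V > 0\<close> N by (intro frac_le) auto
    also have "x * \<bar>cc - \<nu> * V\<bar> / (cc * (\<nu> * V)) \<le> V * (2 * r + 2 * N + K0) / (\<kappa> * V * (\<nu> * V))"
    proof (rule frac_le)
      show "x * \<bar>cc - \<nu> * V\<bar> \<le> V * (2 * r + 2 * N + K0)"
        using x c_app V by (intro mult_mono) auto
      show "\<kappa> * V * (\<nu> * V) \<le> cc * (\<nu> * V)"
        using c_low \<nu> V by (intro mult_right_mono) auto
      show "0 < \<kappa> * V * (\<nu> * V)" using \<open>\<kappa> * V > 0\<close> \<nu> V by simp
      show "0 \<le> V * (2 * r + 2 * N + K0)" using V r N K0_nonneg by simp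
    qed
    also have "V * (2 * r + 2 * N + K0) / (\<kappa> * V * (\<nu> * V)) = (2 * r + 2 * N + K0) / (\<kappa> * \<nu>) / V"
      using V by simp
    also have "\<dots> \<le> (2 * r + (2 + K0) * (N + 1)) / (\<kappa> * \<nu>) / V"
      using \<kappa>_pos \<nu> V N K0_nonneg by (intro divide_right_mono) (auto simp: algebra_simps)
    also have "\<dots> = (2 + K0) / (\<kappa> * \<nu>) * ((N + 1) / V) + 2 / (\<kappa> * \<nu>) * (r / V)"
      using V \<kappa>_pos \<nu> by (simp add: field_simps)
    finally have "\<bar>x' / cc - x / (\<nu> * V)\<bar> \<le> N / (\<kappa> * V) + ((2 + K0) / (\<kappa> * \<nu>) * ((N + 1) / V) + 2 / (\<kappa> * \<nu>) * (r / V))"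
      by simp
    moreover have "N / (\<kappa> * V) \<le> 1 / \<kappa> * ((N + 1) / V)"
      using \<kappa>_pos V by (simp add: divide_right_mono)
    ultimately show ?thesis by (simp only: distrib_right)
  qed
  define p1 p2 p3 where "p1 = 1 / \<kappa> + 1 / \<nu>" and "p2 = 1 / \<kappa> + (2 + K0) / (\<kappa> * \<nu>)" and "p3 = 2 / (\<kappa> * \<nu>)"
  have p: "p1 \<ge> 0" "p2 \<ge> 0" "p3 \<ge> 0" using \<kappa>_pos \<nu> K0_nonneg by (auto simp: p1_def p2_def p3_def)
  define t where "t = min 1 ((N + 1) / V)"
  have t: "t \<ge> 0" using N V by (simp add: t_def)
  have rV: "r / V \<ge> 0" using r V by simp
  have "\<bar>x' / cc - x / (\<nu> * V)\<bar> \<le> (p1 + p2) * t + p3 * (r / V)"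
  proof (cases "(N + 1) / V \<le> 1")
    case True
    then have "t = (N + 1) / V" by (simp add: t_def)
    then have "\<bar>x' / cc - x / (\<nu> * V)\<bar> \<le> p2 * t + p3 * (r / V)" using fine by (simp add: p2_def p3_def)
    moreover have "0 \<le> p1 * t" using p t by simp
    ultimately show ?thesis unfolding distrib_right by linarith
  next
    case False
    then have "t = 1" by (simp add: t_def)
    moreover have "0 \<le> p3 * (r / V)" using p(3) rV by (rule mult_nonneg_nonneg)
    ultimately show ?thesis using crude p by (simp add: p1_def)
  qed
  also have "\<dots> \<le> (p1 + p2 + p3) * t + (p1 + p2 + p3) * (r / V)"
    using p t rV by (intro add_mono[OF mult_right_mono mult_right_mono]) simp_all
  also have "p1 + p2 + p3 = C1" by (simp add: C1_def p1_def p2_def p3_def \<nu>_def)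
  finally show ?thesis unfolding x'_def x_def \<nu>_def V_def t_def N_def r_def cc_def distrib_left .
qed

lemma edge_drift_bound:
  assumes "regular \<omega>" "v \<ge> 3"
  shows "\<bar>edge_drift k v \<omega> - real (m v \<omega>) * (A k (v - 1) \<omega> / (\<mu> * \<theta> * real v))\<bar> \<le> C1 * dominant v \<omega>"
proof -
  define x where "x = A k (v - 1) \<omega> / (\<mu> * \<theta> * real v)"
  define b where "b = C1 * (min 1 ((real (m v \<omega>) + 1) / real v) + \<bar>R (v - 1) \<omega>\<bar> / real v)"
  have "edge_drift k v \<omega> - real (m v \<omega>) * x
      = (\<Sum>j=1..m v \<omega>. deg_count k (PG v (j - 1) \<omega>) (v - 1) / c v j \<omega> - x)"
    by (simp add: edge_drift_def sum_subtractf)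
  then have "\<bar>edge_drift k v \<omega> - real (m v \<omega>) * x\<bar> \<le> (\<Sum>j=1..m v \<omega>. \<bar>deg_count k (PG v (j - 1) \<omega>) (v - 1) / c v j \<omega> - x\<bar>)"
    by (simp only: sum_abs)
  also have "\<dots> \<le> (\<Sum>j=1..m v \<omega>. b)"
    unfolding x_def b_def using assms by (intro sum_mono edge_drift_step) auto
  also have "\<dots> = C1 * dominant v \<omega>"
    by (simp add: b_def dominant_def algebra_simps)
  finally show ?thesis by (simp only: x_def)
qed

text \<open>Abel summation; \<open>R\<close> is an empty sum below 3, so there is no lower boundary
  term.\<close>

lemma summation_by_parts:
  "(\<Sum>v=3..n. (real (m v \<omega>) - \<mu>) * B (v - 1)) = R n \<omega> * B n - (\<Sum>v=3..n. R v \<omega> * (B v - B (v - 1)))"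
proof (induction n)
  case (Suc n)
  show ?case
  proof (cases "Suc n \<ge> 3")
    case True
    have R: "R (Suc n) \<omega> = R n \<omega> + (real (m (Suc n) \<omega>) - \<mu>)"
      using True by (simp add: R_def sum.nat_ivl_Suc')
    show ?thesis using True Suc by (simp add: sum.nat_ivl_Suc' R algebra_simps)
  qed (simp add: R_def)
qed (simp add: R_def)

text \<open>After summation by parts the fluctuations enter through \<open>R\<close> itself,
  multiplied by increments of A k / v that are O(min 1 ((m v + 1) / v)). This is a pathwise bound,
  so the dependence of the counts on the out-degrees causes no difficulty.\<close>

lemma centred_drift_bound:
  assumes "regular \<omega>"
  shows "\<bar>\<Sum>v=3..n. (real (m v \<omega>) - \<mu>) * (A k (v - 1) \<omega> / real v)\<bar>
    \<le> \<bar>R n \<omega>\<bar> + (4 + 4 * \<mu>) * (\<Sum>v=3..n. dominant v \<omega>)"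
proof -
  \<comment> \<open>The denominator v + 1 makes B (v - 1) equal to A k (v - 1) / v, and it keeps B
    in [0, 1].\<close>
  define B where "B v = A k v \<omega> / (real v + 1)" for v
  have B01: "0 \<le> B v" "B v \<le> 1" for v
    using deg_count_bounds[of k "G v \<omega>" v] by (auto simp: B_def divide_le_eq)
  have B_eq: "B (v - 1) = A k (v - 1) \<omega> / real v" if "v \<ge> 3" for v
    using that by (simp add: B_def)
  have step: "\<bar>R v \<omega> * (B v - B (v - 1))\<bar> \<le> (4 + 4 * \<mu>) * dominant v \<omega>" if v: "v \<ge> 3" for v
  proof -
    define N V t r where "N = real (m v \<omega>)" and "V = real v" and "t = min 1 ((N + 1) / V)" and "r = \<bar>R (v - 1) \<omega>\<bar>"
    have N: "N \<ge> 1" using assms v l_ge_1 unfolding N_def regular_def by (metis le_trans of_nat_1 of_nat_mono)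
    have V: "V > 0" using v by (simp add: V_def)
    have t: "0 \<le> t" "t \<le> 1" "t \<le> (N + 1) / V" using N V by (auto simp: t_def)
    obtain n where n: "v = Suc n" using v by (cases v) auto
    have R_le: "\<bar>R v \<omega>\<bar> \<le> r + (1 + \<mu>) * N"
    proof -
      have "R v \<omega> = R (v - 1) \<omega> + (N - \<mu>)" using v n by (simp add: R_def N_def sum.nat_ivl_Suc')
      then have "\<bar>R v \<omega>\<bar> \<le> r + N + \<mu>" using N \<mu>_pos by (simp add: r_def)
      moreover have "\<mu> * 1 \<le> \<mu> * N" using N \<mu>_pos by (intro mult_left_mono) auto
      ultimately show ?thesis by (simp add: algebra_simps)
    qed
    have dB: "\<bar>B v - B (v - 1)\<bar> \<le> 2 * t"
    proof -
      define y y' where "y = A k v \<omega>" and "y' = A k (v - 1) \<omega>"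
      have yy: "\<bar>y - y'\<bar> \<le> N + 1" unfolding y_def y'_def N_def by (rule deg_count_increment_bound[OF v])
      have y': "0 \<le> y'" "y' \<le> V"
        using deg_count_bounds[of k "G (v - 1) \<omega>" "v - 1"] v by (auto simp: y'_def V_def)
      have "y / (V + 1) - y' / V = (y - y') / (V + 1) - y' / (V * (V + 1))"
      proof -
        have "y' / V - y' / (V + 1) = (y' * (V + 1) - y' * V) / (V * (V + 1))"
          by (rule diff_frac_eq) (use V in auto)
        also have "y' * (V + 1) - y' * V = y'" by (simp add: distrib_left)
        finally show ?thesis by (simp add: diff_divide_distrib)
      qed
      then have "B v - B (v - 1) = (y - y') / (V + 1) - y' / (V * (V + 1))"
        unfolding B_eq[OF v] by (simp add: B_def y_def y'_def V_def)
      then have "\<bar>B v - B (v - 1)\<bar> \<le> \<bar>y - y'\<bar> / (V + 1) + y' / (V * (V + 1))"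
        using V y' abs_triangle_ineq4[of "(y - y') / (V + 1)" "y' / (V * (V + 1))"] by simp
      also have "\<dots> \<le> (N + 1) / V + V / (V * V)"
        using yy y' V N by (intro add_mono frac_le) auto
      also have "\<dots> \<le> 2 * ((N + 1) / V)" using V N by (simp add: field_simps)
      finally have "\<bar>B v - B (v - 1)\<bar> \<le> 2 * ((N + 1) / V)" .
      moreover have "\<bar>B v - B (v - 1)\<bar> \<le> 2 * 1" using B01[of v] B01[of "v - 1"] by linarith
      ultimately show ?thesis by (auto simp: t_def min_def)
    qed
    have "\<bar>R v \<omega> * (B v - B (v - 1))\<bar> \<le> (r + (1 + \<mu>) * N) * (2 * t)"
      unfolding abs_mult using R_le dB by (intro mult_mono) (auto simp: r_def)
    also have "\<dots> = 2 * (r * t) + (2 + 2 * \<mu>) * (N * t)" by (simp add: algebra_simps)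
    \<comment> \<open>From N \<ge> 1 follows N + 1 \<le> 2 N, which turns r (N + 1) / V into a
      multiple of the second term of \<open>dominant\<close>.\<close>
    also have "r * t \<le> r * ((N + 1) / V)" using t by (intro mult_left_mono) (auto simp: r_def)
    also have "\<dots> \<le> 2 * (N * r / V)"
    proof -
      have "r * (N + 1) \<le> 2 * (N * r)" using N mult_left_mono[OF N, of r] by (simp add: r_def algebra_simps)
      then have "r * (N + 1) / V \<le> 2 * (N * r) / V" using V by (intro divide_right_mono) auto
      then show ?thesis by simp
    qed
    also have "2 * (2 * (N * r / V)) + (2 + 2 * \<mu>) * (N * t) \<le> (4 + 4 * \<mu>) * (N * r / V) + (4 + 4 * \<mu>) * (N * t)"
      using \<mu>_pos N V t by (intro add_mono) (auto simp: r_def intro!: mult_right_mono divide_right_mono)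
    finally show ?thesis by (simp add: dominant_def N_def V_def t_def r_def algebra_simps)
  qed
  have "(\<Sum>v=3..n. (real (m v \<omega>) - \<mu>) * (A k (v - 1) \<omega> / real v))
      = (\<Sum>v=3..n. (real (m v \<omega>) - \<mu>) * B (v - 1))"
    by (intro sum.cong refl) (simp only: B_eq atLeastAtMost_iff)
  also have "\<dots> = R n \<omega> * B n - (\<Sum>v=3..n. R v \<omega> * (B v - B (v - 1)))"
    by (rule summation_by_parts)
  also have "\<bar>\<dots>\<bar> \<le> \<bar>R n \<omega> * B n\<bar> + \<bar>\<Sum>v=3..n. R v \<omega> * (B v - B (v - 1))\<bar>"
    by (rule abs_triangle_ineq4)
  also have "\<bar>R n \<omega> * B n\<bar> \<le> \<bar>R n \<omega>\<bar> * 1"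
    unfolding abs_mult using B01[of n] by (intro mult_left_mono) auto
  also have "\<bar>\<Sum>v=3..n. R v \<omega> * (B v - B (v - 1))\<bar> \<le> (\<Sum>v=3..n. (4 + 4 * \<mu>) * dominant v \<omega>)"
    by (rule order_trans[OF sum_abs]) (intro sum_mono step, simp)
  finally show ?thesis by (simp add: sum_distrib_left)
qed

text \<open>The target A / (\<theta> v) is \<mu> A / (\<mu> \<theta> v). First the true drift is
  replaced by m v A / (\<mu> \<theta> v), at the cost of \<open>dominant\<close>; then m v is
  replaced by \<mu> through the centred bound.\<close>

lemma edge_drift_sublinear:
  "L1_sublinear (\<lambda>n \<omega>. \<Sum>v=3..n. edge_drift k v \<omega> - A k (v - 1) \<omega> / (\<theta> * real v))"
proof (rule L1_sublinear_bound)
  have abs_R: "L1_sublinear (\<lambda>n \<omega>. \<bar>R n \<omega>\<bar>)"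
    by (rule L1_sublinear_bound[OF R_sublinear]) (use L1_sublinearD(1)[OF R_sublinear] in auto)
  show "L1_sublinear (\<lambda>n \<omega>. (1 / (\<mu> * \<theta>)) * \<bar>R n \<omega>\<bar> + (C1 + 1 / (\<mu> * \<theta>) * (4 + 4 * \<mu>)) * (\<Sum>v=3..n. dominant v \<omega>))"
    by (intro L1_sublinear_add L1_sublinear_cmult abs_R dominant_sublinear)
  show "(\<lambda>\<omega>. \<Sum>v=3..n. edge_drift k v \<omega> - A k (v - 1) \<omega> / (\<theta> * real v)) \<in> borel_measurable P" for n
    by (intro borel_measurable_sum borel_measurable_diff borel_measurable_divide edge_drift_measurable
      deg_count_G_measurable borel_measurable_const) auto
  fix n
  show "AE \<omega> in P. \<bar>\<Sum>v=3..n. edge_drift k v \<omega> - A k (v - 1) \<omega> / (\<theta> * real v)\<bar>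
      \<le> \<bar>(1 / (\<mu> * \<theta>)) * \<bar>R n \<omega>\<bar> + (C1 + 1 / (\<mu> * \<theta>) * (4 + 4 * \<mu>)) * (\<Sum>v=3..n. dominant v \<omega>)\<bar>"
    using AE_regular
  proof eventually_elim
    case (elim \<omega>)
    define X where "X v = A k (v - 1) \<omega> / real v" for v
    define S where "S = (\<Sum>v=3..n. dominant v \<omega>)"
    have eq: "edge_drift k v \<omega> - A k (v - 1) \<omega> / (\<theta> * real v)
        = (edge_drift k v \<omega> - real (m v \<omega>) * (A k (v - 1) \<omega> / (\<mu> * \<theta> * real v)))
          + 1 / (\<mu> * \<theta>) * ((real (m v \<omega>) - \<mu>) * X v)" for v
      using \<mu>_pos \<theta>_pos by (simp add: X_def left_diff_distrib diff_divide_distrib mult_ac)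
    have q: "1 / (\<mu> * \<theta>) \<ge> 0" using \<mu>\<theta>_pos by simp
    have ring: "C * s + q * (r + w * s) = q * r + (C + q * w) * s" for C s q r w :: real
      by (simp add: algebra_simps)
    have tri: "\<bar>x + q * y\<bar> \<le> \<bar>x\<bar> + q * \<bar>y\<bar>" if "q \<ge> 0" for x y q :: real
      using abs_triangle_ineq[of x "q * y"] that by (simp add: abs_mult)
    define H Y where "H = (\<Sum>v=3..n. edge_drift k v \<omega> - real (m v \<omega>) * (A k (v - 1) \<omega> / (\<mu> * \<theta> * real v)))"
      and "Y = (\<Sum>v=3..n. (real (m v \<omega>) - \<mu>) * X v)"
    have "(\<Sum>v=3..n. edge_drift k v \<omega> - A k (v - 1) \<omega> / (\<theta> * real v))
        = H + 1 / (\<mu> * \<theta>) * Y"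
      unfolding eq sum.distrib sum_distrib_left H_def Y_def ..
    then have "\<bar>\<Sum>v=3..n. edge_drift k v \<omega> - A k (v - 1) \<omega> / (\<theta> * real v)\<bar>
        \<le> \<bar>H\<bar> + 1 / (\<mu> * \<theta>) * \<bar>Y\<bar>"
      using tri[OF q, of H Y] by (simp only:)
    moreover have "\<bar>H\<bar> \<le> C1 * S"
      unfolding H_def S_def sum_distrib_left
      by (rule order_trans[OF sum_abs]) (intro sum_mono edge_drift_bound elim, simp)
    moreover have "1 / (\<mu> * \<theta>) * \<bar>Y\<bar> \<le> 1 / (\<mu> * \<theta>) * (\<bar>R n \<omega>\<bar> + (4 + 4 * \<mu>) * S)"
      unfolding X_def S_def Y_def by (intro mult_left_mono centred_drift_bound elim q)
    ultimately have "\<bar>\<Sum>v=3..n. edge_drift k v \<omega> - A k (v - 1) \<omega> / (\<theta> * real v)\<bar>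
        \<le> (1 / (\<mu> * \<theta>)) * \<bar>R n \<omega>\<bar> + (C1 + 1 / (\<mu> * \<theta>) * (4 + 4 * \<mu>)) * S"
      unfolding ring[symmetric] by linarith
    then show ?case unfolding S_def by linarith
  qed
qed

end

section \<open>Attachment noise\<close>

context integrable_preferential_attachment
begin

abbreviation attach :: "nat \<Rightarrow> nat \<Rightarrow> nat \<Rightarrow> 'w \<Rightarrow> real" where
  "attach v j u \<omega> \<equiv> pa_attach_prob model \<delta> a0 (\<lambda>i. m i \<omega>) (PG v (j - 1) \<omega>) v j u"

text \<open>A martingale difference: actual minus conditionally expected change of the degree-k
  count by edge j of v. The indicator extends it by 0 to all j, so sums can run over a deterministic
  range of edges.\<close>

definition edge_noise :: "nat \<Rightarrow> nat \<Rightarrow> nat \<Rightarrow> 'w \<Rightarrow> real" where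
  "edge_noise k v j \<omega> = of_bool (j \<le> m v \<omega>) *
     (\<Sum>u=1..v-1. (of_bool (E v j \<omega> = u) - attach v j u \<omega>) * deg_flow k (PG v (j - 1) \<omega>) u)"

lemma edge_noise_eq:
  assumes "k \<ge> 1" "v \<ge> 3" "1 \<le> j" "j \<le> m v \<omega>"
  shows "edge_noise k v j \<omega> = deg_count k (PG v j \<omega>) (v - 1) - deg_count k (PG v (j - 1) \<omega>) (v - 1)
    - ((real k - 1 + \<delta>) * deg_count (k - 1) (PG v (j - 1) \<omega>) (v - 1) - (real k + \<delta>) * deg_count k (PG v (j - 1) \<omega>) (v - 1)) / c v j \<omega>"
proof -
  obtain i where i: "j = Suc i" using assms by (cases j) auto
  have "deg_count k (PG v j \<omega>) (v - 1) = deg_count k (PG v (j - 1) \<omega>) (v - 1)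
      + (\<Sum>u=1..v-1. of_bool (E v j \<omega> = u) * deg_flow k (PG v (j - 1) \<omega>) u)"
    unfolding i pa_partial_graph_Suc diff_Suc_1 using assms by (intro deg_count_snoc) auto
  moreover note attachment_drift[OF \<open>k \<ge> 1\<close>, of model \<delta> a0 "\<lambda>i. m i \<omega>" "PG v (j - 1) \<omega>" v j]
  ultimately show ?thesis
    unfolding edge_noise_def using assms(4) by (simp only: left_diff_distrib sum_subtractf) simp
qed

lemma sum_edge_noise:
  assumes "k \<ge> 1" "v \<ge> 3"
  shows "deg_count k (PG v (m v \<omega>) \<omega>) (v - 1) - A k (v - 1) \<omega>
    = (\<Sum>j=1..m v \<omega>. edge_noise k v j \<omega>) + (real k - 1 + \<delta>) * edge_drift (k - 1) v \<omega> - (real k + \<delta>) * edge_drift k v \<omega>"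
proof -
  define X where "X k j = deg_count k (PG v j \<omega>) (v - 1)" for k j
  have "X k i - X k 0 = (\<Sum>j=1..i. edge_noise k v j \<omega> + ((real k - 1 + \<delta>) * (X (k - 1) (j - 1) / c v j \<omega>)
      - (real k + \<delta>) * (X k (j - 1) / c v j \<omega>)))" if "i \<le> m v \<omega>" for i
    using that
  proof (induction i)
    case (Suc i)
    have "edge_noise k v (Suc i) \<omega> = X k (Suc i) - X k i
        - ((real k - 1 + \<delta>) * X (k - 1) i - (real k + \<delta>) * X k i) / c v (Suc i) \<omega>"
      using edge_noise_eq[OF assms, of "Suc i" \<omega>] Suc.prems unfolding X_def by simp
    then show ?case using Suc by (simp add: diff_divide_distrib)
  qed simp
  from this[of "m v \<omega>"] show ?thesis
    by (simp add: X_def pa_partial_graph_0 edge_drift_def sum.distrib sum_subtractf sum_distrib_left)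
qed

text \<open>One edge changes the count by at most 1; the drift is bounded by counts \<le> v over a
  normalisation \<ge> \<kappa> v.\<close>

definition noise_bound :: "nat \<Rightarrow> real" where
  "noise_bound k = 1 + (\<bar>real k - 1 + \<delta>\<bar> + \<bar>real k + \<delta>\<bar>) / \<kappa>"

lemma noise_bound_nonneg: "noise_bound k \<ge> 0"
  using \<kappa>_pos by (simp add: noise_bound_def)

lemma edge_noise_bound:
  assumes "k \<ge> 1" "v \<ge> 3" "j \<ge> 1" "regular \<omega>"
  shows "\<bar>edge_noise k v j \<omega>\<bar> \<le> noise_bound k"
proof (cases "j \<le> m v \<omega>")
  case True
  obtain i where i: "j = Suc i" using assms by (cases j) auto
  define X Y where "X = deg_count k (PG v (j - 1) \<omega>) (v - 1)" and "Y = deg_count (k - 1) (PG v (j - 1) \<omega>) (v - 1)"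
  define p q where "p = real k - 1 + \<delta>" and "q = real k + \<delta>"
  have XY: "0 \<le> X" "X \<le> real v" "0 \<le> Y" "Y \<le> real v"
    using deg_count_bounds[of k "PG v (j - 1) \<omega>" "v - 1"] deg_count_bounds[of "k - 1" "PG v (j - 1) \<omega>" "v - 1"] assms
    by (auto simp: X_def Y_def)
  have c: "\<kappa> * real v \<le> c v j \<omega>" by (rule norm_lower_bound[OF assms(4,2,3) True])
  have \<kappa>v: "\<kappa> * real v > 0" using \<kappa>_pos assms by simp
  have 1: "\<bar>deg_count k (PG v j \<omega>) (v - 1) - X\<bar> \<le> 1"
    unfolding i X_def pa_partial_graph_Suc diff_Suc_1 using assms by (intro deg_count_snoc_bound) auto
  have "\<bar>p * Y - q * X\<bar> \<le> \<bar>p\<bar> * Y + \<bar>q\<bar> * X"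
    using XY abs_triangle_ineq4[of "p * Y" "q * X"] by (simp add: abs_mult)
  also have "\<dots> \<le> \<bar>p\<bar> * real v + \<bar>q\<bar> * real v" using XY by (intro add_mono mult_left_mono) auto
  finally have "\<bar>p * Y - q * X\<bar> \<le> (\<bar>p\<bar> + \<bar>q\<bar>) * real v" by (simp add: distrib_right)
  then have "\<bar>p * Y - q * X\<bar> / c v j \<omega> \<le> ((\<bar>p\<bar> + \<bar>q\<bar>) * real v) / (\<kappa> * real v)"
    using c \<kappa>v by (intro frac_le) auto
  then have 2: "\<bar>p * Y - q * X\<bar> / c v j \<omega> \<le> (\<bar>p\<bar> + \<bar>q\<bar>) / \<kappa>" using assms by simp
  have "\<bar>edge_noise k v j \<omega>\<bar> \<le> \<bar>deg_count k (PG v j \<omega>) (v - 1) - X\<bar> + \<bar>(p * Y - q * X) / c v j \<omega>\<bar>"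
    unfolding edge_noise_eq[OF assms(1-3) True] X_def[symmetric] Y_def[symmetric] p_def[symmetric] q_def[symmetric]
    by (rule abs_triangle_ineq4)
  also have "\<bar>(p * Y - q * X) / c v j \<omega>\<bar> = \<bar>p * Y - q * X\<bar> / c v j \<omega>"
    by (subst abs_divide) (use c \<kappa>v in simp)
  finally show ?thesis using 1 2 by (simp add: noise_bound_def p_def q_def)
qed (use noise_bound_nonneg in \<open>simp add: edge_noise_def\<close>)

lemma AE_edge_noise_bound:
  assumes "k \<ge> 1" "v \<ge> 3" "j \<ge> 1"
  shows "AE \<omega> in P. \<bar>edge_noise k v j \<omega>\<bar> \<le> noise_bound k"
  using AE_regular by eventually_elim (rule edge_noise_bound[OF assms])

lemma edge_noise_measurable:
  assumes "v \<ge> 3" "j \<ge> 1"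
  shows "edge_noise k v j \<in> borel_measurable P"
proof -
  have 1: "(\<lambda>\<omega>. of_bool (j \<le> m v \<omega>) :: real) \<in> borel_measurable P"
    by (rule measurable_compose[OF m_measurable]) (use assms in auto)
  have 2: "(\<lambda>\<omega>. of_bool (E v j \<omega> = u) :: real) \<in> borel_measurable P" for u
    by (rule measurable_compose[OF E_measurable[OF assms]]) simp
  have 3: "(\<lambda>\<omega>. deg_flow k (PG v (j - 1) \<omega>) u) \<in> borel_measurable P" for u
    by (rule measurable_compose[OF PG_measurable[OF assms(1)]]) simp
  show ?thesis
    unfolding edge_noise_def[abs_def]
    by (intro borel_measurable_times borel_measurable_sum borel_measurable_diff 1 2 3 attach_prob_measurable assms)
qed

lemma out_degree_indicator_measurable:
  assumes "v \<ge> 3"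
  shows "(\<lambda>\<omega>. of_bool (j \<le> m v \<omega>) :: real) \<in> borel_measurable (pa_sigma P m (PG v i))"
proof -
  have "(\<lambda>\<omega>. of_bool (j \<le> out_degrees m v \<omega> ! (v - 1)) :: real) \<in> borel_measurable (pa_sigma P m (PG v i))"
    by (rule pa_sigma_measurable)
  moreover have "out_degrees m v \<omega> ! (v - 1) = m v \<omega>" for \<omega>
    using assms by (intro out_degrees_nth) auto
  ultimately show ?thesis by (simp only:)
qed

text \<open>For each candidate u the factor Z, the indicator of j \<le> m v and the flow at u are
  all known before the edge is attached, so the conditional law of the edge cancels the two terms of
  the noise.\<close>

lemma edge_noise_zero_mean:
  assumes v: "v \<ge> 3" and j: "j \<ge> 1"
    and Z: "Z \<in> borel_measurable (pa_sigma P m (PG v (j - 1)))" and bdd: "AE \<omega> in P. \<bar>Z \<omega>\<bar> \<le> B"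
  shows "expectation (\<lambda>\<omega>. Z \<omega> * edge_noise k v j \<omega>) = 0"
proof -
  define Zu where "Zu u \<omega> = Z \<omega> * (of_bool (j \<le> m v \<omega>) * deg_flow k (PG v (j - 1) \<omega>) u)" for u \<omega>
  have Zu_meas: "Zu u \<in> borel_measurable (pa_sigma P m (PG v (j - 1)))" for u
  proof -
    have "(\<lambda>\<omega>. deg_flow k (PG v (j - 1) \<omega>) u) \<in> borel_measurable (pa_sigma P m (PG v (j - 1)))"
      by (rule pa_sigma_measurable)
    note borel_measurable_times[OF out_degree_indicator_measurable[OF v, of j] this]
    from borel_measurable_times[OF Z this] show ?thesis unfolding Zu_def[abs_def] .
  qed
  have Zu_le: "\<bar>Zu u \<omega>\<bar> \<le> \<bar>Z \<omega>\<bar>" for u \<omega>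
  proof -
    have "\<bar>Zu u \<omega>\<bar> = \<bar>Z \<omega>\<bar> * \<bar>of_bool (j \<le> m v \<omega>) * deg_flow k (PG v (j - 1) \<omega>) u\<bar>"
      by (simp add: Zu_def abs_mult)
    also have "\<dots> \<le> \<bar>Z \<omega>\<bar> * 1"
      using deg_flow_bound[of k "PG v (j - 1) \<omega>" u] by (intro mult_left_mono) auto
    finally show ?thesis by simp
  qed
  have Zu_bdd: "AE \<omega> in P. \<bar>Zu u \<omega>\<bar> \<le> B" for u
    using bdd by eventually_elim (use Zu_le order_trans in blast)
  have Zu_zero: "Zu u \<omega> = 0" if "m v \<omega> < j" for u \<omega> using that by (simp add: Zu_def)
  note zm = attachment_zero_mean[OF v j Zu_meas Zu_bdd Zu_zero]
  have int1: "integrable P (\<lambda>\<omega>. Zu u \<omega> * of_bool (E v j \<omega> = u))" for u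
  proof (rule integrable_AE_bounded)
    have "(\<lambda>\<omega>. of_bool (E v j \<omega> = u) :: real) \<in> borel_measurable P"
      by (rule measurable_compose[OF E_measurable[OF v j]]) simp
    then show "(\<lambda>\<omega>. Zu u \<omega> * of_bool (E v j \<omega> = u)) \<in> borel_measurable P"
      by (intro borel_measurable_times measurable_from_subalg[OF pa_sigma_subalgebra[OF v] Zu_meas])
    show "AE \<omega> in P. \<bar>Zu u \<omega> * of_bool (E v j \<omega> = u)\<bar> \<le> \<bar>B\<bar>"
      using Zu_bdd[of u] by eventually_elim (auto simp: abs_mult)
  qed
  have "expectation (\<lambda>\<omega>. Z \<omega> * edge_noise k v j \<omega>)
      = expectation (\<lambda>\<omega>. \<Sum>u=1..v-1. Zu u \<omega> * of_bool (E v j \<omega> = u) - Zu u \<omega> * attach v j u \<omega>)"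
    by (intro Bochner_Integration.integral_cong refl)
      (simp add: edge_noise_def Zu_def sum_distrib_left algebra_simps)
  also have "\<dots> = (\<Sum>u=1..v-1. expectation (\<lambda>\<omega>. Zu u \<omega> * of_bool (E v j \<omega> = u)) - expectation (\<lambda>\<omega>. Zu u \<omega> * attach v j u \<omega>))"
    by (subst Bochner_Integration.integral_sum)
      (auto intro!: Bochner_Integration.integrable_diff int1 zm(1) sum.cong Bochner_Integration.integral_diff simp del: One_nat_def)
  also have "\<dots> = 0" using zm(2) by simp
  finally show ?thesis .
qed

lemma length_G: "length (G n \<omega>) = length G0 + (\<Sum>i=3..n. m i \<omega>)"
proof (induction n)
  case (Suc n)
  show ?case
  proof (cases "Suc n \<ge> 3")
    case True
    then show ?thesis using Suc pa_graph_eq_partial[OF True, of G0 m E \<omega>]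
      by (simp add: pa_partial_graph_def pa_edges_def sum.nat_ivl_Suc')
  qed (simp add: pa_graph_def)
qed (simp add: pa_graph_def)

lemma length_PG: "length (PG v j \<omega>) = length G0 + (\<Sum>i=3..v-1. m i \<omega>) + j"
  by (simp add: pa_partial_graph_def pa_edges_def length_G)

lemma PG_prefix: "\<exists>ys. PG v (j + i) \<omega> = PG v j \<omega> @ ys"
  by (induction i) (auto simp: pa_partial_graph_Suc)

lemma G_prefix:
  assumes "v \<ge> 2"
  shows "\<exists>ys. G (v + i) \<omega> = G v \<omega> @ ys"
proof (induction i)
  case (Suc i)
  have "G (Suc (v + i)) \<omega> = G (v + i) \<omega> @ pa_edges (E (Suc (v + i))) (Suc (v + i)) (m (Suc (v + i)) \<omega>) \<omega>"
    using pa_graph_eq_partial[of "Suc (v + i)" G0 m E \<omega>] assms by (simp add: pa_partial_graph_def)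
  then show ?case using Suc by auto
qed simp

lemma PG_prefix_later:
  assumes "v \<ge> 3" "v < v' \<or> v = v' \<and> j \<le> j'" "j \<le> m v \<omega>"
  shows "\<exists>ys. PG v' j' \<omega> = PG v j \<omega> @ ys"
  using assms(2)
proof (elim disjE conjE)
  assume "v < v'"
  then have eq: "v + (v' - 1 - v) = v' - 1" by simp
  obtain ys where ys: "G (v' - 1) \<omega> = G v \<omega> @ ys"
    using G_prefix[of v "v' - 1 - v" \<omega>] assms(1) unfolding eq by auto
  obtain zs where zs: "PG v (m v \<omega>) \<omega> = PG v j \<omega> @ zs"
    using PG_prefix[of v j "m v \<omega> - j" \<omega>] assms(3) by auto
  show ?thesis
    using ys zs pa_graph_eq_partial[OF assms(1), of G0 m E \<omega>] by (simp add: pa_partial_graph_def[of _ _ _ v' j'])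
next
  assume "v = v'" "j \<le> j'"
  then show ?thesis using PG_prefix[of v j "j' - j" \<omega>] by simp
qed

text \<open>Graphs are edge lists in order of attachment, so an earlier graph is a prefix of every
  later one, and its length is determined by the out-degrees. Past noise is thus a function of the
  later graph and the out-degrees. If edge j of v does not exist, the indicator makes the noise
  0.\<close>

lemma edge_noise_adapted:
  assumes "v \<ge> 3" "j \<ge> 1" "j' \<ge> 1" "v < v' \<or> v = v' \<and> j < j'"
  shows "(\<lambda>\<omega>. edge_noise k v j \<omega>) \<in> borel_measurable (pa_sigma P m (PG v' (j' - 1)))"
proof -
  define b :: "nat list \<Rightarrow> nat \<Rightarrow> nat" where "b l i = l ! (i - 1)" for l i
  \<comment> \<open>Position of edge j of v in the list, counted from 0: the entries before it form
    \<open>PG v (j - 1)\<close>, and the second component of the entry there is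
    \<open>E v j\<close>.\<close>
  define N where "N l = length G0 + (\<Sum>i=3..v-1. b l i) + (j - 1)" for l
  define f where "f l g = of_bool (j \<le> b l v) * (\<Sum>u=1..v-1. (of_bool (snd (g ! N l) = u)
      - pa_attach_prob model \<delta> a0 (b l) (take (N l) g) v j u) * deg_flow k (take (N l) g) u)" for l and g :: multigraph
  have "edge_noise k v j \<omega> = f (out_degrees m v' \<omega>) (PG v' (j' - 1) \<omega>)" for \<omega>
  proof (cases "j \<le> m v \<omega>")
    case True
    have b: "b (out_degrees m v' \<omega>) i = m i \<omega>" if "1 \<le> i" "i \<le> v" for i
      unfolding b_def using that assms by (intro out_degrees_nth) auto
    have "(\<Sum>i=3..v-1. b (out_degrees m v' \<omega>) i) = (\<Sum>i=3..v-1. m i \<omega>)"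
      by (intro sum.cong refl b) auto
    then have N: "N (out_degrees m v' \<omega>) = length (PG v (j - 1) \<omega>)" by (simp add: N_def length_PG)
    have "v < v' \<or> v = v' \<and> j \<le> j' - 1" using assms by auto
    from PG_prefix_later[OF assms(1) this True] obtain ys where "PG v' (j' - 1) \<omega> = PG v j \<omega> @ ys"
      by blast
    moreover have "PG v j \<omega> = PG v (j - 1) \<omega> @ [(v, E v j \<omega>)]"
      using pa_partial_graph_Suc[of G0 m E v "j - 1" \<omega>] assms by simp
    ultimately have g: "PG v' (j' - 1) \<omega> = PG v (j - 1) \<omega> @ (v, E v j \<omega>) # ys" by simp
    have "attach v j u \<omega> = pa_attach_prob model \<delta> a0 (b (out_degrees m v' \<omega>)) (PG v (j - 1) \<omega>) v j u" for u
      using assms by (intro pa_attach_prob_cong) (auto simp only: b)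
    moreover have "b (out_degrees m v' \<omega>) v = m v \<omega>" using assms by (intro b) auto
    ultimately show ?thesis by (simp only: f_def N g edge_noise_def) simp
  next
    case False
    moreover have "b (out_degrees m v' \<omega>) v = m v \<omega>"
      unfolding b_def using assms by (intro out_degrees_nth) auto
    ultimately show ?thesis by (simp add: edge_noise_def f_def)
  qed
  then show ?thesis using pa_sigma_measurable[of f v' v' "j' - 1"] by (simp only:)
qed

text \<open>Whichever edge comes later has conditional mean 0 given everything that determines the
  noise of the earlier one.\<close>

lemma edge_noise_orthogonal:
  assumes "k \<ge> 1" "v \<ge> 3" "v' \<ge> 3" "j \<ge> 1" "j' \<ge> 1" "(v, j) \<noteq> (v', j')"
  shows "expectation (\<lambda>\<omega>. edge_noise k v j \<omega> * edge_noise k v' j' \<omega>) = 0"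
proof -
  consider "v < v' \<or> v = v' \<and> j < j'" | "v' < v \<or> v' = v \<and> j' < j" using assms(6) by force
  then show ?thesis
  proof cases
    case 1
    show ?thesis
      by (rule edge_noise_zero_mean[OF assms(3,5) edge_noise_adapted[OF assms(2,4,5) 1] AE_edge_noise_bound[OF assms(1,2,4)]])
  next
    case 2
    have "expectation (\<lambda>\<omega>. edge_noise k v' j' \<omega> * edge_noise k v j \<omega>) = 0"
      by (rule edge_noise_zero_mean[OF assms(2,4) edge_noise_adapted[OF assms(3,5,4) 2] AE_edge_noise_bound[OF assms(1,3,5)]])
    then show ?thesis by (simp only: mult.commute)
  qed
qed

lemma tail_tendsto_zero: "(\<lambda>K. measure_pmf.expectation M (\<lambda>i. real (i - K))) \<longlonglongrightarrow> 0"
proof (rule pmf_tendsto_zero[OF M_integrable])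
  show "(\<lambda>K. real (k - K)) \<longlonglongrightarrow> 0" for k
    by (rule tendsto_eventually) (auto simp: eventually_sequentially intro!: exI[of _ k])
qed simp

lemma tail_integrable: "integrable (measure_pmf M) (\<lambda>i. real (i - K))"
  by (rule Bochner_Integration.integrable_bound[OF M_integrable]) auto

text \<open>Each edge beyond the K-th contributes at most \<open>noise_bound k\<close>, and there
  are m v - K of them; truncated subtraction gives 0 when there are none.\<close>

lemma sum_edge_noise_truncation:
  assumes "k \<ge> 1" "v \<ge> 3" "regular \<omega>"
  shows "\<bar>(\<Sum>j=1..m v \<omega>. edge_noise k v j \<omega>) - (\<Sum>j=1..K. edge_noise k v j \<omega>)\<bar> \<le> noise_bound k * real (m v \<omega> - K)"
proof (cases "m v \<omega> \<le> K")
  case True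
  have "(\<Sum>j=1..m v \<omega>. edge_noise k v j \<omega>) = (\<Sum>j=1..K. edge_noise k v j \<omega>)"
    by (rule sum.mono_neutral_left) (use True in \<open>auto simp: edge_noise_def\<close>)
  then show ?thesis by (simp add: True)
next
  case False
  have "{1..m v \<omega>} = {1..K} \<union> {K<..m v \<omega>}" using False by auto
  then have "(\<Sum>j=1..m v \<omega>. edge_noise k v j \<omega>) = (\<Sum>j=1..K. edge_noise k v j \<omega>) + (\<Sum>j\<in>{K<..m v \<omega>}. edge_noise k v j \<omega>)"
    by (simp only:) (rule sum.union_disjoint, auto)
  then have "\<bar>(\<Sum>j=1..m v \<omega>. edge_noise k v j \<omega>) - (\<Sum>j=1..K. edge_noise k v j \<omega>)\<bar> = \<bar>\<Sum>j\<in>{K<..m v \<omega>}. edge_noise k v j \<omega>\<bar>"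
    by simp
  also have "\<dots> \<le> (\<Sum>j\<in>{K<..m v \<omega>}. noise_bound k)"
    by (rule order_trans[OF sum_abs]) (intro sum_mono edge_noise_bound assms, simp)
  finally show ?thesis using False by (simp add: mult.commute of_nat_diff)
qed

text \<open>With at most K edges per vertex the sum runs over a deterministic set of at most n K
  bounded orthogonal terms, so its second moment is O(n). The omitted edges cost a multiple of the
  expected excess of M over K, small for large K by integrability alone.\<close>

lemma edge_noise_sublinear:
  assumes k: "k \<ge> 1"
  shows "L1_sublinear (\<lambda>n \<omega>. \<Sum>v=3..n. \<Sum>j=1..m v \<omega>. edge_noise k v j \<omega>)"
proof (rule L1_sublinear_approx)
  let ?S = "\<lambda>v \<omega>. \<Sum>j=1..m v \<omega>. edge_noise k v j \<omega>" and ?T = "\<lambda>K v \<omega>. \<Sum>j=1..K. edge_noise k v j \<omega>"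
  have meas: "(\<lambda>\<omega>. \<Sum>j=1..m v \<omega>. edge_noise k v j \<omega>) \<in> borel_measurable P" if "v \<ge> 3" for v
    using that by (intro sum_out_degree_measurable edge_noise_measurable)
  have tail: "integrable P (\<lambda>\<omega>. noise_bound k * real (m v \<omega> - K))"
    "expectation (\<lambda>\<omega>. noise_bound k * real (m v \<omega> - K)) = noise_bound k * measure_pmf.expectation M (\<lambda>i. real (i - K))"
    if "v \<ge> 3" for v K
    using m_expectation[OF that, of "\<lambda>i. real (i - K)"] tail_integrable by auto
  have diff_int: "integrable P (\<lambda>\<omega>. ?S v \<omega> - ?T K v \<omega>)"
    and diff_bound: "expectation (\<lambda>\<omega>. \<bar>?S v \<omega> - ?T K v \<omega>\<bar>)
        \<le> noise_bound k * measure_pmf.expectation M (\<lambda>i. real (i - K))" if v: "v \<ge> 3" for v K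
  proof -
    have le: "AE \<omega> in P. \<bar>?S v \<omega> - ?T K v \<omega>\<bar>
        \<le> noise_bound k * real (m v \<omega> - K)"
      using AE_regular by eventually_elim (rule sum_edge_noise_truncation[OF k v])
    show int: "integrable P (\<lambda>\<omega>. ?S v \<omega> - ?T K v \<omega>)"
    proof (rule Bochner_Integration.integrable_bound[OF tail(1)[OF v, of K]])
      show "(\<lambda>\<omega>. ?S v \<omega> - ?T K v \<omega>) \<in> borel_measurable P"
        using v by (intro borel_measurable_diff meas borel_measurable_sum edge_noise_measurable) auto
      show "AE \<omega> in P. norm (?S v \<omega> - ?T K v \<omega>)
          \<le> norm (noise_bound k * real (m v \<omega> - K))"
        using le by eventually_elim (unfold real_norm_def, rule order_trans[OF _ abs_ge_self])
    qed
    show "expectation (\<lambda>\<omega>. \<bar>?S v \<omega> - ?T K v \<omega>\<bar>)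
        \<le> noise_bound k * measure_pmf.expectation M (\<lambda>i. real (i - K))"
      unfolding tail(2)[OF v, symmetric] by (rule integral_mono_AE[OF integrable_abs[OF int] tail(1)[OF v] le])
  qed
  show "integrable P (\<lambda>\<omega>. \<Sum>v=3..n. ?S v \<omega>)" for n
    by (rule Bochner_Integration.integrable_sum) (use diff_int[of _ 0] in simp)
  fix e :: real assume "e > 0"
  have "(\<lambda>K. noise_bound k * measure_pmf.expectation M (\<lambda>i. real (i - K))) \<longlonglongrightarrow> noise_bound k * 0"
    by (intro tendsto_mult tendsto_const tail_tendsto_zero)
  then have "\<forall>\<^sub>F K in sequentially. noise_bound k * measure_pmf.expectation M (\<lambda>i. real (i - K)) < e"
    using \<open>e > 0\<close> by (intro order_tendstoD(2)) auto
  then obtain K where K: "noise_bound k * measure_pmf.expectation M (\<lambda>i. real (i - K)) < e"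
    using eventually_happens'[OF sequentially_bot] by blast
  have "L1_sublinear (\<lambda>n \<omega>. \<Sum>v=3..n. ?T K v \<omega>)"
  proof (rule L1_sublinear_of_second_moment)
    define I where "I n = {3..n} \<times> {1..K}" for n :: nat
    define D where "D p \<omega> = edge_noise k (fst p) (snd p) \<omega>" for p \<omega>
    have sum_eq: "(\<Sum>v=3..n. ?T K v \<omega>) = (\<Sum>p\<in>I n. D p \<omega>)" for n \<omega>
      by (simp add: I_def D_def sum.cartesian_product case_prod_beta)
    have D_meas: "D p \<in> borel_measurable P" if "p \<in> I n" for p n
      unfolding D_def[abs_def] using that by (intro edge_noise_measurable) (auto simp: I_def)
    have D_bdd: "AE \<omega> in P. \<bar>D p \<omega>\<bar> \<le> noise_bound k" if "p \<in> I n" for p n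
      unfolding D_def using that k by (intro AE_edge_noise_bound) (auto simp: I_def)
    have D_orth: "expectation (\<lambda>\<omega>. D p \<omega> * D p' \<omega>) = 0" if "p \<in> I n" "p' \<in> I n" "p \<noteq> p'" for p p' n
      unfolding D_def using that k by (intro edge_noise_orthogonal) (auto simp: I_def)
    have fin: "finite (I n)" for n by (simp add: I_def)
    show "integrable P (\<lambda>\<omega>. \<Sum>v=3..n. ?T K v \<omega>)" for n
      unfolding sum_eq by (intro Bochner_Integration.integrable_sum integrable_AE_bounded[OF D_meas D_bdd])
    show "integrable P (\<lambda>\<omega>. (\<Sum>v=3..n. ?T K v \<omega>)\<^sup>2)" for n
      unfolding sum_eq by (rule orthogonal_sum_second_moment(1)[OF fin D_meas D_bdd D_orth])
    have "expectation (\<lambda>\<omega>. (\<Sum>v=3..n. ?T K v \<omega>)\<^sup>2) \<le> (noise_bound k)\<^sup>2 * real (card (I n))" for n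
      unfolding sum_eq by (rule orthogonal_sum_second_moment(2)[OF fin D_meas D_bdd D_orth])
    also have "(noise_bound k)\<^sup>2 * real (card (I n)) \<le> (noise_bound k)\<^sup>2 * real (n * K)" for n
      by (intro mult_left_mono) (auto simp: I_def card_cartesian_product intro!: mult_right_mono)
    also have "(noise_bound k)\<^sup>2 * real (n * K) = ((noise_bound k)\<^sup>2 * real K) * real n" for n by simp
    finally show "expectation (\<lambda>\<omega>. (\<Sum>v=3..n. ?T K v \<omega>)\<^sup>2) \<le> ((noise_bound k)\<^sup>2 * real K) * real n" for n .
  qed
  moreover have "expectation (\<lambda>\<omega>. \<bar>(\<Sum>v=3..n. ?S v \<omega>) - (\<Sum>v=3..n. ?T K v \<omega>)\<bar>) \<le> e * real n" for n
  proof -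
    let ?d = "\<lambda>v \<omega>. ?S v \<omega> - ?T K v \<omega>"
    have "expectation (\<lambda>\<omega>. \<bar>(\<Sum>v=3..n. ?S v \<omega>) - (\<Sum>v=3..n. ?T K v \<omega>)\<bar>)
        \<le> expectation (\<lambda>\<omega>. \<Sum>v=3..n. \<bar>?d v \<omega>\<bar>)"
      unfolding sum_subtractf[symmetric]
      by (intro integral_mono integrable_abs Bochner_Integration.integrable_sum diff_int sum_abs) auto
    also have "\<dots> = (\<Sum>v=3..n. expectation (\<lambda>\<omega>. \<bar>?d v \<omega>\<bar>))"
      by (intro Bochner_Integration.integral_sum integrable_abs diff_int) auto
    also have "\<dots> \<le> (\<Sum>v=3..n. e)"
      by (intro sum_mono order_trans[OF diff_bound less_imp_le[OF K]]) auto
    also have "\<dots> \<le> e * real n" using \<open>e > 0\<close> by simp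
    finally show ?thesis .
  qed
  ultimately show "\<exists>H'. L1_sublinear H' \<and> (\<forall>n. expectation (\<lambda>\<omega>. \<bar>(\<Sum>v=3..n. ?S v \<omega>) - H' n \<omega>\<bar>) \<le> e * real n)"
    by blast
qed

end

section \<open>Convergence of the degree counts\<close>

text \<open>The guard starts the recursion at l, where l + \<delta> > 0 makes the denominators
  positive.\<close>

fun limit_law :: "real \<Rightarrow> real \<Rightarrow> nat \<Rightarrow> (nat \<Rightarrow> real) \<Rightarrow> nat \<Rightarrow> real" where
  "limit_law \<theta> \<delta> l b 0 = 0"
| "limit_law \<theta> \<delta> l b (Suc k) =
    (if Suc k < l then 0 else (\<theta> * b (Suc k) + (real k + \<delta>) * limit_law \<theta> \<delta> l b k) / (\<theta> + real (Suc k) + \<delta>))"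

context integrable_preferential_attachment
begin

section \<open>Self-loops and the degree of a new vertex\<close>

text \<open>The variables \<open>E\<close> are constrained only through conditional probabilities. A
  target u > v has probability 0, and countably many null events are collected; only then is a
  vertex known to have degree 0 before it arrives.\<close>

lemma AE_attach_to_existing: "AE \<omega> in P. \<forall>v\<ge>3. \<forall>j\<ge>1. j \<le> m v \<omega> \<longrightarrow> E v j \<omega> \<le> v"
proof -
  have "AE \<omega> in P. v \<ge> 3 \<longrightarrow> j \<ge> 1 \<longrightarrow> u > v \<longrightarrow> j \<le> m v \<omega> \<longrightarrow> E v j \<omega> \<noteq> u" for v j u
  proof (cases "v \<ge> 3 \<and> j \<ge> 1 \<and> u > v")
    case True
    then have vj: "v \<ge> 3" "j \<ge> 1" by auto
    define Z where "Z \<omega> = (of_bool (j \<le> m v \<omega>) :: real)" for \<omega>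
    have Z: "Z \<in> borel_measurable (pa_sigma P m (PG v (j - 1)))"
      unfolding Z_def[abs_def] by (rule out_degree_indicator_measurable[OF vj(1)])
    have Z1: "AE \<omega> in P. \<bar>Z \<omega>\<bar> \<le> 1" by (simp add: Z_def)
    have "expectation (\<lambda>\<omega>. Z \<omega> * of_bool (E v j \<omega> = u)) = expectation (\<lambda>\<omega>. Z \<omega> * attach v j u \<omega>)"
      by (rule attachment_zero_mean(2)[OF vj Z Z1]) (simp add: Z_def)
    also have "\<dots> = 0" using True by (simp add: pa_attach_prob_def)
    finally have 0: "expectation (\<lambda>\<omega>. Z \<omega> * of_bool (E v j \<omega> = u)) = 0" .
    have meas: "(\<lambda>\<omega>. Z \<omega> * of_bool (E v j \<omega> = u)) \<in> borel_measurable P"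
      by (intro borel_measurable_times measurable_from_subalg[OF pa_sigma_subalgebra[OF vj(1)] Z]
        measurable_compose[OF E_measurable[OF vj]]) simp
    have int: "integrable P (\<lambda>\<omega>. Z \<omega> * of_bool (E v j \<omega> = u))"
      by (rule integrable_AE_bounded[OF meas, of 1]) (simp add: Z_def)
    have "AE \<omega> in P. Z \<omega> * of_bool (E v j \<omega> = u) = 0"
      using 0 by (subst (asm) integral_nonneg_eq_0_iff_AE[OF int]) (auto simp: Z_def)
    then show ?thesis by eventually_elim (auto simp: Z_def)
  qed auto
  then have "AE \<omega> in P. \<forall>v j u. v \<ge> 3 \<longrightarrow> j \<ge> 1 \<longrightarrow> u > v \<longrightarrow> j \<le> m v \<omega> \<longrightarrow> E v j \<omega> \<noteq> u"
    by (simp only: AE_all_countable) blast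
  then show ?thesis by eventually_elim (metis not_le)
qed

lemma vdegree_new_vertex:
  assumes "\<forall>v\<ge>3. \<forall>j\<ge>1. j \<le> m v \<omega> \<longrightarrow> E v j \<omega> \<le> v" "n < u" "u \<ge> 3"
  shows "vdegree (G n \<omega>) u = 0"
proof -
  have G0: "vdegree G0 u = 0"
    using initial_vertices assms(3) by (auto simp: vdegree_def count_list_0_iff)
  have "vdegree (pa_edges (E v) v (m v \<omega>) \<omega>) u = 0" if "v \<in> {3..n}" for v
    using assms(1) that assms(2) by (fastforce simp: vdegree_def count_list_0_iff pa_edges_def)
  moreover have "vdegree (concat (map h vs)) u = 0" if "\<forall>v\<in>set vs. vdegree (h v) u = 0" for h :: "nat \<Rightarrow> multigraph" and vs
    using that by (induction vs) (auto simp: vdegree_append, simp add: vdegree_def)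
  ultimately show ?thesis using G0 by (auto simp: pa_graph_def vdegree_append simp del: upt_Suc)
qed

lemma vdegree_PG:
  assumes "\<forall>v\<ge>3. \<forall>j\<ge>1. j \<le> m v \<omega> \<longrightarrow> E v j \<omega> \<le> v" "v \<ge> 3"
  shows "vdegree (PG v j \<omega>) v \<le> 2 * j"
    and "(\<forall>i\<in>{1..j}. E v i \<omega> \<noteq> v) \<Longrightarrow> vdegree (PG v j \<omega>) v = j"
proof -
  have 0: "vdegree (G (v - 1) \<omega>) v = 0"
    by (rule vdegree_new_vertex[OF assms(1)]) (use assms in auto)
  show "vdegree (PG v j \<omega>) v \<le> 2 * j"
    by (induction j) (auto simp: pa_partial_graph_0 pa_partial_graph_Suc vdegree_snoc 0[simplified])
  show "vdegree (PG v j \<omega>) v = j" if "\<forall>i\<in>{1..j}. E v i \<omega> \<noteq> v"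
    using that
  proof (induction j)
    case (Suc j)
    have "E v (Suc j) \<omega> \<noteq> v" "vdegree (PG v j \<omega>) v = j" using Suc by auto
    then show ?case by (auto simp: pa_partial_graph_Suc vdegree_snoc)
  qed (simp add: pa_partial_graph_0 0[simplified])
qed

lemma loop_weight_bound:
  assumes "vdegree g v \<le> 2 * (j - 1)" "1 \<le> j" "j \<le> b v"
  shows "pa_loop_weight model \<delta> b g v j \<le> 2 * real j + \<bar>\<delta>\<bar>"
proof -
  have "real i / real (b v) * \<delta> \<le> \<bar>\<delta>\<bar>" if "i \<le> b v" for i
  proof -
    have "real i / real (b v) * \<delta> \<le> real i / real (b v) * \<bar>\<delta>\<bar>" by (intro mult_left_mono) auto
    also have "\<dots> \<le> 1 * \<bar>\<delta>\<bar>" using that assms by (intro mult_right_mono) (auto simp: divide_le_eq)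
    finally show ?thesis by simp
  qed
  from this[of j] this[of "j - 1"]
  have "real j / real (b v) * \<delta> \<le> \<bar>\<delta>\<bar>" "(real j - 1) / real (b v) * \<delta> \<le> \<bar>\<delta>\<bar>"
    using assms by (auto simp: of_nat_diff)
  moreover have "real (vdegree g v) + 2 \<le> 2 * real j" using assms by linarith
  ultimately have "real (vdegree g v) + 1 + real j / real (b v) * \<delta> \<le> 2 * real j + \<bar>\<delta>\<bar>"
    "real (vdegree g v) + (real j - 1) / real (b v) * \<delta> \<le> 2 * real j + \<bar>\<delta>\<bar>"
    by linarith+
  then show ?thesis by (cases model) simp_all
qed

text \<open>Before edge j the new vertex has degree at most 2 (j - 1), so its loop weight is O(j +
  1), against a normalisation of order v.\<close>

lemma self_loop_probability:
  assumes "v \<ge> 3" "j \<ge> 1"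
  shows "integrable P (\<lambda>\<omega>. of_bool (j \<le> m v \<omega>) * of_bool (E v j \<omega> = v) :: real)"
    and "expectation (\<lambda>\<omega>. of_bool (j \<le> m v \<omega>) * of_bool (E v j \<omega> = v) :: real) \<le> (2 * real j + \<bar>\<delta>\<bar>) / (\<kappa> * real v)"
proof -
  define Z where "Z \<omega> = (of_bool (j \<le> m v \<omega>) :: real)" for \<omega>
  have Z: "Z \<in> borel_measurable (pa_sigma P m (PG v (j - 1)))"
    unfolding Z_def[abs_def] by (rule out_degree_indicator_measurable[OF assms(1)])
  have Z1: "AE \<omega> in P. \<bar>Z \<omega>\<bar> \<le> 1" by (simp add: Z_def)
  have Z0: "Z \<omega> = 0" if "m v \<omega> < j" for \<omega> using that by (simp add: Z_def)
  have p_int: "integrable P (\<lambda>\<omega>. Z \<omega> * attach v j v \<omega>)"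
    by (rule attachment_zero_mean(1)[OF assms Z Z1 Z0])
  have p_eq: "expectation (\<lambda>\<omega>. Z \<omega> * of_bool (E v j \<omega> = v)) = expectation (\<lambda>\<omega>. Z \<omega> * attach v j v \<omega>)"
    by (rule attachment_zero_mean(2)[OF assms Z Z1 Z0])
  have meas: "(\<lambda>\<omega>. Z \<omega> * of_bool (E v j \<omega> = v)) \<in> borel_measurable P"
    by (intro borel_measurable_times measurable_from_subalg[OF pa_sigma_subalgebra[OF assms(1)] Z]
      measurable_compose[OF E_measurable[OF assms]]) simp
  show "integrable P (\<lambda>\<omega>. of_bool (j \<le> m v \<omega>) * of_bool (E v j \<omega> = v) :: real)"
    using integrable_AE_bounded[OF meas, of 1] by (simp add: Z_def)
  have "expectation (\<lambda>\<omega>. Z \<omega> * attach v j v \<omega>) \<le> expectation (\<lambda>\<omega>. (2 * real j + \<bar>\<delta>\<bar>) / (\<kappa> * real v))"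
  proof (rule integral_mono_AE[OF p_int])
    show "AE \<omega> in P. Z \<omega> * attach v j v \<omega> \<le> (2 * real j + \<bar>\<delta>\<bar>) / (\<kappa> * real v)"
      using AE_regular AE_attach_to_existing
    proof eventually_elim
      case (elim \<omega>)
      have pos: "\<kappa> * real v > 0" using \<kappa>_pos assms by simp
      have nn: "0 \<le> (2 * real j + \<bar>\<delta>\<bar>) / (\<kappa> * real v)" using pos by (intro divide_nonneg_pos) auto
      show ?case
      proof (cases "j \<le> m v \<omega>")
        case True
        have "pa_loop_weight model \<delta> (\<lambda>i. m i \<omega>) (PG v (j - 1) \<omega>) v j \<le> 2 * real j + \<bar>\<delta>\<bar>"
          by (rule loop_weight_bound[where b = "\<lambda>i. m i \<omega>", OF vdegree_PG(1)[OF elim(2) assms(1), of "j - 1"] assms(2) True])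
        moreover have "\<kappa> * real v \<le> c v j \<omega>" by (rule norm_lower_bound[OF elim(1) assms True])
        ultimately have "pa_loop_weight model \<delta> (\<lambda>i. m i \<omega>) (PG v (j - 1) \<omega>) v j / c v j \<omega> \<le> (2 * real j + \<bar>\<delta>\<bar>) / (\<kappa> * real v)"
          using pos by (intro order_trans[OF divide_right_mono divide_left_mono]) auto
        then show ?thesis using True by (simp add: Z_def pa_attach_prob_def)
      next
        case False
        then show ?thesis using nn by (simp add: Z_def)
      qed
    qed
  qed (rule integrable_const)
  then show "expectation (\<lambda>\<omega>. of_bool (j \<le> m v \<omega>) * of_bool (E v j \<omega> = v) :: real) \<le> (2 * real j + \<bar>\<delta>\<bar>) / (\<kappa> * real v)"
    using p_eq by (simp add: Z_def prob_space)
qed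

text \<open>The degree of v at the end of its step differs from m v only after a self-loop. Either a
  loop occurs among the first K edges, with probability O(1 / v) for fixed K, or m v > K and then m
  v - K \<ge> 1 dominates the error. K is fixed before v grows.\<close>

lemma self_loops_sublinear:
  "L1_sublinear (\<lambda>n \<omega>. \<Sum>v=3..n. of_bool (vdegree (G v \<omega>) v = k) - of_bool (m v \<omega> = k))"
proof (rule L1_sublinear_sum)
  let ?h = "\<lambda>v \<omega>. of_bool (vdegree (G v \<omega>) v = k) - of_bool (m v \<omega> = k) :: real"
  have meas: "?h v \<in> borel_measurable P" if "v \<ge> 3" for v
    using that by (intro borel_measurable_diff measurable_compose[OF G_measurable] measurable_compose[OF m_measurable]) auto
  show int: "integrable P (?h v)" if "v \<ge> 3" for v
    by (rule integrable_AE_bounded[OF meas[OF that], of 1]) auto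
  have bound: "expectation (\<lambda>\<omega>. \<bar>?h v \<omega>\<bar>)
      \<le> measure_pmf.expectation M (\<lambda>i. real (i - K)) + real K * ((2 * real K + \<bar>\<delta>\<bar>) / (\<kappa> * real v))" if v: "v \<ge> 3" for v K
  proof -
    let ?l = "\<lambda>j \<omega>. of_bool (j \<le> m v \<omega>) * of_bool (E v j \<omega> = v) :: real"
    have tail: "integrable P (\<lambda>\<omega>. real (m v \<omega> - K))"
      "expectation (\<lambda>\<omega>. real (m v \<omega> - K)) = measure_pmf.expectation M (\<lambda>i. real (i - K))"
      using m_expectation[OF v, of "\<lambda>i. real (i - K)"] tail_integrable by auto
    have l_int: "integrable P (?l j)" if "j \<in> {1..K}" for j
      using self_loop_probability(1)[OF v, of j] that by auto
    have "expectation (\<lambda>\<omega>. \<bar>?h v \<omega>\<bar>) \<le> expectation (\<lambda>\<omega>. real (m v \<omega> - K) + (\<Sum>j=1..K. ?l j \<omega>))"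
    proof (rule integral_mono_AE)
      show "integrable P (\<lambda>\<omega>. \<bar>?h v \<omega>\<bar>)" by (rule integrable_abs[OF int[OF v]])
      show "integrable P (\<lambda>\<omega>. real (m v \<omega> - K) + (\<Sum>j=1..K. ?l j \<omega>))"
        by (intro Bochner_Integration.integrable_add tail Bochner_Integration.integrable_sum l_int)
      show "AE \<omega> in P. \<bar>?h v \<omega>\<bar> \<le> real (m v \<omega> - K) + (\<Sum>j=1..K. ?l j \<omega>)"
        using AE_attach_to_existing
      proof eventually_elim
        case (elim \<omega>)
        have nn: "(\<Sum>j=1..K. ?l j \<omega>) \<ge> 0" by (intro sum_nonneg) auto
        show ?case
        proof (cases "vdegree (G v \<omega>) v = m v \<omega>")
          case True
          then show ?thesis using nn by simp
        next
          case False
          then have "vdegree (PG v (m v \<omega>) \<omega>) v \<noteq> m v \<omega>"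
            using pa_graph_eq_partial[OF v, of G0 m E \<omega>] by simp
          then obtain j where j: "j \<in> {1..m v \<omega>}" "E v j \<omega> = v"
            using vdegree_PG(2)[OF elim v, of "m v \<omega>"] by blast
          have h1: "\<bar>?h v \<omega>\<bar> \<le> 1" by auto
          show ?thesis
          proof (cases "m v \<omega> \<le> K")
            case True
            have "?l j \<omega> \<le> (\<Sum>j=1..K. ?l j \<omega>)"
              by (rule member_le_sum) (use j True in auto)
            then have "1 \<le> (\<Sum>j=1..K. ?l j \<omega>)" using j by simp
            then show ?thesis using h1 by linarith
          next
            case False
            then have "real (m v \<omega> - K) \<ge> 1" by linarith
            then show ?thesis using h1 nn by linarith
          qed
        qed
      qed
    qed
    also have "\<dots> = measure_pmf.expectation M (\<lambda>i. real (i - K)) + (\<Sum>j=1..K. expectation (?l j))"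
    proof -
      have "expectation (\<lambda>\<omega>. real (m v \<omega> - K) + (\<Sum>j=1..K. ?l j \<omega>))
          = expectation (\<lambda>\<omega>. real (m v \<omega> - K)) + expectation (\<lambda>\<omega>. \<Sum>j=1..K. ?l j \<omega>)"
        by (rule Bochner_Integration.integral_add[OF tail(1) Bochner_Integration.integrable_sum[OF l_int]])
      also have "expectation (\<lambda>\<omega>. \<Sum>j=1..K. ?l j \<omega>) = (\<Sum>j=1..K. expectation (?l j))"
        by (rule Bochner_Integration.integral_sum[OF l_int])
      finally show ?thesis by (simp only: tail(2))
    qed
    also have "(\<Sum>j=1..K. expectation (?l j)) \<le> (\<Sum>j=1..K. (2 * real K + \<bar>\<delta>\<bar>) / (\<kappa> * real v))"
    proof (rule sum_mono)
      fix j assume j: "j \<in> {1..K}"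
      have "expectation (?l j) \<le> (2 * real j + \<bar>\<delta>\<bar>) / (\<kappa> * real v)"
        using self_loop_probability(2)[OF v, of j] j by auto
      also have "\<dots> \<le> (2 * real K + \<bar>\<delta>\<bar>) / (\<kappa> * real v)"
        using j \<kappa>_pos by (intro divide_right_mono) auto
      finally show "expectation (?l j) \<le> (2 * real K + \<bar>\<delta>\<bar>) / (\<kappa> * real v)" .
    qed
    finally show ?thesis by simp
  qed
  show "(\<lambda>v. expectation (\<lambda>\<omega>. \<bar>?h v \<omega>\<bar>)) \<longlonglongrightarrow> 0"
  proof (rule LIMSEQ_I)
    fix e :: real assume "e > 0"
    then have "\<forall>\<^sub>F K in sequentially. measure_pmf.expectation M (\<lambda>i. real (i - K)) < e / 2"
      using tail_tendsto_zero by (intro order_tendstoD(2)) auto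
    then obtain K where K: "measure_pmf.expectation M (\<lambda>i. real (i - K)) < e / 2"
      using eventually_happens'[OF sequentially_bot] by blast
    have "(\<lambda>v. real K * ((2 * real K + \<bar>\<delta>\<bar>) / \<kappa> / real v)) \<longlonglongrightarrow> real K * 0"
      by (intro tendsto_mult tendsto_const lim_const_over_n)
    then have "\<forall>\<^sub>F v in sequentially. real K * ((2 * real K + \<bar>\<delta>\<bar>) / \<kappa> / real v) < e / 2"
      using \<open>e > 0\<close> by (intro order_tendstoD(2)) auto
    then have "\<forall>\<^sub>F v in sequentially. norm (expectation (\<lambda>\<omega>. \<bar>?h v \<omega>\<bar>) - 0) < e"
      using eventually_ge_at_top[of 3]
    proof eventually_elim
      case (elim v)
      have "expectation (\<lambda>\<omega>. \<bar>?h v \<omega>\<bar>) < e"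
        using bound[OF elim(2), of K] elim(1) K unfolding divide_divide_eq_left by linarith
      moreover have "expectation (\<lambda>\<omega>. \<bar>?h v \<omega>\<bar>) \<ge> 0" by simp
      ultimately show ?case by (simp only: diff_0_right real_norm_def abs_of_nonneg)
    qed
    then show "\<exists>no. \<forall>v\<ge>no. norm (expectation (\<lambda>\<omega>. \<bar>?h v \<omega>\<bar>) - 0) < e"
      by (simp only: eventually_sequentially)
  qed
qed

section \<open>Limit law and induction over the degree\<close>

definition p :: "nat \<Rightarrow> real" where "p = limit_law \<theta> \<delta> l (pmf M)"

lemma p_zero: "k < l \<Longrightarrow> p k = 0"
  by (cases k) (auto simp: p_def)

lemma p_rec: "k \<ge> l \<Longrightarrow> k \<ge> 1 \<Longrightarrow> (\<theta> + real k + \<delta>) * p k = \<theta> * pmf M k + (real k - 1 + \<delta>) * p (k - 1)"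
proof -
  assume k: "k \<ge> l" "k \<ge> 1"
  then have "\<theta> + real k + \<delta> > 0" using l_\<delta> \<theta>_pos by linarith
  then show ?thesis using k by (cases k) (auto simp: p_def)
qed

lemma out_degree_le_degree:
  assumes "3 \<le> u" "u \<le> n"
  shows "m u \<omega> \<le> vdegree (G n \<omega>) u"
proof -
  have "j \<le> vdegree (PG u j \<omega>) u" for j
    by (induction j) (auto simp: pa_partial_graph_Suc vdegree_snoc)
  moreover obtain ys where "G n \<omega> = G u \<omega> @ ys"
    using G_prefix[of u "n - u" \<omega>] assms by auto
  ultimately show ?thesis
    using pa_graph_eq_partial[OF assms(1), of G0 m E \<omega>] by (simp add: vdegree_append trans_le_add1)
qed

text \<open>Every vertex from 3 on has degree at least its out-degree, hence at least l; only the
  two initial vertices can have smaller degree. This is the base of the induction.\<close>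

lemma deg_count_small:
  assumes "regular \<omega>" "k < l"
  shows "A k n \<omega> \<le> 2"
proof -
  have "A k n \<omega> \<le> (\<Sum>u=1..n. of_bool (u \<in> {1, 2}))"
    unfolding deg_count_def
  proof (rule sum_mono)
    fix u assume u: "u \<in> {1..n}"
    have "vdegree (G n \<omega>) u \<noteq> k" if "u \<ge> 3"
      using out_degree_le_degree[OF that, of n \<omega>] u assms that by (auto simp: regular_def)
    then show "of_bool (vdegree (G n \<omega>) u = k) \<le> (of_bool (u \<in> {1, 2}) :: real)"
      using u by (cases "u \<ge> 3") auto
  qed
  also have "\<dots> = real (card ({1..n} \<inter> {1, 2}))"
    by (simp add: sum.If_cases of_bool_def Int_def)
  also have "\<dots> \<le> real (card {1, 2::nat})"
    by (intro of_nat_mono card_mono) auto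
  finally show ?thesis by simp
qed

text \<open>Vertices 1 and 2 are present from the start, so increments begin at 3; the minimum makes
  the identity hold for n < 3 as well, where the sum is empty.\<close>

lemma deg_count_telescope:
  "A k n \<omega> = A k (min n 2) \<omega>
    + (\<Sum>v=3..n. A k v \<omega> - A k (v - 1) \<omega>)"
proof (induction n)
  case (Suc n)
  show ?case
  proof (cases "Suc n \<ge> 3")
    case True
    then have min: "min (Suc n) 2 = min n 2" by simp
    have "(\<Sum>v=3..Suc n. A k v \<omega> - A k (v - 1) \<omega>)
        = (\<Sum>v=3..n. A k v \<omega> - A k (v - 1) \<omega>) + (A k (Suc n) \<omega> - A k n \<omega>)"
      using True by (simp add: sum.nat_ivl_Suc')
    then show ?thesis unfolding min using Suc by linarith
  qed simp
qed simp

text \<open>Only inflow from degree k - 1 uses the induction hypothesis. The outflow from degree k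
  is kept on the left as a linear feedback, which the recursion lemma resolves with a = (k +
  \<delta>) / \<theta>.\<close>

lemma degree_count_convergence: "L1_sublinear (\<lambda>n \<omega>. A k n \<omega> - p k * real n)"
proof (induction k rule: less_induct)
  case (less k)
  have int: "integrable P (\<lambda>\<omega>. deg_count k (G n \<omega>) w)" for k n w
    by (rule integrable_AE_bounded[OF deg_count_G_measurable, of _ _ _ "real w"])
      (use deg_count_bounds in \<open>auto simp: abs_of_nonneg\<close>)
  show ?case
  proof (cases "k < l")
    case True
    show ?thesis
    proof (rule L1_sublinear_bound[OF L1_sublinear_const[of "\<lambda>_. 2"]])
      show "AE \<omega> in P. \<bar>A k n \<omega> - p k * real n\<bar> \<le> \<bar>2\<bar>" for n
        using AE_regular
        by eventually_elim (use deg_count_small[OF _ True] deg_count_bounds(1) in \<open>simp add: p_zero[OF True]\<close>)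
      show "(\<lambda>\<omega>. A k n \<omega> - p k * real n) \<in> borel_measurable P" for n
        by (intro borel_measurable_diff deg_count_G_measurable) simp
    qed simp
  next
    case False
    then have k: "k \<ge> l" "k \<ge> 1" using l_ge_1 by auto
    define a b f where "a = (real k + \<delta>) / \<theta>" and "b = (real k - 1 + \<delta>) / \<theta>" and "f = pmf M k + b * p (k - 1)"
    have k\<delta>: "real k + \<delta> > 0" using k l_\<delta> by linarith
    have a: "a > 0" using k\<delta> \<theta>_pos by (simp add: a_def)
    have \<theta>ab: "\<theta> * a = real k + \<delta>" "\<theta> * b = real k - 1 + \<delta>"
      using \<theta>_pos by (simp_all add: a_def b_def)
    have p_eq: "f / (1 + a) = p k"
    proof -
      have "f / (1 + a) = (\<theta> * f) / (\<theta> * (1 + a))" using \<theta>_pos by simp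
      also have "\<theta> * (1 + a) = \<theta> + real k + \<delta>" by (simp add: \<theta>ab distrib_left)
      also have "\<theta> * f = (\<theta> + real k + \<delta>) * p k" using p_rec[OF k] by (simp add: f_def \<theta>ab distrib_left mult.assoc[symmetric])
      finally show ?thesis using k\<delta> \<theta>_pos by simp
    qed
    have "L1_sublinear (\<lambda>n \<omega>. A k n \<omega> + (\<Sum>v=3..n. a / real v * A k (v - 1) \<omega>) - f * real n)"
    proof -
      \<comment> \<open>The boundary terms: the counts among at most two vertices, and the constant
        f summed over 3, ..., n instead of 1, ..., n.\<close>
      have init: "L1_sublinear (\<lambda>n \<omega>. A k (min n 2) \<omega> + f * (real (card {3..n}) - real n))"
      proof (rule L1_sublinear_bound[OF L1_sublinear_const[of "\<lambda>_. 2 + \<bar>f\<bar> * 2"]])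
        fix n
        show "(\<lambda>\<omega>. A k (min n 2) \<omega> + f * (real (card {3..n}) - real n)) \<in> borel_measurable P"
          by (intro borel_measurable_add deg_count_G_measurable) simp
        show "AE \<omega> in P. \<bar>A k (min n 2) \<omega> + f * (real (card {3..n}) - real n)\<bar> \<le> \<bar>2 + \<bar>f\<bar> * 2\<bar>"
        proof (rule AE_I2)
          fix \<omega>
          define x y where "x = A k (min n 2) \<omega>" and "y = real (card {3..n}) - real n"
          have x: "0 \<le> x" "x \<le> 2" using deg_count_bounds[of k "G (min n 2) \<omega>" "min n 2"] by (auto simp: x_def)
          have y: "\<bar>y\<bar> \<le> 2" unfolding y_def by (cases "n \<ge> 2") (auto simp: of_nat_diff)
          have "\<bar>f * y\<bar> \<le> \<bar>f\<bar> * 2" unfolding abs_mult using y by (intro mult_left_mono) auto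
          then have "\<bar>x + f * y\<bar> \<le> \<bar>2 + \<bar>f\<bar> * 2\<bar>" using x by linarith
          then show "\<bar>A k (min n 2) \<omega> + f * (real (card {3..n}) - real n)\<bar> \<le> \<bar>2 + \<bar>f\<bar> * 2\<bar>"
            by (simp only: x_def y_def)
        qed
      qed simp
      have lln: "L1_sublinear (\<lambda>n \<omega>. \<Sum>v=3..n. of_bool (m v \<omega> = k) - pmf M k)"
      proof -
        have "measure_pmf.expectation M (\<lambda>i. of_bool (i = k)) = pmf M k"
        proof -
          have "(\<lambda>i. of_bool (i = k) :: real) = indicator {k}" by (auto simp: indicator_def)
          then show ?thesis by (simp add: measure_pmf_single)
        qed
        moreover have "integrable (measure_pmf M) (\<lambda>i. of_bool (i = k) :: real)"
          by (rule measure_pmf.integrable_const_bound[of _ 1]) auto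
        ultimately show ?thesis
          using L1_law_of_large_numbers[OF m_indep m_law, of "\<lambda>i. of_bool (i = k)"] by simp
      qed
      \<comment> \<open>Dividing by v while the count has v - 1 vertices leaves an error p (k - 1) /
        v besides the induction hypothesis.\<close>
      have prev: "L1_sublinear (\<lambda>n \<omega>. \<Sum>v=3..n. A (k - 1) (v - 1) \<omega> / real v - p (k - 1))"
      proof (rule L1_sublinear_sum)
        define W where "W n \<omega> = A (k - 1) n \<omega> - p (k - 1) * real n" for n \<omega>
        have W: "L1_sublinear W" unfolding W_def[abs_def] using less.IH[of "k - 1"] k by simp
        show int': "integrable P (\<lambda>\<omega>. A (k - 1) (v - 1) \<omega> / real v - p (k - 1))" for v
          by (intro Bochner_Integration.integrable_diff integrable_divide int) simp
        show "(\<lambda>v. expectation (\<lambda>\<omega>. \<bar>A (k - 1) (v - 1) \<omega> / real v - p (k - 1)\<bar>)) \<longlonglongrightarrow> 0"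
        proof (rule tendsto_sandwich[OF _ _ tendsto_const])
          show "(\<lambda>v. expectation (\<lambda>\<omega>. \<bar>W (v - 1) \<omega>\<bar>) / real v + \<bar>p (k - 1)\<bar> / real v) \<longlonglongrightarrow> 0"
            using tendsto_add[OF L1_sublinear_shift[OF W] lim_const_over_n[of "\<bar>p (k - 1)\<bar>"]] by simp
          show "\<forall>\<^sub>F v in sequentially. expectation (\<lambda>\<omega>. \<bar>A (k - 1) (v - 1) \<omega> / real v - p (k - 1)\<bar>)
              \<le> expectation (\<lambda>\<omega>. \<bar>W (v - 1) \<omega>\<bar>) / real v + \<bar>p (k - 1)\<bar> / real v"
            using eventually_gt_at_top[of 0]
          proof eventually_elim
            case (elim v)
            have "expectation (\<lambda>\<omega>. \<bar>A (k - 1) (v - 1) \<omega> / real v - p (k - 1)\<bar>)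
                \<le> expectation (\<lambda>\<omega>. \<bar>W (v - 1) \<omega>\<bar> / real v + \<bar>p (k - 1)\<bar> / real v)"
            proof (rule integral_mono)
              show "integrable P (\<lambda>\<omega>. \<bar>A (k - 1) (v - 1) \<omega> / real v - p (k - 1)\<bar>)"
                by (rule integrable_abs[OF int'])
              show "integrable P (\<lambda>\<omega>. \<bar>W (v - 1) \<omega>\<bar> / real v + \<bar>p (k - 1)\<bar> / real v)"
                using L1_sublinearD(1)[OF W] by simp
              fix \<omega>
              have "A (k - 1) (v - 1) \<omega> / real v - p (k - 1) = W (v - 1) \<omega> / real v - p (k - 1) / real v"
              proof -
                have alg: "x / s - y = (x - y * (s - 1)) / s - y / s" if "s > 0" for x s y :: real
                  using that by (simp add: field_simps)
                have v: "real (v - 1) = real v - 1" using elim by simp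
                show ?thesis unfolding W_def v by (rule alg) (use elim in simp)
              qed
              then show "\<bar>A (k - 1) (v - 1) \<omega> / real v - p (k - 1)\<bar> \<le> \<bar>W (v - 1) \<omega>\<bar> / real v + \<bar>p (k - 1)\<bar> / real v"
                using abs_triangle_ineq4[of "W (v - 1) \<omega> / real v" "p (k - 1) / real v"] by simp
            qed
            also have "\<dots> = expectation (\<lambda>\<omega>. \<bar>W (v - 1) \<omega>\<bar>) / real v + \<bar>p (k - 1)\<bar> / real v"
              using L1_sublinearD(1)[OF W] by (simp add: prob_space)
            finally show ?case .
          qed
        qed simp
      qed
      \<comment> \<open>Decomposition of the defect of the linear recursion: boundary, martingale
        noise, self-loops, fluctuation of the out-degree frequencies, the two drift approximations,
        and the replacement of A (k - 1) by its limit. Each summand is sublinear.\<close>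
      have eq: "A k n \<omega> + (\<Sum>v=3..n. a / real v * A k (v - 1) \<omega>) - f * real n
        = (A k (min n 2) \<omega> + f * (real (card {3..n}) - real n))
          + (\<Sum>v=3..n. \<Sum>j=1..m v \<omega>. edge_noise k v j \<omega>)
          + (\<Sum>v=3..n. of_bool (vdegree (G v \<omega>) v = k) - of_bool (m v \<omega> = k))
          + (\<Sum>v=3..n. of_bool (m v \<omega> = k) - pmf M k)
          + (real k - 1 + \<delta>) * (\<Sum>v=3..n. edge_drift (k - 1) v \<omega> - A (k - 1) (v - 1) \<omega> / (\<theta> * real v))
          - (real k + \<delta>) * (\<Sum>v=3..n. edge_drift k v \<omega> - A k (v - 1) \<omega> / (\<theta> * real v))
          + b * (\<Sum>v=3..n. A (k - 1) (v - 1) \<omega> / real v - p (k - 1))" for n \<omega>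
      proof -
        have step: "A k v \<omega> - A k (v - 1) \<omega> + a / real v * A k (v - 1) \<omega> - f
          = (\<Sum>j=1..m v \<omega>. edge_noise k v j \<omega>) + (of_bool (vdegree (G v \<omega>) v = k) - of_bool (m v \<omega> = k))
            + (of_bool (m v \<omega> = k) - pmf M k)
            + (real k - 1 + \<delta>) * (edge_drift (k - 1) v \<omega> - A (k - 1) (v - 1) \<omega> / (\<theta> * real v))
            - (real k + \<delta>) * (edge_drift k v \<omega> - A k (v - 1) \<omega> / (\<theta> * real v))
            + b * (A (k - 1) (v - 1) \<omega> / real v - p (k - 1))" if "v \<in> {3..n}" for v
        proof -
          have v: "v \<ge> 3" using that by simp
          define X Y where "X = A k (v - 1) \<omega>" and "Y = A (k - 1) (v - 1) \<omega>"
          have "a / real v * X = (real k + \<delta>) * (X / (\<theta> * real v))"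
            and "b * (Y / real v) = (real k - 1 + \<delta>) * (Y / (\<theta> * real v))"
            by (simp_all add: a_def b_def)
          then show ?thesis
            unfolding X_def Y_def
            using sum_edge_noise[OF k(2) v, of \<omega>] deg_count_increment[OF v, of k \<omega>]
            unfolding f_def right_diff_distrib by linarith
        qed
        have sum_combine: "(\<Sum>v=3..n. h1 v + h2 v + h3 v + q * h4 v - r * h5 v + s * h6 v)
            = (\<Sum>v=3..n. h1 v) + (\<Sum>v=3..n. h2 v) + (\<Sum>v=3..n. h3 v) + q * (\<Sum>v=3..n. h4 v) - r * (\<Sum>v=3..n. h5 v) + s * (\<Sum>v=3..n. h6 v)"
          for h1 h2 h3 h4 h5 h6 :: "nat \<Rightarrow> real" and q r s
          by (simp add: sum.distrib sum_subtractf sum_distrib_left)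
        have "A k n \<omega> + (\<Sum>v=3..n. a / real v * A k (v - 1) \<omega>) - f * real n
          = (A k (min n 2) \<omega> + f * (real (card {3..n}) - real n))
          + (\<Sum>v=3..n. A k v \<omega> - A k (v - 1) \<omega> + a / real v * A k (v - 1) \<omega> - f)"
          unfolding deg_count_telescope[of k n \<omega>] sum.distrib sum_subtractf by (simp add: algebra_simps)
        also have "(\<Sum>v=3..n. A k v \<omega> - A k (v - 1) \<omega> + a / real v * A k (v - 1) \<omega> - f)
          = (\<Sum>v=3..n. (\<Sum>j=1..m v \<omega>. edge_noise k v j \<omega>) + (of_bool (vdegree (G v \<omega>) v = k) - of_bool (m v \<omega> = k))
            + (of_bool (m v \<omega> = k) - pmf M k)
            + (real k - 1 + \<delta>) * (edge_drift (k - 1) v \<omega> - A (k - 1) (v - 1) \<omega> / (\<theta> * real v))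
            - (real k + \<delta>) * (edge_drift k v \<omega> - A k (v - 1) \<omega> / (\<theta> * real v))
            + b * (A (k - 1) (v - 1) \<omega> / real v - p (k - 1)))"
          by (intro sum.cong refl step)
        finally show ?thesis
          unfolding sum_combine by (simp only: add.assoc diff_conv_add_uminus)
      qed
      show ?thesis unfolding eq
        by (intro L1_sublinear_add L1_sublinear_diff L1_sublinear_cmult init edge_noise_sublinear[OF k(2)]
          self_loops_sublinear lln edge_drift_sublinear prev)
    qed
    from L1_linear_recursion[OF int less_imp_le[OF a] this] show ?thesis by (simp only: p_eq)
  qed
qed

lemma degree_fraction_converges_in_prob:
  "converges_in_prob P (\<lambda>n \<omega>. (\<Sum>v=1..n. of_bool (vdegree (G n \<omega>) v = k)) / real n) (\<lambda>_. p k)"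
  unfolding converges_in_prob_def deg_count_def[symmetric]
proof (intro allI impI)
  fix e :: real assume "e > 0"
  define W where "W n \<omega> = A k n \<omega> - p k * real n" for n \<omega>
  have W: "L1_sublinear W" unfolding W_def[abs_def] by (rule degree_count_convergence)
  show "(\<lambda>n. measure P {\<omega> \<in> space P. \<bar>A k n \<omega> / real n - p k\<bar> > e}) \<longlonglongrightarrow> 0"
  proof (rule tendsto_sandwich[OF _ _ tendsto_const])
    show "(\<lambda>n. expectation (\<lambda>\<omega>. \<bar>W n \<omega>\<bar>) / real n / e) \<longlonglongrightarrow> 0"
      using tendsto_divide[OF L1_sublinearD(2)[OF W] tendsto_const, of e] \<open>e > 0\<close> by simp
    show "\<forall>\<^sub>F n in sequentially. measure P {\<omega> \<in> space P. \<bar>A k n \<omega> / real n - p k\<bar> > e}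
        \<le> expectation (\<lambda>\<omega>. \<bar>W n \<omega>\<bar>) / real n / e"
      using eventually_gt_at_top[of 0]
    proof eventually_elim
      case (elim n)
      have en: "e * real n > 0" using elim \<open>e > 0\<close> by simp
      have int: "integrable P (\<lambda>\<omega>. \<bar>W n \<omega>\<bar>)" using L1_sublinearD(1)[OF W] by simp
      have [measurable]: "W n \<in> borel_measurable P" using L1_sublinearD(1)[OF W] by simp
      have "{\<omega> \<in> space P. \<bar>A k n \<omega> / real n - p k\<bar> > e} \<subseteq> {\<omega> \<in> space P. \<bar>W n \<omega>\<bar> \<ge> e * real n}"
      proof safe
        fix \<omega> assume "e < \<bar>A k n \<omega> / real n - p k\<bar>"
        moreover have "\<bar>W n \<omega>\<bar> = \<bar>A k n \<omega> / real n - p k\<bar> * real n"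
        proof -
          have "W n \<omega> = (A k n \<omega> / real n - p k) * real n" using elim by (simp add: W_def field_simps)
          then show ?thesis by (simp add: abs_mult)
        qed
        ultimately show "e * real n \<le> \<bar>W n \<omega>\<bar>" by (simp add: mult_right_mono)
      qed
      then have "measure P {\<omega> \<in> space P. \<bar>A k n \<omega> / real n - p k\<bar> > e} \<le> measure P {\<omega> \<in> space P. \<bar>W n \<omega>\<bar> \<ge> e * real n}"
        by (intro finite_measure_mono) measurable
      also have "\<dots> \<le> expectation (\<lambda>\<omega>. \<bar>W n \<omega>\<bar>) / (e * real n)"
        by (rule integral_Markov_inequality_measure[OF int, of "{}"]) (use en in auto)
      finally show ?case by (simp add: mult.commute)
    qed
  qed simp
qed

end

theorem mainTheorem5:
  fixes M :: "nat pmf" and L :: "real \<Rightarrow> real" and q \<tau>\<^sub>M \<delta> :: real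
    and model :: pa_model and P :: "'w measure" and G0 :: multigraph
    and m :: "nat \<Rightarrow> 'w \<Rightarrow> nat" and E :: "nat \<Rightarrow> nat \<Rightarrow> 'w \<Rightarrow> nat"
  assumes M_pos: "set_pmf M \<subseteq> {1..}"
    and q: "q > 1"
    and M_moment: "integrable (measure_pmf M) (\<lambda>k. real k powr q)"
    and L: "slowly_varying L"
    and M_tail: "\<And>k. k \<ge> 1 \<Longrightarrow> pmf M k = L (real k) * real k powr (- \<tau>\<^sub>M)"
    and \<tau>\<^sub>M: "\<tau>\<^sub>M \<ge> q"
    and \<delta>: "\<delta> > - real (Inf (set_pmf M))"
    and PA: "preferential_attachment P M \<delta> model G0 m E"
  defines "\<tau>\<^sub>e \<equiv> 3 + \<delta> / measure_pmf.expectation M real"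
  defines "\<tau> \<equiv> min \<tau>\<^sub>M \<tau>\<^sub>e"
  shows "\<exists>(p :: nat \<Rightarrow> real) (L' :: real \<Rightarrow> real). slowly_varying L' \<and>
    (\<forall>k\<ge>1.
      converges_in_prob P
        (\<lambda>n \<omega>. (\<Sum>v=1..n. of_bool (vdegree (pa_graph G0 m E n \<omega>) v = k)) / real n)
        (\<lambda>_. p k) \<and>
      p k = L' (real k) * real k powr (- \<tau>))"
proof -
  have "integrable (measure_pmf M) real"
  proof (rule Bochner_Integration.integrable_bound[OF M_moment])
    have "real k \<le> real k powr q" for k :: nat
      using q powr_mono[of 1 q "real k"] by (cases "k = 0") auto
    then show "AE k in measure_pmf M. norm (real k) \<le> norm (real k powr q)" by simp
  qed simp
  then interpret D: integrable_preferential_attachment P M \<delta> model G0 m E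
    using PA M_pos \<delta>
    by (simp add: integrable_preferential_attachment_def integrable_preferential_attachment_axioms_def)
  have "\<exists>L'. slowly_varying L' \<and> (\<forall>k\<ge>1. D.p k = L' (real k) * real k powr (- min \<tau>\<^sub>M (D.\<theta> + 1)))"
  proof (rule power_law_of_recursion[OF L M_tail pmf_nonneg _ D.\<theta>_pos D.l_\<delta> D.p_zero D.p_rec D.l_ge_1])
    show "pmf M k = 0" if "k < D.l" for k
      using D.l_le[of k] that by (auto simp: pmf_eq_0_set_pmf)
  qed auto
  moreover have "D.\<theta> + 1 = \<tau>\<^sub>e"
    by (simp add: \<tau>\<^sub>e_def D.\<theta>_def D.\<mu>_def)
  ultimately obtain L' where L': "slowly_varying L'" "\<And>k. k \<ge> 1 \<Longrightarrow> D.p k = L' (real k) * real k powr (- \<tau>)"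
    unfolding \<tau>_def by auto
  show ?thesis
    by (intro exI[of _ D.p] exI[of _ L'] conjI allI impI L' D.degree_fraction_converges_in_prob)
qed

end
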